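(* Let $n\ge2$ and let $\Bbbk$ be an algebraically closed field of characteristic zero. The monomials $$\prod_{I} m_I^{(l_{1,I})}\cdots m_I^{(l_{r_I,I})},\qquad 0\le l_{1,I}\le\dots\le l_{r_I,I},\qquad l_{1,I}\ge\sum_{J\prec I}k(I,J)\,r_J ,$$ (where $I,J$ run over nonempty proper subsets of $\{1,\dots,n\}$, $(r_I)$ runs over all tuples of non-negative integers, and the condition on $l_{1,I}$ is imposed for those $I$ with $r_I\ge 1$) are linearly independent as elements of the algebra $\mathbb W\subset\Bbbk[SL_n[[t]]]$ generated by all $m_I^{(k)}$.
   Context: $\Bbbk[SL_n[[t]]]$ is generated by $z_{ij}^{(k)}$, $1\le i,j\le n$, $k\ge0$, modulo all $s$-coefficients of $\det(z_{ij}(s))_{1\le i,j\le n}-1$, where $z_{ij}(s)=\sum_{k\ge0}z_{ij}^{(k)}s^k$. For a nonempty proper subset $I=\{i_1<\dots<i_k\}\subset\{1,\dots,n\}$ put $m_I(s)=\det(z_{i_p,q}(s))_{1\le p,q\le k}=\sum_{k\ge0}m_I^{(k)}s^k$ (minor in rows $I$ and columns $1,\dots,|I|$). Order: for nonempty subsets $I\neq J$, $I\prec J$ if $|I|<|J|$, or $|I|=|J|$ and the largest element of the symmetric difference of $I$ and $J$ belongs to $J$. The number $k(I,J)$ for $I\ne J$ is symmetric, $k(I,J)=k(J,I)$, and is defined as follows when $|I|>|J|$, or $|I|=|J|$ and $I\prec J$. Start with current row $I$; for $p=|J|,|J|-1,\dots,1$: if the current row is $I$ and $i_p>j_p$, change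 the current row to $J$; if the current row is $J$ and $j_p>i_p$, change the current row to $I$; otherwise do nothing. Then $k(I,J)$ is the number of row changes. *)

theory Defs
  imports
    "HOL-Library.Poly_Mapping"
    "HOL-Computational_Algebra.Polynomial"
    "HOL-Computational_Algebra.Formal_Power_Series"
    "HOL-Algebra.QuotRing"
    "HOL-Algebra.Embedded_Algebras"
    "HOL-Algebra.Generated_Rings"
    "Jordan_Normal_Form.Determinant"
begin

section \<open>The coordinate ring of the arc space of the special linear group\<close>

text \<open>
  A variable is a triple \<open>(i, j, k)\<close>, standing for the coordinate of \<open>t\<^sup>k\<close> in the matrix entry
  \<open>(i, j)\<close>; rows and columns are numbered from \<open>1\<close>. Since \<open>n\<close> is a term, the polynomial ring in
  the variables with \<open>i, j \<in> {1..n}\<close> is a carrier inside the ring of all finitely supported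
  polynomials.
\<close>

type_synonym 'a arc_poly = "((nat \<times> nat \<times> nat) \<Rightarrow>\<^sub>0 nat) \<Rightarrow>\<^sub>0 'a"

definition arc_poly_ring :: "nat \<Rightarrow> ('a::comm_ring_1) arc_poly ring" where
  "arc_poly_ring n =
    \<lparr>carrier = {p. \<forall>m \<in> Poly_Mapping.keys p. Poly_Mapping.keys m \<subseteq> {1..n} \<times> {1..n} \<times> UNIV},
     monoid.mult = (*), one = 1, ring.zero = 0, add = (+)\<rparr>"

definition arc_var :: "nat \<Rightarrow> nat \<Rightarrow> nat \<Rightarrow> ('a::comm_ring_1) arc_poly" where
  "arc_var i j k = Poly_Mapping.single (Poly_Mapping.single (i, j, k) 1) 1"

definition arc_const :: "'a::comm_ring_1 \<Rightarrow> 'a arc_poly" where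
  "arc_const c = Poly_Mapping.single 0 c"

definition arc_entry :: "nat \<Rightarrow> nat \<Rightarrow> ('a::comm_ring_1) arc_poly fps" where
  "arc_entry i j = Abs_fps (arc_var i j)"

text \<open>
  The minor in rows \<open>I\<close> and columns \<open>1, \<dots>, card I\<close>; matrices of the type \<open>mat\<close> and lists are
  indexed from \<open>0\<close>, which accounts for the shift in the column.
\<close>

definition arc_minor :: "nat set \<Rightarrow> ('a::comm_ring_1) arc_poly fps" where
  "arc_minor I =
    det (mat (card I) (card I) (\<lambda>(p, q). arc_entry (sorted_list_of_set I ! p) (q + 1)))"

definition sl_relations :: "nat \<Rightarrow> ('a::comm_ring_1) arc_poly set" where
  "sl_relations n =
    range (fps_nth (det (mat n n (\<lambda>(p, q). arc_entry (p + 1) (q + 1))) - 1))"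

definition sl_ideal :: "nat \<Rightarrow> ('a::comm_ring_1) arc_poly set" where
  "sl_ideal n = Idl\<^bsub>arc_poly_ring n\<^esub> (sl_relations n)"

definition sl_arc_ring :: "nat \<Rightarrow> ('a::comm_ring_1) arc_poly set ring" where
  "sl_arc_ring n = arc_poly_ring n Quot sl_ideal n"

definition sl_class :: "nat \<Rightarrow> ('a::comm_ring_1) arc_poly \<Rightarrow> 'a arc_poly set" where
  "sl_class n p = sl_ideal n +>\<^bsub>arc_poly_ring n\<^esub> p"

definition sl_scalars :: "nat \<Rightarrow> ('a::comm_ring_1) arc_poly set set" where
  "sl_scalars n = range (\<lambda>c. sl_class n (arc_const c))"

definition minor_coeff :: "nat \<Rightarrow> nat set \<Rightarrow> nat \<Rightarrow> ('a::comm_ring_1) arc_poly set" where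
  "minor_coeff n I k = sl_class n (fps_nth (arc_minor I) k)"

definition proper_subsets :: "nat \<Rightarrow> nat set set" where
  "proper_subsets n = {I. I \<noteq> {} \<and> I \<subset> {1..n}}"

definition minor_algebra :: "nat \<Rightarrow> ('a::comm_ring_1) arc_poly set ring" where
  "minor_algebra n = (sl_arc_ring n)
    \<lparr>carrier := generate_ring (sl_arc_ring n)
       (sl_scalars n \<union> {minor_coeff n I k | I k. I \<in> proper_subsets n})\<rparr>"


section \<open>The order on subsets and the numbers k(I, J)\<close>

definition set_prec :: "nat set \<Rightarrow> nat set \<Rightarrow> bool" (infix \<open>\<prec>\<close> 50) where
  "I \<prec> J \<longleftrightarrow> card I < card J \<or>
    (card I = card J \<and> I \<noteq> J \<and> Max ((I - J) \<union> (J - I)) \<in> J)"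

text \<open>
  \<open>row_changes xs ys b p\<close> counts the row changes made while processing the columns
  \<open>p, p - 1, \<dots>, 1\<close>, where \<open>xs\<close> and \<open>ys\<close> list \<open>I\<close> and \<open>J\<close> increasingly and \<open>b\<close> says
  whether the current row is \<open>I\<close>. Column \<open>p + 1\<close> is at list position \<open>p\<close>.
\<close>

fun row_changes :: "nat list \<Rightarrow> nat list \<Rightarrow> bool \<Rightarrow> nat \<Rightarrow> nat" where
  "row_changes xs ys b 0 = 0"
| "row_changes xs ys b (Suc p) =
    (if b \<and> xs ! p > ys ! p then Suc (row_changes xs ys False p)
     else if \<not> b \<and> ys ! p > xs ! p then Suc (row_changes xs ys True p)
     else row_changes xs ys b p)"

definition k_ordered :: "nat set \<Rightarrow> nat set \<Rightarrow> nat" where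
  "k_ordered I J = row_changes (sorted_list_of_set I) (sorted_list_of_set J) True (card J)"

definition k_num :: "nat set \<Rightarrow> nat set \<Rightarrow> nat" where
  "k_num I J =
    (if card I > card J \<or> card I = card J \<and> I \<prec> J then k_ordered I J else k_ordered J I)"


section \<open>The monomials\<close>

text \<open>
  A monomial is given by a weakly increasing list \<open>l I\<close> of upper indices for every \<open>I\<close>, so that
  \<open>r\<^sub>I = length (l I)\<close>. The value of \<open>l\<close> outside the proper subsets is fixed, so that different
  index families really are different monomials.
\<close>

definition admissible :: "nat \<Rightarrow> (nat set \<Rightarrow> nat list) set" where
  "admissible n =
    {l. (\<forall>I. I \<notin> proper_subsets n \<longrightarrow> l I = []) \<and>
        (\<forall>I \<in> proper_subsets n. sorted (l I) \<and>
          (l I \<noteq> [] \<longrightarrow>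
            hd (l I) \<ge> (\<Sum>J \<in> {J \<in> proper_subsets n. J \<prec> I}. k_num I J * length (l J))))}"

definition minor_monomial ::
    "nat \<Rightarrow> (nat set \<Rightarrow> nat list) \<Rightarrow> ('a::comm_ring_1) arc_poly set" where
  "minor_monomial n l =
    (\<Otimes>\<^bsub>sl_arc_ring n\<^esub>I \<in> proper_subsets n.
       \<Otimes>\<^bsub>sl_arc_ring n\<^esub>p \<in> {..<length (l I)}. minor_coeff n I (l I ! p))"


section \<open>Well-definedness\<close>

lemma mem_arc_poly_ring:
  "p \<in> carrier (arc_poly_ring n) \<longleftrightarrow>
    (\<forall>m \<in> Poly_Mapping.keys p. Poly_Mapping.keys m \<subseteq> {1..n} \<times> {1..n} \<times> UNIV)"
  by (simp add: arc_poly_ring_def)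

lemma arc_poly_ring_closed:
  fixes p q :: "'a::comm_ring_1 arc_poly"
  shows "p \<in> carrier (arc_poly_ring n) \<Longrightarrow> q \<in> carrier (arc_poly_ring n) \<Longrightarrow>
      p + q \<in> carrier (arc_poly_ring n)"
    and "p \<in> carrier (arc_poly_ring n) \<Longrightarrow> q \<in> carrier (arc_poly_ring n) \<Longrightarrow>
      p * q \<in> carrier (arc_poly_ring n)"
    and "p \<in> carrier (arc_poly_ring n) \<Longrightarrow> - p \<in> carrier (arc_poly_ring n)"
    and "0 \<in> carrier (arc_poly_ring n :: 'a arc_poly ring)"
    and "arc_const c \<in> carrier (arc_poly_ring n :: 'a arc_poly ring)"
    and "i \<in> {1..n} \<Longrightarrow> j \<in> {1..n} \<Longrightarrow>
      arc_var i j k \<in> carrier (arc_poly_ring n :: 'a arc_poly ring)"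
proof -
  assume p: "p \<in> carrier (arc_poly_ring n)" and q: "q \<in> carrier (arc_poly_ring n)"
  show "p + q \<in> carrier (arc_poly_ring n)"
    using p q Poly_Mapping.keys_add[of p q] unfolding mem_arc_poly_ring by blast
  show "p * q \<in> carrier (arc_poly_ring n)"
    unfolding mem_arc_poly_ring
  proof
    fix m assume "m \<in> Poly_Mapping.keys (p * q)"
    then obtain a b where ab: "a \<in> Poly_Mapping.keys p" "b \<in> Poly_Mapping.keys q" "m = a + b"
      using keys_mult[of p q] by blast
    then show "Poly_Mapping.keys m \<subseteq> {1..n} \<times> {1..n} \<times> UNIV"
      using p q Poly_Mapping.keys_add[of a b] unfolding mem_arc_poly_ring by blast
  qed
next
  assume p: "p \<in> carrier (arc_poly_ring n)"
  then show "- p \<in> carrier (arc_poly_ring n)"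
    unfolding mem_arc_poly_ring by simp
qed (auto simp: mem_arc_poly_ring arc_const_def arc_var_def)

lemma arc_poly_ring_one_closed: "1 \<in> carrier (arc_poly_ring n :: 'a::comm_ring_1 arc_poly ring)"
  using arc_poly_ring_closed(5)[of 1 n] by (simp add: arc_const_def)

lemma cring_arc_poly_ring: "cring (arc_poly_ring n :: 'a::comm_ring_1 arc_poly ring)"
proof -
  let ?R = "arc_poly_ring n :: 'a arc_poly ring"
  have "\<exists>q \<in> carrier ?R. q + p = 0" if "p \<in> carrier ?R" for p
    using arc_poly_ring_closed(3)[OF that] by (intro bexI[of _ "- p"]) auto
  moreover have sel: "monoid.mult ?R = (*)" "one ?R = 1" "ring.zero ?R = 0" "add ?R = (+)"
    by (simp_all add: arc_poly_ring_def)
  ultimately show ?thesis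
    by (intro cringI abelian_groupI comm_monoidI)
      (auto simp: sel arc_poly_ring_closed arc_poly_ring_one_closed algebra_simps)
qed

lemma det_coeff_closed:
  fixes A :: "'a::comm_ring_1 arc_poly fps mat"
  assumes A: "\<And>i j k. i < dim_row A \<Longrightarrow> j < dim_row A \<Longrightarrow>
      fps_nth (A $$ (i, j)) k \<in> carrier (arc_poly_ring n)"
  shows "fps_nth (det A) k \<in> carrier (arc_poly_ring n)"
proof -
  let ?C = "carrier (arc_poly_ring n) :: 'a arc_poly set"
  let ?S = "{f. \<forall>k. fps_nth f k \<in> ?C}"
  note c = arc_poly_ring_closed(1-4)[where ?n = n] arc_poly_ring_one_closed[of n]
  have sum: "(\<And>x. x \<in> X \<Longrightarrow> f x \<in> ?C) \<Longrightarrow> sum f X \<in> ?C" for f and X :: "nat set"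
    by (induction X rule: infinite_finite_induct) (auto intro: c)
  have one: "1 \<in> ?S"
    by (auto intro: c simp: fps_one_nth)
  have mult: "f * g \<in> ?S" if "f \<in> ?S" "g \<in> ?S" for f g
    using that by (auto simp: fps_mult_nth intro!: sum c)
  have prod: "(\<And>x. x \<in> X \<Longrightarrow> f x \<in> ?S) \<Longrightarrow> prod f X \<in> ?S" for f and X :: "nat set"
  proof (induction X rule: infinite_finite_induct)
    case (insert x X)
    then show ?case using mult[of "f x" "prod f X"] by simp
  qed (use one in simp_all)
  have sumS: "(\<And>x. x \<in> X \<Longrightarrow> f x \<in> ?S) \<Longrightarrow> sum f X \<in> ?S" for f and X :: "(nat \<Rightarrow> nat) set"
    by (induction X rule: infinite_finite_induct) (auto intro: c)
  have sign: "signof s * f \<in> ?S" if "f \<in> ?S" for s :: "nat \<Rightarrow> nat" and f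
    using that by (cases s rule: sign_cases) (auto intro: c)
  have "det A \<in> ?S"
  proof (cases "dim_row A = dim_col A")
    case True
    have "signof s * (\<Prod>i = 0..<dim_row A. A $$ (i, s i)) \<in> ?S"
      if "s permutes {0..<dim_row A}" for s
    proof (intro sign prod)
      fix i assume "i \<in> {0..<dim_row A}"
      moreover from this have "s i < dim_row A"
        using permutes_in_image[OF that, of i] by simp
      ultimately show "A $$ (i, s i) \<in> ?S"
        using A by simp
    qed
    then show ?thesis
      unfolding det_def if_P[OF True] by (intro sumS) blast
  next
    case False
    then show ?thesis by (auto simp: det_def intro: c)
  qed
  then show ?thesis by simp
qed

text \<open>Without the following inclusion the generated ideal would degenerate.\<close>

lemma sl_relations_closed:
  "sl_relations n \<subseteq> carrier (arc_poly_ring n :: 'a::comm_ring_1 arc_poly ring)"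
proof -
  have "fps_nth (det (mat n n (\<lambda>(p, q). arc_entry (p + 1) (q + 1))) - 1) k
      \<in> carrier (arc_poly_ring n :: 'a arc_poly ring)" for k
  proof -
    have "fps_nth (det (mat n n (\<lambda>(p, q). arc_entry (p + 1) (q + 1)))) k
        \<in> carrier (arc_poly_ring n :: 'a arc_poly ring)"
      by (rule det_coeff_closed) (auto simp: arc_entry_def intro!: arc_poly_ring_closed)
    moreover have "- fps_nth 1 k \<in> carrier (arc_poly_ring n :: 'a arc_poly ring)"
      by (auto simp: fps_one_nth intro!: arc_poly_ring_closed arc_poly_ring_one_closed)
    ultimately show ?thesis
      using arc_poly_ring_closed(1) by fastforce
  qed
  then show ?thesis by (auto simp: sl_relations_def)
qed

lemma ideal_sl_ideal: "ideal (sl_ideal n) (arc_poly_ring n :: 'a::comm_ring_1 arc_poly ring)"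
  unfolding sl_ideal_def
  using ring.genideal_ideal[OF cring.axioms(1)[OF cring_arc_poly_ring] sl_relations_closed] .

lemma cring_sl_arc_ring: "cring (sl_arc_ring n :: 'a::comm_ring_1 arc_poly set ring)"
  unfolding sl_arc_ring_def
  by (rule ideal.quotient_is_cring[OF ideal_sl_ideal cring_arc_poly_ring])

lemma sl_class_closed:
  "p \<in> carrier (arc_poly_ring n) \<Longrightarrow> sl_class n p \<in> carrier (sl_arc_ring n)"
  for p :: "'a::comm_ring_1 arc_poly"
  unfolding sl_class_def sl_arc_ring_def FactRing_def A_RCOSETS_def' by auto

lemma minor_coeff_closed:
  assumes "I \<in> proper_subsets n"
  shows "minor_coeff n I k \<in> carrier (sl_arc_ring n :: 'a::comm_ring_1 arc_poly set ring)"
proof -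
  have sub: "I \<subseteq> {1..n}" and fin: "finite I"
    using assms finite_subset[of I "{1..n}"] by (auto simp: proper_subsets_def)
  have "card I \<le> n"
    using card_mono[OF _ sub] by simp
  moreover have "sorted_list_of_set I ! p \<in> {1..n}" if "p < card I" for p
    using nth_mem[of p "sorted_list_of_set I"] fin sub that by auto
  ultimately show ?thesis
    unfolding minor_coeff_def arc_minor_def
    by (intro sl_class_closed det_coeff_closed)
      (auto simp: arc_entry_def intro!: arc_poly_ring_closed)
qed

lemma ring_minor_algebra: "ring (minor_algebra n :: 'a::comm_ring_1 arc_poly set ring)"
  unfolding minor_algebra_def
  by (rule ring.generate_ring_is_ring[OF cring.axioms(1)[OF cring_sl_arc_ring]])
    (auto simp: sl_scalars_def intro!: minor_coeff_closed sl_class_closed arc_poly_ring_closed)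

end

theory Submission
  imports Defs "HOL-Library.Product_Lexorder" "HOL-Computational_Algebra.Fraction_Field"
begin

text \<open>
  Specializing \<open>z\<close> to the generic lower triangular matrix of determinant one reduces the claim to
  polynomials. For the weight giving \<open>z\<^sub>i\<^sub>j\<close> the value \<open>i j\<close>, the rearrangement inequality shows that the
  leading form of \<open>m\<^sub>I(s)\<close> is \<open>X\<^sub>I(s) = \<Prod>\<^sub>p z\<close> over the entries \<open>(i\<^sub>p, p)\<close>, so it suffices to treat
  the coefficients of the \<open>X\<^sub>I\<close>.

  These are separated by duality. A linear functional \<open>L\<close> turns the product of the series \<open>X\<close> at
  \<open>I\<^sub>a\<close> and \<open>s\<^sub>a\<close> into a series in the variables \<open>s\<^sub>a\<close>. For every family \<open>(I\<^sub>a)\<close> and every \<open>e\<close> there is an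
  \<open>L\<close> for which this series is the symmetrization of \<open>s\<^sup>e\<close> under the permutations preserving the family,
  times the product of the \<open>(s\<^sub>a - s\<^sub>b)\<close> to the power \<open>k(I\<^sub>a, I\<^sub>b)\<close> over \<open>b < a\<close>, while \<open>L\<close> vanishes on all
  families not above the given one in some order. Such functionals are built by adjoining the matrix
  entries one at a time: if \<open>n\<close> exceeds the elements of \<open>C\<close> and \<open>D\<close>, both of size \<open>p - 1\<close>, then
  \<open>k(C n, D n) = k(C, D)\<close> and \<open>k(C n, D) = k(C, D) + [D \<prec> C]\<close>, and the additional factors are supplied
  by quotients of alternating sums by Vandermonde products.

  If the variables are weighted increasingly along \<open>\<prec>\<close>, the leading monomial of the product has at
  \<open>s\<^sub>a\<close> the exponent \<open>\<Sum> k(I\<^sub>a, J) r\<^sub>J\<close> over \<open>J \<prec> I\<^sub>a\<close>. The exponents of an admissible monomial dominate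
  it, so each admissible monomial is the leading term of some such series, and the pairing is triangular.
\<close>

section \<open>Evaluation, linear functionals and leading forms of polynomials\<close>

text \<open>Lower triangular matrices suffice because the minor of a proper subset stops before
  column \<open>n\<close>: the entry \<open>(n, n)\<close> occurs in none of them, so it can absorb
  the determinant relation while all other entries stay free. The obstacle in adjoining the entry
  \<open>(n, p)\<close> is that its coefficients see only the multiset of exponents taken at the
  extended positions. The new dependence on these positions must therefore come from one polynomial
  symmetric in \<open>m\<close> auxiliary variables, and yet this polynomial has to detect which
  positions are extended. A product \<open>theta\<close> of differences detects it, vanishing as
  soon as an auxiliary variable sits at a position of too small rank, but it is not symmetric.
  Antisymmetrizing and dividing by the Vandermonde product restores the symmetry, and the division
  removes exactly those differences of \<open>theta\<close> that \<open>kprod\<close> must not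
  contain. What this yields at the target is symmetrized under a larger group than wanted. The
  single \<open>av N \<tau> e\<close> are recovered by an induction that divides by numbers of
  permutations; here characteristic zero is used.\<close>

abbreviation "lookup \<equiv> Poly_Mapping.lookup"
abbreviation "keys \<equiv> Poly_Mapping.keys"

definition evm :: "('v \<Rightarrow> 'r::comm_ring_1) \<Rightarrow> ('v \<Rightarrow>\<^sub>0 nat) \<Rightarrow> 'r" where
  "evm v m = (\<Prod>x\<in>keys m. v x ^ lookup m x)"

lemma evm_superset:
  assumes "finite A" "keys m \<subseteq> A"
  shows "evm v m = (\<Prod>x\<in>A. v x ^ lookup m x)"
  unfolding evm_def using assms
  by (intro prod.mono_neutral_left) (auto simp: in_keys_iff)

lemma evm_zero [simp]: "evm v 0 = 1"
  by (simp add: evm_def)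

lemma evm_add: "evm v (m + m') = evm v m * evm v m'"
proof -
  let ?A = "keys m \<union> keys m'"
  have "keys (m + m') \<subseteq> ?A" by (rule Poly_Mapping.keys_add)
  then have "evm v (m + m') = (\<Prod>x\<in>?A. v x ^ lookup (m + m') x)"
    by (intro evm_superset) auto
  moreover have "evm v m = (\<Prod>x\<in>?A. v x ^ lookup m x)" "evm v m' = (\<Prod>x\<in>?A. v x ^ lookup m' x)"
    by (intro evm_superset; auto)+
  ultimately show ?thesis
    by (simp add: lookup_add power_add prod.distrib)
qed

lemma evm_single [simp]: "evm v (Poly_Mapping.single x k) = v x ^ k"
  by (cases "k = 0") (auto simp: evm_def)

lemma poly_mapping_expand:
  "p = (\<Sum>m\<in>keys p. Poly_Mapping.single m (lookup p m))"
proof (rule poly_mapping_eqI)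
  fix k
  have "lookup (\<Sum>m\<in>keys p. Poly_Mapping.single m (lookup p m)) k
      = (\<Sum>m\<in>keys p. (if m = k then lookup p m else 0))"
    by (simp add: lookup_sum lookup_single when_def)
  also have "\<dots> = lookup p k"
    by (auto simp: in_keys_iff)
  finally show "lookup p k = lookup (\<Sum>m\<in>keys p. Poly_Mapping.single m (lookup p m)) k" ..
qed

text \<open>The target ring is a parameter because polynomials are evaluated later in polynomial
  rings, in polynomial rings over polynomial rings, and in a fraction field.\<close>

definition ins :: "('c::comm_ring_1 \<Rightarrow> 'r::comm_ring_1) \<Rightarrow> ('v \<Rightarrow> 'r) \<Rightarrow> (('v \<Rightarrow>\<^sub>0 nat) \<Rightarrow>\<^sub>0 'c) \<Rightarrow> 'r" where
  "ins f v p = (\<Sum>m\<in>keys p. f (lookup p m) * evm v m)"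

context comm_ring_hom
begin

lemma ins_superset:
  assumes "finite A" "keys p \<subseteq> A"
  shows "ins hom v p = (\<Sum>m\<in>A. hom (lookup p m) * evm v m)"
  unfolding ins_def using assms
  by (intro sum.mono_neutral_left) (auto simp: in_keys_iff)

lemma ins_add: "ins hom v (p + q) = ins hom v p + ins hom v q"
proof -
  let ?A = "keys p \<union> keys q"
  have "keys (p + q) \<subseteq> ?A" by (rule Poly_Mapping.keys_add)
  then have "ins hom v (p + q) = (\<Sum>m\<in>?A. hom (lookup (p + q) m) * evm v m)"
    by (intro ins_superset) auto
  moreover have "ins hom v p = (\<Sum>m\<in>?A. hom (lookup p m) * evm v m)"
      "ins hom v q = (\<Sum>m\<in>?A. hom (lookup q m) * evm v m)"
    by (intro ins_superset; auto)+
  ultimately show ?thesis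
    by (simp add: lookup_add hom_add algebra_simps sum.distrib)
qed

lemma ins_zero [simp]: "ins hom v 0 = 0"
  by (simp add: ins_def)

lemma ins_single [simp]: "ins hom v (Poly_Mapping.single m c) = hom c * evm v m"
  by (cases "c = 0") (auto simp: ins_def)

lemma ins_sum: "ins hom v (\<Sum>i\<in>A. f i) = (\<Sum>i\<in>A. ins hom v (f i))"
  by (induction A rule: infinite_finite_induct) (auto simp: ins_add)

lemma ins_mult: "ins hom v (p * q) = ins hom v p * ins hom v q"
proof -
  have "p * q = (\<Sum>m\<in>keys p. \<Sum>m'\<in>keys q. Poly_Mapping.single (m + m') (lookup p m * lookup q m'))"
    by (subst poly_mapping_expand[of p], subst poly_mapping_expand[of q])
      (simp add: sum_product mult_single)
  then have "ins hom v (p * q)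
      = (\<Sum>m\<in>keys p. \<Sum>m'\<in>keys q. hom (lookup p m * lookup q m') * evm v (m + m'))"
    by (simp only: ins_sum ins_single)
  also have "\<dots> = ins hom v p * ins hom v q"
    by (simp add: ins_def sum_product hom_mult evm_add algebra_simps)
  finally show ?thesis .
qed

lemma ins_hom: "comm_ring_hom (ins hom v)"
proof -
  have "ins hom v 1 = 1"
    using ins_single[of v 0 1] by (simp add: hom_one)
  then show ?thesis
    by unfold_locales (simp_all add: ins_add ins_mult)
qed

end

lemma comm_ring_hom_const:
  "comm_ring_hom (\<lambda>c::'a::comm_ring_1. Poly_Mapping.single (0::'v \<Rightarrow>\<^sub>0 nat) c)"
  by unfold_locales (auto simp: single_add mult_single)

definition pvar :: "'v \<Rightarrow> ('v \<Rightarrow>\<^sub>0 nat) \<Rightarrow>\<^sub>0 'c::comm_ring_1" where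
  "pvar x = Poly_Mapping.single (Poly_Mapping.single x 1) 1"

definition mon :: "('v \<Rightarrow>\<^sub>0 nat) \<Rightarrow> ('v \<Rightarrow>\<^sub>0 nat) \<Rightarrow>\<^sub>0 'c::comm_ring_1" where
  "mon m = Poly_Mapping.single m 1"

lemma mon_zero [simp]: "mon 0 = 1"
  by (simp add: mon_def)

lemma mon_add: "mon (m + m') = mon m * mon m'"
  by (simp add: mon_def mult_single)

lemma mon_sum: "mon (\<Sum>i\<in>A. f i) = (\<Prod>i\<in>A. mon (f i))"
  by (induction A rule: infinite_finite_induct) (auto simp: mon_add)

lemma pvar_power: "pvar x ^ k = mon (Poly_Mapping.single x k)"
proof (induction k)
  case (Suc k)
  have "Poly_Mapping.single x (Suc k) = Poly_Mapping.single x 1 + Poly_Mapping.single x k"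
    by (simp flip: single_add)
  with Suc show ?case
    by (simp add: mon_add) (simp add: mon_def pvar_def)
qed simp

lemma evm_pvar: "evm pvar m = mon m"
proof -
  have "evm pvar m = mon (\<Sum>x\<in>keys m. Poly_Mapping.single x (lookup m x))"
    by (simp add: evm_def pvar_power mon_sum)
  then show ?thesis using poly_mapping_expand[of m] by simp
qed

lemma lookup_mon: "lookup (mon m) k = (if k = m then 1 else 0)"
  by (simp add: mon_def lookup_single when_def)

lemma lookup_mult_mon:
  "lookup (p * mon m) k = (\<Sum>j\<in>keys p. if j + m = k then lookup p j else 0)"
proof -
  have "p * mon m = (\<Sum>j\<in>keys p. Poly_Mapping.single (j + m) (lookup p j))"
    by (subst poly_mapping_expand[of p]) (simp add: mon_def sum_distrib_right mult_single)
  then show ?thesis by (simp add: lookup_sum lookup_single when_def)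
qed

lemma lookup_mult_mon_add:
  fixes p :: "('v \<Rightarrow>\<^sub>0 nat) \<Rightarrow>\<^sub>0 'c::comm_ring_1"
  shows "lookup (p * mon m) (k + m) = lookup p k"
  unfolding lookup_mult_mon by (auto simp: in_keys_iff)

section \<open>Linear functionals on polynomials\<close>

definition pair :: "('m \<Rightarrow> 'c::comm_ring_1) \<Rightarrow> ('m \<Rightarrow>\<^sub>0 'c) \<Rightarrow> 'c" where
  "pair \<phi> p = (\<Sum>m\<in>keys p. \<phi> m * lookup p m)"

lemma pair_superset:
  assumes "finite A" "keys p \<subseteq> A"
  shows "pair \<phi> p = (\<Sum>m\<in>A. \<phi> m * lookup p m)"
  unfolding pair_def using assms
  by (intro sum.mono_neutral_left) (auto simp: in_keys_iff)

lemma pair_zero [simp]: "pair \<phi> 0 = 0"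
  by (simp add: pair_def)

lemma pair_add: "pair \<phi> (p + q) = pair \<phi> p + pair \<phi> q"
proof -
  let ?A = "keys p \<union> keys q"
  have "keys (p + q) \<subseteq> ?A" by (rule Poly_Mapping.keys_add)
  then have "pair \<phi> (p + q) = (\<Sum>m\<in>?A. \<phi> m * lookup (p + q) m)"
    by (intro pair_superset) auto
  moreover have "pair \<phi> p = (\<Sum>m\<in>?A. \<phi> m * lookup p m)" "pair \<phi> q = (\<Sum>m\<in>?A. \<phi> m * lookup q m)"
    by (intro pair_superset; auto)+
  ultimately show ?thesis
    by (simp add: lookup_add algebra_simps sum.distrib)
qed

lemma pair_sum: "pair \<phi> (\<Sum>i\<in>A. f i) = (\<Sum>i\<in>A. pair \<phi> (f i))"
  by (induction A rule: infinite_finite_induct) (auto simp: pair_add)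

lemma pair_single [simp]: "pair \<phi> (Poly_Mapping.single m c) = \<phi> m * c"
  by (cases "c = 0") (auto simp: pair_def)

lemma pair_const_mult:
  "pair \<phi> (Poly_Mapping.single (0::'m::comm_monoid_add) c * p) = c * pair \<phi> p"
proof -
  have "Poly_Mapping.single 0 c * p = (\<Sum>m\<in>keys p. Poly_Mapping.single m (c * lookup p m))"
    by (subst poly_mapping_expand[of p]) (simp add: sum_distrib_left mult_single)
  then have "pair \<phi> (Poly_Mapping.single 0 c * p) = (\<Sum>m\<in>keys p. \<phi> m * (c * lookup p m))"
    by (simp only: pair_sum pair_single)
  then show ?thesis
    by (simp add: pair_def sum_distrib_left algebra_simps)
qed

lemma pair_fun_lin:
  "pair (\<lambda>m. \<Sum>i\<in>A. c i * \<phi> i m) p = (\<Sum>i\<in>A. c i * pair (\<phi> i) p)"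
  unfolding pair_def by (simp add: sum_distrib_right sum_distrib_left algebra_simps sum.swap[of _ A])

lemma pair_cong: "(\<And>m. m \<in> keys p \<Longrightarrow> \<phi> m = \<psi> m) \<Longrightarrow> pair \<phi> p = pair \<psi> p"
  by (simp add: pair_def)

lemma pair_mon_mult:
  "pair \<phi> (mon a * p) = pair (\<lambda>m. \<phi> (a + m)) p"
proof -
  have "mon a * p = (\<Sum>m\<in>keys p. Poly_Mapping.single (a + m) (lookup p m))"
    by (subst poly_mapping_expand[of p]) (simp add: mon_def sum_distrib_left mult_single)
  then have "pair \<phi> (mon a * p) = (\<Sum>m\<in>keys p. \<phi> (a + m) * lookup p m)"
    by (simp only: pair_sum pair_single)
  then show ?thesis by (simp add: pair_def)
qed

section \<open>Weights of monomials and leading forms\<close>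

definition mwt :: "('v \<Rightarrow> int) \<Rightarrow> ('v \<Rightarrow>\<^sub>0 nat) \<Rightarrow> int" where
  "mwt \<omega> m = (\<Sum>x\<in>keys m. int (lookup m x) * \<omega> x)"

lemma mwt_superset:
  assumes "finite A" "keys m \<subseteq> A"
  shows "mwt \<omega> m = (\<Sum>x\<in>A. int (lookup m x) * \<omega> x)"
  unfolding mwt_def using assms
  by (intro sum.mono_neutral_left) (auto simp: in_keys_iff)

lemma mwt_zero [simp]: "mwt \<omega> 0 = 0"
  by (simp add: mwt_def)

lemma mwt_add: "mwt \<omega> (m + m') = mwt \<omega> m + mwt \<omega> m'"
proof -
  let ?A = "keys m \<union> keys m'"
  have "keys (m + m') \<subseteq> ?A" by (rule Poly_Mapping.keys_add)
  then have "mwt \<omega> (m + m') = (\<Sum>x\<in>?A. int (lookup (m + m') x) * \<omega> x)"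
    by (intro mwt_superset) auto
  moreover have "mwt \<omega> m = (\<Sum>x\<in>?A. int (lookup m x) * \<omega> x)" "mwt \<omega> m' = (\<Sum>x\<in>?A. int (lookup m' x) * \<omega> x)"
    by (intro mwt_superset; auto)+
  ultimately show ?thesis
    by (simp add: lookup_add algebra_simps sum.distrib)
qed

lemma mwt_single [simp]: "mwt \<omega> (Poly_Mapping.single x k) = int k * \<omega> x"
  by (cases "k = 0") (auto simp: mwt_def)

text \<open>\<open>q\<close> is the weight-\<open>w\<close> part of \<open>p\<close>, and \<open>p\<close> has no part of larger weight.\<close>

definition top_form :: "('v \<Rightarrow> int) \<Rightarrow> int \<Rightarrow>
    (('v \<Rightarrow>\<^sub>0 nat) \<Rightarrow>\<^sub>0 'c::comm_ring_1) \<Rightarrow> (('v \<Rightarrow>\<^sub>0 nat) \<Rightarrow>\<^sub>0 'c) \<Rightarrow> bool" where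
  "top_form \<omega> w p q \<longleftrightarrow> (\<forall>m\<in>keys q. mwt \<omega> m = w) \<and> (\<forall>m\<in>keys (p - q). mwt \<omega> m < w)"

lemma top_form_one: "top_form \<omega> 0 1 1"
  by (simp add: top_form_def)

lemma keys_mult_mwt:
  assumes "\<And>m. m \<in> keys p \<Longrightarrow> P (mwt \<omega> m)" "\<And>m. m \<in> keys q \<Longrightarrow> Q (mwt \<omega> m)"
    and "\<And>a b. P a \<Longrightarrow> Q b \<Longrightarrow> R (a + b)" "m \<in> keys (p * q)"
  shows "R (mwt \<omega> m)"
proof -
  obtain a b where "a \<in> keys p" "b \<in> keys q" "m = a + b"
    using assms(4) keys_mult[of p q] by blast
  with assms show ?thesis by (simp add: mwt_add)
qed

lemma top_form_mult:
  assumes "top_form \<omega> w p q" "top_form \<omega> w' p' q'"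
  shows "top_form \<omega> (w + w') (p * p') (q * q')"
proof -
  \<comment> \<open>Each summand contains a difference \<open>p - q\<close> or
    \<open>p' - q'\<close>, hence a factor of smaller weight.\<close>
  have *: "p * p' - q * q' = (p - q) * q' + (q * (p' - q') + (p - q) * (p' - q'))"
    by (simp add: algebra_simps)
  have "mwt \<omega> m < w + w'" if "m \<in> keys ((p - q) * q')" for m
    using that assms unfolding top_form_def
    by (intro keys_mult_mwt[where P = "\<lambda>a. a < w" and Q = "\<lambda>a. a = w'" and R = "\<lambda>a. a < w + w'"]) auto
  moreover have "mwt \<omega> m < w + w'" if "m \<in> keys (q * (p' - q'))" for m
    using that assms unfolding top_form_def
    by (intro keys_mult_mwt[where P = "\<lambda>a. a = w" and Q = "\<lambda>a. a < w'" and R = "\<lambda>a. a < w + w'"]) auto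
  moreover have "mwt \<omega> m < w + w'" if "m \<in> keys ((p - q) * (p' - q'))" for m
    using that assms unfolding top_form_def
    by (intro keys_mult_mwt[where P = "\<lambda>a. a < w" and Q = "\<lambda>a. a < w'" and R = "\<lambda>a. a < w + w'"]) auto
  ultimately have "mwt \<omega> m < w + w'" if "m \<in> keys (p * p' - q * q')" for m
    using that unfolding *
    using Poly_Mapping.keys_add[of "(p - q) * q'"] Poly_Mapping.keys_add[of "q * (p' - q')"] by blast
  moreover have "mwt \<omega> m = w + w'" if "m \<in> keys (q * q')" for m
    using that assms unfolding top_form_def
    by (intro keys_mult_mwt[where P = "\<lambda>a. a = w" and Q = "\<lambda>a. a = w'" and R = "\<lambda>a. a = w + w'"]) auto
  ultimately show ?thesis by (simp add: top_form_def)
qed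

lemma top_form_prod:
  assumes "\<And>i. i \<in> A \<Longrightarrow> top_form \<omega> (w i) (p i) (q i)"
  shows "top_form \<omega> (\<Sum>i\<in>A. w i) (\<Prod>i\<in>A. p i) (\<Prod>i\<in>A. q i)"
  using assms
  by (induction A rule: infinite_finite_induct) (auto simp: top_form_one intro: top_form_mult)

lemma top_form_power:
  "top_form \<omega> w p q \<Longrightarrow> top_form \<omega> (int k * w) (p ^ k) (q ^ k)"
  using top_form_prod[of "{..<k}" \<omega> "\<lambda>_. w" "\<lambda>_. p" "\<lambda>_. q"] by simp

section \<open>Vandermonde products and alternating sums\<close>

definition vand :: "nat \<Rightarrow> (nat \<Rightarrow> 'r::comm_ring_1) \<Rightarrow> 'r" where
  "vand m u = (\<Prod>b<m. \<Prod>c<b. (u b - u c))"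

text \<open>The Newton interpolation basis at the nodes \<open>u 0, u 1, ...\<close>. The matrix of
  its values at the nodes is triangular, with the factors of \<open>vand\<close> on the
  diagonal.\<close>

definition newton :: "(nat \<Rightarrow> 'r::comm_ring_1) \<Rightarrow> nat \<Rightarrow> 'r poly" where
  "newton u c = (\<Prod>c'<c. [:- u c', 1:])"

lemma newton_Suc: "newton u (Suc c) = [:- u c, 1:] * newton u c"
  by (simp add: newton_def mult.commute)

lemma poly_newton: "poly (newton u c) x = (\<Prod>c'<c. (x - u c'))"
  by (simp add: newton_def poly_prod)

text \<open>Repeated synthetic division: dividing the remaining cofactor by \<open>x - u m\<close>
  splits off one more Newton term. What remains, \<open>q * newton u m\<close>, vanishes at the
  nodes below \<open>m\<close>.\<close>

lemma newton_expansion: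
  "\<exists>\<omega> q. \<phi> = (\<Sum>c<m. smult (\<omega> c) (newton u c)) + q * newton u m"
proof (induction m)
  case 0
  show ?case by (simp add: newton_def)
next
  case (Suc m)
  then obtain \<omega> q where IH: "\<phi> = (\<Sum>c<m. smult (\<omega> c) (newton u c)) + q * newton u m" by blast
  define \<omega>' where "\<omega>' = \<omega>(m := poly q (u m))"
  have "q = [:- u m, 1:] * synthetic_div q (u m) + [:poly q (u m):]"
    using synthetic_div_correct'[of "u m" q] by simp
  moreover have "(L * S + [:x:]) * K = S * (L * K) + smult x K" for L S K :: "'a poly" and x
    by (simp add: algebra_simps)
  ultimately have "q * newton u m = synthetic_div q (u m) * newton u (Suc m) + smult (poly q (u m)) (newton u m)"
    unfolding newton_Suc by metis
  moreover have "(\<Sum>c<Suc m. smult (\<omega>' c) (newton u c))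
      = (\<Sum>c<m. smult (\<omega> c) (newton u c)) + smult (poly q (u m)) (newton u m)"
    by (simp add: \<omega>'_def)
  ultimately have "\<phi> = (\<Sum>c<Suc m. smult (\<omega>' c) (newton u c)) + synthetic_div q (u m) * newton u (Suc m)"
    using IH by (simp add: algebra_simps)
  then show ?case by blast
qed

text \<open>Only values at the nodes matter, so the remainder of the Newton expansion drops out, and
  the matrix of values is a coefficient matrix times a triangular matrix of determinant
  \<open>vand m u\<close>. This gives divisibility over every commutative ring, with no appeal to
  factorization.\<close>

lemma det_poly_values:
  fixes u :: "nat \<Rightarrow> 'r::comm_ring_1"
  shows "\<exists>g. det (mat m m (\<lambda>(k, b). poly (\<phi> k) (u b))) = vand m u * g"
proof -
  have "\<exists>P. \<phi> k = (\<Sum>c<m. smult (fst P c) (newton u c)) + snd P * newton u m" for k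
    using newton_expansion[of "\<phi> k" u m] by auto
  then obtain P where P: "\<And>k. \<phi> k = (\<Sum>c<m. smult (fst (P k) c) (newton u c)) + snd (P k) * newton u m"
    by metis
  define \<omega> q where "\<omega> k = fst (P k)" and "q k = snd (P k)" for k
  have \<omega>: "\<phi> k = (\<Sum>c<m. smult (\<omega> k c) (newton u c)) + q k * newton u m" for k
    using P by (simp add: \<omega>_def q_def)
  define W where "W = mat m m (\<lambda>(k, c). \<omega> k c)"
  define T where "T = mat m m (\<lambda>(c, b). poly (newton u c) (u b))"
  have "poly (\<phi> k) (u b) = (\<Sum>c = 0..<m. \<omega> k c * poly (newton u c) (u b))" if "b < m" for k b
  proof -
    have "poly (newton u m) (u b) = 0"
      using that by (auto simp: poly_newton intro!: prod_zero)
    then show ?thesis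
      by (subst \<omega>) (simp add: poly_sum atLeast0LessThan)
  qed
  then have "mat m m (\<lambda>(k, b). poly (\<phi> k) (u b)) = W * T"
    by (intro eq_matI) (auto simp: W_def T_def scalar_prod_def)
  moreover have "det T = vand m u"
  proof -
    have "upper_triangular T"
      by (auto simp: T_def poly_newton upper_triangular_def intro!: prod_zero)
    then have "det T = prod_list (diag_mat T)"
      by (rule det_upper_triangular[of _ m]) (simp add: T_def)
    also have "\<dots> = (\<Prod>b<m. poly (newton u b) (u b))"
      by (simp add: prod_list_diag_prod T_def atLeast0LessThan)
    finally show ?thesis by (simp add: vand_def poly_newton)
  qed
  moreover have "det (W * T) = det W * det T"
    by (rule det_mult[of _ m]) (auto simp: W_def T_def)
  ultimately show ?thesis by (metis mult.commute)
qed

lemma degree_newton: "degree (newton u c) \<le> c"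
  and lead_newton: "coeff (newton u c) c = 1"
proof -
  have "degree (newton u c) \<le> c \<and> coeff (newton u c) c = 1"
  proof (induction c)
    case 0
    show ?case by (simp add: newton_def)
  next
    case (Suc c)
    then have z: "coeff (newton u c) (Suc c) = 0"
      by (simp add: coeff_eq_0 le_imp_less_Suc)
    have "degree (newton u (Suc c)) \<le> Suc c"
      unfolding newton_Suc using Suc degree_mult_le[of "[:- u c, 1:]" "newton u c"] by simp
    moreover have "coeff (newton u (Suc c)) (Suc c) = 1"
      unfolding newton_Suc using Suc z by simp
    ultimately show ?case by blast
  qed
  then show "degree (newton u c) \<le> c" "coeff (newton u c) c = 1" by auto
qed

text \<open>The Newton polynomials are monic of degree \<open>c\<close>, so the change of basis from
  the powers has determinant one. The determinant form is wanted because it displays the sign under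
  permutations.\<close>

lemma vand_eq_det: "vand m u = det (mat m m (\<lambda>(b, c). u b ^ c))" for u :: "nat \<Rightarrow> 'r::comm_ring_1"
proof -
  define T where "T = mat m m (\<lambda>(b, k). poly (newton u k) (u b))"
  define C where "C = mat m m (\<lambda>(c, k). coeff (newton u k) c)"
  define V where "V = mat m m (\<lambda>(b, c). u b ^ c)"
  have "poly (newton u k) (u b) = (\<Sum>c = 0..<m. u b ^ c * coeff (newton u k) c)" if "k < m" for b k
  proof -
    have "poly (newton u k) (u b) = (\<Sum>c\<le>degree (newton u k). coeff (newton u k) c * u b ^ c)"
      by (rule poly_altdef)
    also have "\<dots> = (\<Sum>c = 0..<m. coeff (newton u k) c * u b ^ c)"
      using that degree_newton[of u k] by (intro sum.mono_neutral_left) (auto simp: coeff_eq_0)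
    finally show ?thesis by (simp add: mult.commute)
  qed
  then have "T = V * C"
    by (intro eq_matI) (auto simp: T_def C_def V_def scalar_prod_def)
  then have "det T = det V * det C"
    by (simp add: det_mult[of _ m] C_def V_def)
  moreover have "det C = 1"
  proof -
    have "upper_triangular C"
      using le_less_trans[OF degree_newton[of u]] by (auto simp: C_def upper_triangular_def intro!: coeff_eq_0)
    then have "det C = prod_list (diag_mat C)"
      by (rule det_upper_triangular[of _ m]) (simp add: C_def)
    then show ?thesis by (simp add: prod_list_diag_prod C_def lead_newton)
  qed
  moreover have "det T = vand m u"
  proof -
    have "det T = prod_list (diag_mat T)"
      by (rule det_lower_triangular[of m]) (auto simp: T_def poly_newton intro!: prod_zero)
    also have "\<dots> = (\<Prod>b<m. poly (newton u b) (u b))"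
      by (simp add: prod_list_diag_prod T_def atLeast0LessThan)
    finally show ?thesis by (simp add: vand_def poly_newton)
  qed
  ultimately show ?thesis by (simp add: V_def)
qed

lemma vand_permute:
  fixes u :: "nat \<Rightarrow> 'r::comm_ring_1"
  assumes "w permutes {..<m}"
  shows "vand m (\<lambda>k. u (w k)) = signof w * vand m u"
proof -
  define V where "V = mat m m (\<lambda>(b, c). u b ^ c)"
  have w: "w permutes {0..<m}" using assms by (simp add: atLeast0LessThan)
  have wl: "w b < m" if "b < m" for b
    using permutes_in_image[OF assms, of b] that by simp
  have "mat m m (\<lambda>(b, c). u (w b) ^ c) = mat m m (\<lambda>(i, j). V $$ (w i, j))"
    using wl by (intro eq_matI) (auto simp: V_def)
  then show ?thesis
    using det_permute_rows[OF _ w, of V] by (simp add: vand_eq_det V_def)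
qed

lemma (in comm_ring_hom) hom_vand: "hom (vand m u) = vand m (\<lambda>k. hom (u k))"
  by (simp add: vand_def hom_prod hom_minus)

lemma vand_nonzero:
  fixes u :: "nat \<Rightarrow> 'r::idom"
  assumes "inj_on u {..<m}"
  shows "vand m u \<noteq> 0"
proof -
  have "u b - u c \<noteq> 0" if "b < m" "c < b" for b c
    using inj_onD[OF assms, of b c] that by auto
  then show ?thesis by (auto simp: vand_def prod_zero_iff)
qed

text \<open>By the Leibniz formula the sum is the determinant of the values of the monomials with
  exponents \<open>e k\<close> at the nodes.\<close>

lemma alternating_sum_monomial:
  fixes u :: "nat \<Rightarrow> 'r::comm_ring_1"
  shows "\<exists>g. (\<Sum>w | w permutes {..<m}. signof w * (\<Prod>k<m. u (w k) ^ e k)) = vand m u * g"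
proof -
  have *: "det (mat m m (\<lambda>(k, b). poly (monom 1 (e k)) (u b)))
      = (\<Sum>w | w permutes {0..<m}. signof w * (\<Prod>k = 0..<m. u (w k) ^ e k))"
  proof (unfold det_def'[of "mat m m f" m for f, OF mat_carrier], intro sum.cong refl arg_cong2[of _ _ _ _ "(*)"] prod.cong)
    fix w k assume "w \<in> {w. w permutes {0..<m}}" "k \<in> {0..<m}"
    then have "w k < m" using permutes_in_image[of w "{0..<m}" k] by simp
    with \<open>k \<in> {0..<m}\<close> show "mat m m (\<lambda>(k, b). poly (monom 1 (e k)) (u b)) $$ (k, w k) = u (w k) ^ e k"
      by (simp add: poly_monom)
  qed
  show ?thesis
    using det_poly_values[where m = m and \<phi> = "\<lambda>k. monom 1 (e k)" and u = u] unfolding * atLeast0LessThan .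
qed

lemma alternating_sum:
  fixes u :: "nat \<Rightarrow> 'r::comm_ring_1"
  assumes "\<And>m'. m' \<in> keys h \<Longrightarrow> keys m' \<subseteq> {..<m}"
  shows "\<exists>g. (\<Sum>w | w permutes {..<m}. signof w * ins f (\<lambda>k. u (w k)) h) = vand m u * g"
proof -
  obtain g where g: "\<And>e. (\<Sum>w | w permutes {..<m}. signof w * (\<Prod>k<m. u (w k) ^ e k)) = vand m u * g e"
    using alternating_sum_monomial[where m = m and u = u] by metis
  have "ins f (\<lambda>k. u (w k)) h = (\<Sum>m'\<in>keys h. f (lookup h m') * (\<Prod>k<m. u (w k) ^ lookup m' k))" for w
    unfolding ins_def using assms by (intro sum.cong refl) (simp add: evm_superset[of "{..<m}"])
  then have "(\<Sum>w | w permutes {..<m}. signof w * ins f (\<lambda>k. u (w k)) h)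
      = (\<Sum>m'\<in>keys h. f (lookup h m') * (\<Sum>w | w permutes {..<m}. signof w * (\<Prod>k<m. u (w k) ^ lookup m' k)))"
    by (simp add: sum_distrib_left sum.swap[of _ "{w. w permutes {..<m}}"] algebra_simps)
  also have "\<dots> = vand m u * (\<Sum>m'\<in>keys h. f (lookup h m') * g (lookup m'))"
    by (simp add: g sum_distrib_left algebra_simps)
  finally show ?thesis by blast
qed

section \<open>The recursion for k(I, J)\<close>

abbreviation "sls \<equiv> sorted_list_of_set"

lemma sls_insert_greater:
  fixes C :: "nat set"
  assumes "finite C" "\<And>c. c \<in> C \<Longrightarrow> c < n"
  shows "sls (insert n C) = sls C @ [n]"
  using assms by (intro sorted_distinct_set_unique) (auto simp: sorted_append less_imp_le simp del: sorted_list_of_set_insert_remove)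

lemma row_changes_cong:
  assumes "\<And>q. q < p \<Longrightarrow> xs ! q = xs' ! q" "\<And>q. q < p \<Longrightarrow> ys ! q = ys' ! q"
  shows "row_changes xs ys b p = row_changes xs' ys' b p"
  using assms by (induction p arbitrary: b) auto

lemma row_changes_swap: "row_changes xs ys b p = row_changes ys xs (\<not> b) p"
  by (induction p arbitrary: b) auto

lemma row_changes_same [simp]: "row_changes xs xs b p = 0"
  by (induction p arbitrary: b) auto

text \<open>Above position \<open>i\<close> nothing happens. At \<open>i\<close> the run that is in
  the row with the larger entry leaves it, the other run stays, and from then on both are in the
  same row. This single change is the source of the term \<open>[D \<prec> C]\<close> in the
  recursion.\<close>

lemma row_changes_top:
  assumes "i < p" "xs ! i > ys ! i" "\<And>q. i < q \<Longrightarrow> q < p \<Longrightarrow> xs ! q = ys ! q"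
  shows "row_changes xs ys True p = Suc (row_changes xs ys False p)"
  using assms by (induction p) (auto simp: less_Suc_eq)

lemma sls_nth_mem: "finite C \<Longrightarrow> i < card C \<Longrightarrow> sls C ! i \<in> C" for C :: "nat set"
  by (metis nth_mem length_sorted_list_of_set set_sorted_list_of_set)

lemma sls_nth_ex: "finite C \<Longrightarrow> x \<in> C \<Longrightarrow> \<exists>i<card C. x = sls C ! i" for C :: "nat set"
  by (metis in_set_conv_nth length_sorted_list_of_set set_sorted_list_of_set)

lemma sls_nth_less: "i < j \<Longrightarrow> j < card C \<Longrightarrow> sls C ! i < sls C ! j" for C :: "nat set"
  using strict_sorted_list_of_set[of C] by (simp add: sorted_wrt_iff_nth_less)

lemma sls_nth_le: "i \<le> j \<Longrightarrow> j < card C \<Longrightarrow> sls C ! i \<le> sls C ! j" for C :: "nat set"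
  using sls_nth_less[of i j C] by (cases "i = j") auto

text \<open>Above position \<open>i\<close> the lists agree, so \<open>sls D ! i\<close> is the
  largest element of the symmetric difference. Together with the converse
  \<open>set_prec_top\<close> this connects the order with the columns that
  \<open>row_changes\<close> reads.\<close>

lemma set_prec_if_top:
  assumes fin: "finite C" "finite D" and card: "card C = card D"
    and i: "i < card D" "sls C ! i < sls D ! i"
    and eq: "\<And>q. i < q \<Longrightarrow> q < card D \<Longrightarrow> sls C ! q = sls D ! q"
  shows "C \<prec> D"
proof -
  let ?x = "sls D ! i"
  have xD: "?x \<in> D" using fin i by (simp add: sls_nth_mem)
  have xC: "?x \<notin> C"
  proof
    assume "?x \<in> C"
    then obtain q where q: "q < card C" "?x = sls C ! q" using sls_nth_ex fin by blast
    show False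
    proof (cases "q \<le> i")
      case True
      then show False using sls_nth_le[of q i C] i q card by simp
    next
      case False
      then show False using eq[of q] q card sls_nth_less[of i q D] by simp
    qed
  qed
  have "y \<le> ?x" if y: "y \<in> (C - D) \<union> (D - C)" for y
  proof (cases "y \<in> C")
    case True
    then obtain q where q: "q < card C" "y = sls C ! q" using sls_nth_ex fin by blast
    have "q \<le> i"
    proof (rule ccontr)
      assume "\<not> q \<le> i"
      then have "y = sls D ! q" using eq[of q] q card by simp
      then show False using y True sls_nth_mem[of D q] fin q card by auto
    qed
    then show ?thesis using sls_nth_le[of q i C] i q card by simp
  next
    case False
    then have "y \<in> D" using y by blast
    then obtain q where q: "q < card D" "y = sls D ! q" using sls_nth_ex fin by blast
    have "q \<le> i"
    proof (rule ccontr)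
      assume "\<not> q \<le> i"
      then have "y = sls C ! q" using eq[of q] q card by simp
      then show False using False sls_nth_mem[of C q] fin q card by auto
    qed
    then show ?thesis using sls_nth_le[of q i D] i q by simp
  qed
  then have "Max ((C - D) \<union> (D - C)) = ?x"
    using fin xD xC by (intro Max_eqI) auto
  then show ?thesis using xD xC card by (auto simp: set_prec_def)
qed

lemma set_prec_total:
  assumes "finite C" "finite D" "C \<noteq> D"
  shows "C \<prec> D \<or> D \<prec> C"
proof -
  have "(C - D) \<union> (D - C) \<noteq> {}" "finite ((C - D) \<union> (D - C))" using assms by auto
  then have "Max ((C - D) \<union> (D - C)) \<in> (C - D) \<union> (D - C)" by (rule Max_in[rotated])
  moreover have "Max ((D - C) \<union> (C - D)) = Max ((C - D) \<union> (D - C))" by (simp only: Un_commute)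
  ultimately show ?thesis using assms(3) by (auto simp: set_prec_def)
qed

lemma set_prec_asym:
  assumes "finite C" "finite D" "C \<prec> D"
  shows "\<not> D \<prec> C"
proof
  assume DC: "D \<prec> C"
  with assms have c: "card C = card D" "C \<noteq> D" by (auto simp: set_prec_def)
  have "(C - D) \<union> (D - C) \<noteq> {}" "finite ((C - D) \<union> (D - C))" using assms c by auto
  then have "Max ((C - D) \<union> (D - C)) \<in> (C - D) \<union> (D - C)" by (rule Max_in[rotated])
  moreover have "Max ((D - C) \<union> (C - D)) = Max ((C - D) \<union> (D - C))" by (simp only: Un_commute)
  ultimately show False using assms(3) DC c by (auto simp: set_prec_def)
qed

lemma set_prec_top:
  assumes fin: "finite C" "finite D" and card: "card C = card D" and prec: "C \<prec> D"
  obtains i where "i < card D" "sls C ! i < sls D ! i"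
    "\<And>q. i < q \<Longrightarrow> q < card D \<Longrightarrow> sls C ! q = sls D ! q"
proof -
  let ?S = "{q. q < card D \<and> sls C ! q \<noteq> sls D ! q}"
  have "C \<noteq> D" using prec by (auto simp: set_prec_def)
  have "?S \<noteq> {}"
  proof
    assume "?S = {}"
    then have "sls C = sls D" using card by (intro nth_equalityI) auto
    then have "C = D" using fin by (metis set_sorted_list_of_set)
    with \<open>C \<noteq> D\<close> show False by simp
  qed
  then have m: "Max ?S \<in> ?S" by (intro Max_in) auto
  have eq: "sls C ! q = sls D ! q" if "Max ?S < q" "q < card D" for q
    using Max_ge[of ?S q] that by fastforce
  have "\<not> sls D ! Max ?S < sls C ! Max ?S"
  proof
    assume "sls D ! Max ?S < sls C ! Max ?S"
    moreover have "Max ?S < card C" using m card by simp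
    moreover have "sls D ! q = sls C ! q" if "Max ?S < q" "q < card C" for q
      using eq[of q] that card by simp
    ultimately have "D \<prec> C" using set_prec_if_top[OF fin(2,1) card[symmetric]] by blast
    then show False using set_prec_asym[OF fin prec] by simp
  qed
  then have "sls C ! Max ?S < sls D ! Max ?S" using m by simp
  moreover have "Max ?S < card D" using m by simp
  ultimately show ?thesis using that eq by blast
qed

text \<open>Binary encoding. Among sets of equal size it turns \<open>\<prec>\<close> into
  \<open><\<close> on numbers, so that ranks can be sorted and, for several sets, added and
  compared.\<close>

definition bin :: "nat set \<Rightarrow> nat" where
  "bin C = (\<Sum>i\<in>C. 2 ^ i)"

lemma bin_less_pow: "C \<subseteq> {..<x} \<Longrightarrow> bin C < 2 ^ x"
proof -
  assume "C \<subseteq> {..<x}"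
  then have "bin C \<le> (\<Sum>i<x. 2 ^ i)" unfolding bin_def by (intro sum_mono2) auto
  also have "\<dots> < 2 ^ x" by (induction x) auto
  finally show ?thesis .
qed

text \<open>The largest element of the symmetric difference contributes a power of two that exceeds
  all of \<open>C - D\<close> together.\<close>

lemma bin_less:
  assumes fin: "finite C" "finite D" and card: "card C = card D" and prec: "C \<prec> D"
  shows "bin C < bin D"
proof -
  let ?x = "Max ((C - D) \<union> (D - C))"
  have x: "?x \<in> D" "C \<noteq> D" using prec card by (auto simp: set_prec_def)
  have ne: "(C - D) \<union> (D - C) \<noteq> {}" "finite ((C - D) \<union> (D - C))" using fin x by auto
  have xin: "?x \<in> D - C" using Max_in[OF ne(2,1)] x by blast
  have "y < ?x" if "y \<in> C - D" for y
    using Max_ge[OF ne(2), of y] that x by (cases "y = ?x") auto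
  then have "bin (C - D) < 2 ^ ?x" by (intro bin_less_pow) auto
  also have "\<dots> \<le> bin (D - C)"
    using xin fin member_le_sum[of ?x "D - C" "\<lambda>i. 2 ^ i :: nat"] by (simp add: bin_def)
  finally have "bin (C - D) < bin (D - C)" .
  moreover have "bin C = bin (C - D) + bin (C \<inter> D)" "bin D = bin (D - C) + bin (C \<inter> D)"
    unfolding bin_def using fin
    by (subst sum.union_disjoint[symmetric]; auto intro!: sum.cong)+
  ultimately show ?thesis by simp
qed

lemma bin_less_iff:
  assumes "finite C" "finite D" "card C = card D"
  shows "bin C < bin D \<longleftrightarrow> C \<prec> D"
  using bin_less[of C D] bin_less[of D C] set_prec_total[of C D] assms by fastforce

lemma bin_inj:
  assumes "finite C" "finite D" "card C = card D" "bin C = bin D"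
  shows "C = D"
  using bin_less[of C D] bin_less[of D C] set_prec_total[of C D] assms by fastforce

lemma k_num_refl [simp]: "k_num I I = 0"
  by (simp add: k_num_def k_ordered_def)

lemma k_num_sym:
  assumes "finite I" "finite J"
  shows "k_num I J = k_num J I"
proof (cases "I = J")
  case False
  then show ?thesis
    using set_prec_total[OF assms] set_prec_asym[OF assms] set_prec_asym[OF assms(2,1)]
    by (auto simp: k_num_def)
qed simp

text \<open>The sets to which row \<open>n\<close> can be appended in column \<open>p\<close>: all
  elements lie below \<open>n\<close>, so \<open>n\<close> becomes entry \<open>p\<close> of the
  sorted list and the first \<open>p - 1\<close> entries stay.\<close>

locale extension_step =
  fixes n p :: nat and C :: "nat set"
  assumes p: "p \<ge> 2" and C: "C \<subseteq> {1..<n}" and card_C: "card C = p - 1"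
begin

lemma finite_C: "finite C"
  using C finite_subset by blast

lemma n_notin: "n \<notin> C"
  using C by auto

lemma card_insert_C: "card (insert n C) = p"
  using p card_C finite_C n_notin by simp

lemma sls_insert: "sls (insert n C) = sls C @ [n]"
  using finite_C C by (intro sls_insert_greater) auto

lemma nth_insert: "q < p - 1 \<Longrightarrow> sls (insert n C) ! q = sls C ! q"
  using card_C by (simp add: sls_insert nth_append)

lemma nth_insert_top: "sls (insert n C) ! (p - 1) = n"
  using card_C by (simp add: sls_insert nth_append)

end

text \<open>In column \<open>p\<close> both rows are \<open>n\<close>, so no change occurs there,
  and the remaining columns are those of \<open>C\<close> and \<open>D\<close>. The order of the two
  sets, hence the starting row, is kept.\<close>

lemma k_num_insert_insert:
  assumes "extension_step n p C" "extension_step n p D"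
  shows "k_num (insert n C) (insert n D) = k_num C D"
proof -
  have *: "k_num (insert n C) (insert n D) = k_num C D"
    if C: "extension_step n p C" and D: "extension_step n p D" and prec: "C \<prec> D" for C D
  proof -
    interpret C: extension_step n p C by (rule C)
    interpret D: extension_step n p D by (rule D)
    have "(insert n C - insert n D) \<union> (insert n D - insert n C) = (C - D) \<union> (D - C)"
      using C.n_notin D.n_notin by auto
    then have prec': "insert n C \<prec> insert n D"
      using prec C.card_C D.card_C C.card_insert_C D.card_insert_C
      unfolding set_prec_def by (metis insertCI less_irrefl C.n_notin D.n_notin insert_ident)
    have "p = Suc (p - 1)" using C.p by simp
    then have "row_changes (sls (insert n C)) (sls (insert n D)) True p
        = row_changes (sls (insert n C)) (sls (insert n D)) True (p - 1)"
      using C.nth_insert_top D.nth_insert_top by (metis less_irrefl row_changes.simps(2))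
    also have "\<dots> = row_changes (sls C) (sls D) True (p - 1)"
      by (intro row_changes_cong) (auto simp: C.nth_insert D.nth_insert)
    finally show ?thesis
      using prec prec' C.card_insert_C D.card_insert_C C.card_C D.card_C
      by (simp add: k_num_def k_ordered_def)
  qed
  have fin: "finite C" "finite D"
    using assms by (auto dest: extension_step.finite_C)
  show ?thesis
  proof (cases "C = D")
    case False
    then consider "C \<prec> D" | "D \<prec> C" using set_prec_total fin by blast
    then show ?thesis
      using *[OF assms] *[OF assms(2,1)] fin k_num_sym[of C D] k_num_sym[of "insert n C" "insert n D"]
      by cases auto
  qed simp
qed

text \<open>Having more elements, \<open>insert n C\<close> is the starting row, and the run reads
  only the first \<open>p - 1\<close> columns, where it looks like \<open>C\<close>. The number
  \<open>k_num C D\<close> starts in the smaller set in the sense of \<open>\<prec>\<close>; if that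
  is \<open>D\<close>, \<open>row_changes_top\<close> accounts for one more change.\<close>

lemma k_num_insert_same_card:
  assumes "extension_step n p C" "extension_step n p D"
  shows "k_num (insert n C) D = k_num C D + (if bin D < bin C then 1 else 0)"
proof -
  interpret C: extension_step n p C by fact
  interpret D: extension_step n p D by fact
  have card: "card C = card D" using C.card_C D.card_C by simp
  have "k_num (insert n C) D = row_changes (sls (insert n C)) (sls D) True (p - 1)"
    using C.card_insert_C D.card_C C.p by (simp add: k_num_def k_ordered_def)
  also have "\<dots> = row_changes (sls C) (sls D) True (p - 1)"
    by (intro row_changes_cong) (auto simp: C.nth_insert)
  finally have L: "k_num (insert n C) D = row_changes (sls C) (sls D) True (p - 1)" .
  consider "C = D" | "C \<prec> D" | "D \<prec> C" using set_prec_total[OF C.finite_C D.finite_C] by blast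
  then show ?thesis
  proof cases
    case 2
    then show ?thesis
      using L bin_less[OF C.finite_C D.finite_C card] card D.card_C by (simp add: k_num_def k_ordered_def)
  next
    case 3
    obtain i where i: "i < card C" "sls D ! i < sls C ! i"
        "\<And>q. i < q \<Longrightarrow> q < card C \<Longrightarrow> sls D ! q = sls C ! q"
      using set_prec_top[OF D.finite_C C.finite_C card[symmetric] 3] by metis
    have "row_changes (sls C) (sls D) True (p - 1) = Suc (row_changes (sls C) (sls D) False (p - 1))"
      using i C.card_C by (intro row_changes_top[of i]) auto
    moreover have "k_num C D = row_changes (sls D) (sls C) True (p - 1)"
      using 3 card set_prec_asym[OF D.finite_C C.finite_C 3] C.card_C by (simp add: k_num_def k_ordered_def)
    ultimately show ?thesis
      using L bin_less[OF D.finite_C C.finite_C card[symmetric] 3] row_changes_swap[of "sls C" "sls D" False]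
      by simp
  qed (use L in simp)
qed

text \<open>
  The row sets inside \<open>{1..M}\<close> that are available once the entries of column \<open>1\<close>, of the rows below
  \<open>n\<close>, and \<open>(n, 2), \<dots>, (n, p - 1)\<close> have been adjoined.
\<close>

definition stage :: "nat \<Rightarrow> nat \<Rightarrow> nat \<Rightarrow> nat set set" where
  "stage M n p = {I. I \<noteq> {} \<and> I \<subseteq> {1..M} \<and>
     (card I = 1 \<or> I \<subseteq> {1..<n} \<or> I \<subseteq> {1..n} \<and> card I < p)}"

text \<open>In all cases the starting row and the columns below \<open>p\<close> are the same for
  \<open>C\<close> and \<open>insert n C\<close>. If \<open>card D = p - 1\<close>, then
  \<open>D\<close> has an element \<open>\<ge> n\<close>, which puts it above \<open>C\<close>. If
  \<open>card D \<ge> p\<close>, the run starts in \<open>D\<close>, whose entry in column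
  \<open>p\<close> is below \<open>n\<close>, so column \<open>p\<close> causes no change.\<close>

lemma k_num_insert_other:
  assumes "extension_step n p C" "D \<in> stage M n p" "\<not> extension_step n p D"
  shows "k_num (insert n C) D = k_num C D"
proof -
  interpret extension_step n p C by fact
  have finD: "finite D" using assms(2) finite_subset by (auto simp: stage_def)
  consider "card D = p - 1" | "card D < p - 1" | "card D > p - 1" by linarith
  then show ?thesis
  proof cases
    case 1
    then have "\<not> D \<subseteq> {1..<n}" using assms(3) p by (auto simp: extension_step_def)
    moreover have "D \<subseteq> {1..M}" using assms(2) by (simp add: stage_def)
    ultimately obtain d where d: "d \<in> D" "d \<ge> n" by fastforce
    have d': "d \<in> (C - D) \<union> (D - C)" "finite ((C - D) \<union> (D - C))" and "C \<noteq> D"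
      using d C finD finite_C by auto
    have "Max ((C - D) \<union> (D - C)) \<ge> n"
      using d Max_ge[OF d'(2,1)] by simp
    moreover have "Max ((C - D) \<union> (D - C)) \<in> (C - D) \<union> (D - C)"
      using d' by (intro Max_in) blast+
    ultimately have "Max ((C - D) \<union> (D - C)) \<in> D" using C by auto
    then have "C \<prec> D" using \<open>C \<noteq> D\<close> 1 card_C by (simp add: set_prec_def)
    then have "k_num C D = row_changes (sls C) (sls D) True (p - 1)"
      using 1 card_C by (simp add: k_num_def k_ordered_def)
    moreover have "k_num (insert n C) D = row_changes (sls (insert n C)) (sls D) True (p - 1)"
      using card_insert_C 1 p by (simp add: k_num_def k_ordered_def)
    ultimately show ?thesis
      using row_changes_cong[of "p - 1" "sls (insert n C)" "sls C" "sls D" "sls D" True] nth_insert by auto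
  next
    case 2
    then have "card D < p" by simp
    with 2 show ?thesis
      using row_changes_cong[of "card D" "sls (insert n C)" "sls C" "sls D" "sls D" True] nth_insert
        card_insert_C card_C by (simp add: k_num_def k_ordered_def)
  next
    case 3
    then have D: "D \<subseteq> {1..<n}" using assms(2) p by (auto simp: stage_def)
    have notprec: "\<not> insert n C \<prec> D" if "card D = p"
    proof -
      have "n \<in> (insert n C - D) \<union> (D - insert n C)" "finite ((insert n C - D) \<union> (D - insert n C))"
        using D finD finite_C by auto
      moreover have "(insert n C - D) \<union> (D - insert n C) \<subseteq> {..n}" using D C by auto
      ultimately have "Max ((insert n C - D) \<union> (D - insert n C)) = n" by (intro Max_eqI) auto
      then show ?thesis using that card_insert_C D by (auto simp: set_prec_def)
    qed
    have "k_num (insert n C) D = row_changes (sls D) (sls (insert n C)) True p"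
      using 3 notprec card_insert_C by (auto simp: k_num_def k_ordered_def)
    also have "\<dots> = row_changes (sls D) (sls (insert n C)) True (p - 1)"
    proof -
      have "sls D ! (p - 1) \<in> D" using 3 finD by (intro sls_nth_mem) auto
      then have "sls D ! (p - 1) < n" using D by auto
      moreover have "p = Suc (p - 1)" using p by simp
      ultimately show ?thesis
        using nth_insert_top by (metis not_less_iff_gr_or_eq row_changes.simps(2))
    qed
    also have "\<dots> = row_changes (sls D) (sls C) True (p - 1)"
      by (intro row_changes_cong) (auto simp: nth_insert)
    also have "\<dots> = k_num C D"
      using 3 card_C by (auto simp: k_num_def k_ordered_def set_prec_def)
    finally show ?thesis .
  qed
qed

section \<open>Functionals with a prescribed generating function\<close>

abbreviation "pinv \<equiv> inv_into UNIV"

abbreviation "act \<equiv> Poly_Mapping.map_key"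

lemma lookup_act: "\<sigma> permutes A \<Longrightarrow> lookup (act \<sigma> e) a = lookup e (\<sigma> a)"
  using map_key.rep_eq[OF permutes_inj, of \<sigma> A e] by simp

text \<open>Exponents are read through the permutation, so this is a right action and the composite
  is reversed.\<close>

lemma act_comp: "\<sigma> permutes A \<Longrightarrow> \<sigma>' permutes A \<Longrightarrow> act \<sigma> (act \<sigma>' e) = act (\<sigma>' \<circ> \<sigma>) e"
  by (intro map_key_compose) (auto dest: permutes_inj)

lemma act_inj:
  assumes p: "\<sigma> permutes A"
  shows "act \<sigma> e = act \<sigma> e' \<longleftrightarrow> e = e'"
proof
  assume *: "act \<sigma> e = act \<sigma> e'"
  show "e = e'"
  proof (rule poly_mapping_eqI)
    fix a
    obtain b where "a = \<sigma> b" using permutes_surj[OF p] by blast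
    then show "lookup e a = lookup e' a" using * lookup_act[OF p] by metis
  qed
qed simp

lemma act_add: "\<sigma> permutes A \<Longrightarrow> act \<sigma> (e + e') = act \<sigma> e + act \<sigma> e'"
  by (intro map_key_plus) (auto dest: permutes_inj)

lemma act_id [simp]: "act id e = e"
  using map_key_id[of e] by (simp add: id_def)

lemma keys_act: "\<sigma> permutes A \<Longrightarrow> keys e \<subseteq> A \<Longrightarrow> keys (act \<sigma> e) \<subseteq> A"
proof
  fix a
  assume \<sigma>: "\<sigma> permutes A" and e: "keys e \<subseteq> A" and a: "a \<in> keys (act \<sigma> e)"
  then have "\<sigma> a \<in> A" by (auto simp: in_keys_iff lookup_act)
  then show "a \<in> A" using permutes_in_image[OF \<sigma>] by simp
qed

section \<open>Multisets of types and the permutations that preserve a family\<close>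

definition tms :: "nat \<Rightarrow> (nat \<Rightarrow> 't) \<Rightarrow> 't multiset" where
  "tms N \<tau> = image_mset \<tau> (mset_set {..<N})"

lemma size_tms [simp]: "size (tms N \<tau>) = N"
  by (simp add: tms_def)

lemma tms_cong: "(\<And>a. a < N \<Longrightarrow> \<tau> a = \<tau>' a) \<Longrightarrow> tms N \<tau> = tms N \<tau>'"
  unfolding tms_def by (intro image_mset_cong) simp

lemma tms_eqD:
  assumes "tms N \<tau> = tms N' \<tau>'"
  obtains \<sigma> where "N' = N" "\<sigma> permutes {..<N}" "\<And>a. a < N \<Longrightarrow> \<tau> a = \<tau>' (\<sigma> a)"
proof -
  have "N' = N" using assms by (metis size_tms)
  moreover obtain \<sigma> where "\<sigma> permutes {..<N}" "\<forall>a\<in>{..<N}. \<tau> a = \<tau>' (\<sigma> a)"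
    using image_mset_eq_implies_permutes[of "{..<N}" \<tau> \<tau>'] assms \<open>N' = N\<close> unfolding tms_def by auto
  ultimately show ?thesis using that by auto
qed

lemma tms_permute:
  assumes "\<sigma> permutes {..<N}"
  shows "tms N (\<lambda>a. \<tau> (\<sigma> a)) = tms N \<tau>"
proof -
  have "image_mset \<sigma> (mset_set {..<N}) = mset_set {..<N}"
    using assms by (simp add: image_mset_mset_set permutes_inj_on permutes_image)
  then show ?thesis
    using image_mset.compositionality[of \<tau> \<sigma> "mset_set {..<N}"] by (simp add: tms_def comp_def)
qed

lemma count_tms: "count (tms N x) y = card {a. a < N \<and> x a = y}"
proof -
  have "count (tms N x) y = card (x -` {y} \<inter> {..<N})"
    unfolding tms_def by (simp add: count_image_mset)
  also have "x -` {y} \<inter> {..<N} = {a. a < N \<and> x a = y}" by auto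
  finally show ?thesis .
qed

lemma lookup_sum_single:
  "lookup (\<Sum>a<N. Poly_Mapping.single (x a) (1::nat)) y = count (tms N x) y"
proof -
  have "lookup (\<Sum>a<N. Poly_Mapping.single (x a) (1::nat)) y = (\<Sum>a<N. if x a = y then 1 else 0)"
    unfolding lookup_sum by (intro sum.cong refl) (simp add: lookup_single when_def)
  also have "\<dots> = card {a. a < N \<and> x a = y}"
    by (subst sum.inter_filter[symmetric]) (auto intro!: arg_cong[where f = card])
  finally show ?thesis by (simp add: count_tms)
qed

text \<open>A monomial remembers exactly the multiset of its variables. This is all by which a
  functional on monomials can recognize a family.\<close>

lemma sum_single_eq_iff:
  "(\<Sum>a<N. Poly_Mapping.single (x a) (1::nat)) = (\<Sum>a<N'. Poly_Mapping.single (x' a) 1)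
    \<longleftrightarrow> tms N x = tms N' x'"
  unfolding poly_mapping_eq_iff fun_eq_iff lookup_sum_single multiset_eq_iff ..

lemma tms_image: "image_mset f (tms N x) = tms N (\<lambda>a. f (x a))"
  by (simp add: tms_def image_mset.compositionality comp_def)

definition stab :: "nat \<Rightarrow> (nat \<Rightarrow> 't) \<Rightarrow> (nat \<Rightarrow> nat) set" where
  "stab N \<tau> = {\<sigma>. \<sigma> permutes {..<N} \<and> (\<forall>a<N. \<tau> (\<sigma> a) = \<tau> a)}"

lemma finite_stab [simp]: "finite (stab N \<tau>)"
  unfolding stab_def by (rule finite_subset[OF _ finite_permutations[of "{..<N}"]]) auto

lemma stabD: "\<sigma> \<in> stab N \<tau> \<Longrightarrow> \<sigma> permutes {..<N}"
  "\<sigma> \<in> stab N \<tau> \<Longrightarrow> a < N \<Longrightarrow> \<tau> (\<sigma> a) = \<tau> a"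
  "\<sigma> \<in> stab N \<tau> \<Longrightarrow> a < N \<Longrightarrow> \<sigma> a < N"
  using permutes_in_image[of \<sigma> "{..<N}" a] by (auto simp: stab_def)

lemma id_stab [simp]: "id \<in> stab N \<tau>"
  by (simp add: stab_def)

lemma stab_comp:
  assumes "\<sigma> \<in> stab N \<tau>" "\<sigma>' \<in> stab N \<tau>"
  shows "\<sigma> \<circ> \<sigma>' \<in> stab N \<tau>"
proof -
  have "\<sigma> \<circ> \<sigma>' permutes {..<N}"
    by (rule permutes_compose[OF stabD(1)[OF assms(2)] stabD(1)[OF assms(1)]])
  moreover have "\<tau> (\<sigma> (\<sigma>' a)) = \<tau> a" if "a < N" for a
    using stabD(2)[OF assms(1) stabD(3)[OF assms(2) that]] stabD(2)[OF assms(2) that] by simp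
  ultimately show ?thesis by (simp add: stab_def)
qed

lemma stab_inv:
  assumes "\<sigma> \<in> stab N \<tau>"
  shows "pinv \<sigma> \<in> stab N \<tau>"
proof -
  have p: "pinv \<sigma> permutes {..<N}" using permutes_inv[OF stabD(1)[OF assms]] .
  have "\<tau> (pinv \<sigma> a) = \<tau> a" if "a < N" for a
    using stabD(2)[OF assms, of "pinv \<sigma> a"] permutes_in_image[OF p, of a] that
      permutes_inverses(1)[OF stabD(1)[OF assms], of a] by simp
  with p show ?thesis by (simp add: stab_def)
qed

lemma stab_comp_bij:
  assumes "\<sigma> \<in> stab N \<tau>"
  shows "bij_betw (\<lambda>\<sigma>'. \<sigma>' \<circ> \<sigma>) (stab N \<tau>) (stab N \<tau>)"
proof (rule bij_betw_byWitness[where f' = "\<lambda>\<sigma>'. \<sigma>' \<circ> pinv \<sigma>"])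
  have "\<sigma> \<circ> pinv \<sigma> = id" "pinv \<sigma> \<circ> \<sigma> = id"
    using permutes_inv_o[OF stabD(1)[OF assms]] by auto
  then show "\<forall>a\<in>stab N \<tau>. a \<circ> \<sigma> \<circ> pinv \<sigma> = a" "\<forall>a\<in>stab N \<tau>. a \<circ> pinv \<sigma> \<circ> \<sigma> = a"
    by (auto simp: comp_assoc)
qed (use assms stab_comp stab_inv in blast)+

lemma stab_comp_bij_left:
  assumes "\<sigma> \<in> stab N \<tau>"
  shows "bij_betw (\<lambda>\<sigma>'. \<sigma> \<circ> \<sigma>') (stab N \<tau>) (stab N \<tau>)"
proof (rule bij_betw_byWitness[where f' = "\<lambda>\<sigma>'. pinv \<sigma> \<circ> \<sigma>'"])
  have "\<sigma> \<circ> pinv \<sigma> = id" "pinv \<sigma> \<circ> \<sigma> = id"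
    using permutes_inv_o[OF stabD(1)[OF assms]] by auto
  then show "\<forall>a\<in>stab N \<tau>. pinv \<sigma> \<circ> (\<sigma> \<circ> a) = a" "\<forall>a\<in>stab N \<tau>. \<sigma> \<circ> (pinv \<sigma> \<circ> a) = a"
    by (auto simp flip: comp_assoc)
qed (use assms stab_comp stab_inv in blast)+

text \<open>A sum over the whole group, not over the orbit: an exponent fixed by many permutations
  occurs with that multiplicity.\<close>

definition av :: "nat \<Rightarrow> (nat \<Rightarrow> 't) \<Rightarrow> (nat \<Rightarrow>\<^sub>0 nat) \<Rightarrow> (nat \<Rightarrow>\<^sub>0 nat) \<Rightarrow>\<^sub>0 'a::comm_ring_1" where
  "av N \<tau> e = (\<Sum>\<sigma>\<in>stab N \<tau>. mon (act \<sigma> e))"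

lemma av_act:
  assumes "\<sigma> \<in> stab N \<tau>"
  shows "av N \<tau> (act \<sigma> e) = (av N \<tau> e :: (nat \<Rightarrow>\<^sub>0 nat) \<Rightarrow>\<^sub>0 'a::comm_ring_1)" (is "?lhs = ?rhs")
proof -
  have "?lhs = (\<Sum>\<sigma>'\<in>stab N \<tau>. mon (act (\<sigma> \<circ> \<sigma>') e))"
    unfolding av_def using assms by (intro sum.cong refl arg_cong[where f = mon] act_comp) (auto dest: stabD(1))
  also have "\<dots> = ?rhs"
    unfolding av_def
    using sum.reindex_bij_betw[OF stab_comp_bij_left[OF assms], of "\<lambda>\<sigma>'. mon (act \<sigma>' e)"] by blast
  finally show ?thesis .
qed

lemma lookup_av_act:
  assumes "\<sigma> \<in> stab N \<tau>"
  shows "lookup (av N \<tau> e) (act \<sigma> l) = (lookup (av N \<tau> e) l :: 'a::comm_ring_1)" (is "?lhs = ?rhs")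
proof -
  have "?lhs = (\<Sum>\<sigma>'\<in>stab N \<tau>. if act \<sigma> l = act \<sigma>' e then 1 else 0)"
    by (simp add: av_def lookup_sum lookup_mon)
  also have "\<dots> = (\<Sum>\<sigma>'\<in>stab N \<tau>. if act \<sigma> l = act (\<sigma>' \<circ> \<sigma>) e then 1 else 0)"
    using sum.reindex_bij_betw[OF stab_comp_bij[OF assms], of "\<lambda>\<sigma>'. if act \<sigma> l = act \<sigma>' e then 1 else (0::'a)"]
    by simp
  also have "\<dots> = (\<Sum>\<sigma>'\<in>stab N \<tau>. if l = act \<sigma>' e then 1 else 0)"
  proof (intro sum.cong refl)
    fix \<sigma>' assume "\<sigma>' \<in> stab N \<tau>"
    then have "act (\<sigma>' \<circ> \<sigma>) e = act \<sigma> (act \<sigma>' e)"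
      using act_comp[OF stabD(1)[OF assms] stabD(1)] by metis
    then show "(if act \<sigma> l = act (\<sigma>' \<circ> \<sigma>) e then 1 else (0::'a)) = (if l = act \<sigma>' e then 1 else 0)"
      by (simp add: act_inj[OF stabD(1)[OF assms]])
  qed
  finally show ?thesis by (simp add: av_def lookup_sum lookup_mon)
qed

text \<open>Turns an equality of multisets, the only information visible on monomials, into an
  element of the stabilizer.\<close>

lemma stab_ex:
  assumes "tms N (\<lambda>a. (\<tau> a, lookup l a)) = tms N (\<lambda>a. (\<tau> a, lookup l' a))"
    and "keys l \<subseteq> {..<N}" "keys l' \<subseteq> {..<N}"
  obtains \<sigma> where "\<sigma> \<in> stab N \<tau>" "l = act \<sigma> l'"
proof -
  obtain \<sigma> where \<sigma>: "\<sigma> permutes {..<N}" "\<And>a. a < N \<Longrightarrow> (\<tau> a, lookup l a) = (\<tau> (\<sigma> a), lookup l' (\<sigma> a))"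
    using tms_eqD[OF assms(1)] by metis
  have "lookup l a = lookup (act \<sigma> l') a" for a
  proof (cases "a < N")
    case False
    then have "a \<notin> keys l" "\<sigma> a \<notin> keys l'"
      using assms permutes_in_image[OF \<sigma>(1), of a] by auto
    then show ?thesis by (simp add: lookup_act[OF \<sigma>(1)] in_keys_iff)
  qed (use \<sigma>(2) in \<open>simp add: lookup_act[OF \<sigma>(1)]\<close>)
  then have "l = act \<sigma> l'" by (intro poly_mapping_eqI)
  moreover have "\<sigma> \<in> stab N \<tau>" using \<sigma> by (auto simp: stab_def)
  ultimately show ?thesis using that by blast
qed

definition kprod :: "nat \<Rightarrow> (nat \<Rightarrow> nat set) \<Rightarrow> (nat \<Rightarrow>\<^sub>0 nat) \<Rightarrow>\<^sub>0 'a::comm_ring_1" where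
  "kprod N \<tau> = (\<Prod>a<N. \<Prod>b<a. (pvar a - pvar b) ^ k_num (\<tau> a) (\<tau> b))"

definition vals :: "(nat set \<Rightarrow> 'a::comm_ring_1 arc_poly fps) \<Rightarrow> nat \<Rightarrow> (nat \<Rightarrow> nat set) \<Rightarrow> (nat \<Rightarrow>\<^sub>0 nat) \<Rightarrow> 'a arc_poly" where
  "vals X N \<tau> l = (\<Prod>a<N. fps_nth (X (\<tau> a)) (lookup l a))"

lemma vals_permute:
  assumes "\<sigma> permutes {..<N}"
  shows "vals X N (\<lambda>a. \<tau> (\<sigma> a)) (act \<sigma> l) = vals X N \<tau> l"
  unfolding vals_def lookup_act[OF assms]
  using prod.permute[OF assms, of "\<lambda>a. fps_nth (X (\<tau> a)) (lookup l a)"] by (simp add: comp_def)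

text \<open>
  A functional \<open>L\<close> on monomials is extended linearly by \<open>pair\<close>. Its generating function
  \<open>\<Sum>\<^sub>l pair L (vals X N \<tau> l) s\<^sup>l\<close> is required to be \<open>kprod N \<tau> * H\<close> at the type \<open>\<tau>\<close> and to vanish
  at all other types that are not above \<open>\<tau>\<close>.
\<close>

definition represents where
  "represents X S gr N \<tau> H L \<longleftrightarrow>
    (\<forall>N' \<tau>' l. (\<forall>a<N'. \<tau>' a \<in> S) \<and> keys l \<subseteq> {..<N'} \<and> tms N' \<tau>' \<noteq> tms N \<tau> \<and> \<not> gr (tms N' \<tau>') (tms N \<tau>)
        \<longrightarrow> pair L (vals X N' \<tau>' l) = 0) \<and>
    (\<forall>l. keys l \<subseteq> {..<N} \<longrightarrow> pair L (vals X N \<tau> l) = lookup (kprod N \<tau> * H) l)"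

text \<open>Symmetrized monomials are the natural right-hand sides, because \<open>vals\<close>, and
  with it the generating function, is unchanged under \<open>stab N \<tau>\<close>.\<close>

definition representable where
  "representable X S gr \<longleftrightarrow>
    (\<forall>N \<tau> e. (\<forall>a<N. \<tau> a \<in> S) \<and> keys e \<subseteq> {..<N} \<longrightarrow> (\<exists>L. represents X S gr N \<tau> (av N \<tau> e) L))"

lemma lookup_const_mult: "lookup (Poly_Mapping.single 0 d * h) l = d * lookup h l"
  for h :: "('v \<Rightarrow>\<^sub>0 nat) \<Rightarrow>\<^sub>0 'a::comm_ring_1"
proof -
  have "Poly_Mapping.single 0 d * h = (\<Sum>m\<in>keys h. Poly_Mapping.single m (d * lookup h m))"
    by (subst poly_mapping_expand[of h]) (simp add: sum_distrib_left mult_single)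
  then have "lookup (Poly_Mapping.single 0 d * h) l = (\<Sum>m\<in>keys h. if m = l then d * lookup h m else 0)"
    by (simp add: lookup_sum lookup_single when_def)
  then show ?thesis by (auto simp: in_keys_iff)
qed

lemma represents_linear:
  fixes X :: "nat set \<Rightarrow> 'a::comm_ring_1 arc_poly fps"
  assumes "\<And>i. i \<in> A \<Longrightarrow> represents X S gr N \<tau> (H i) (L i)"
  shows "represents X S gr N \<tau> (\<Sum>i\<in>A. Poly_Mapping.single 0 (c i) * H i) (\<lambda>m. \<Sum>i\<in>A. c i * L i m)"
proof -
  have "lookup (kprod N \<tau> * (\<Sum>i\<in>A. Poly_Mapping.single 0 (c i) * H i)) l = (\<Sum>i\<in>A. c i * lookup (kprod N \<tau> * H i) l)" for l
    by (simp add: sum_distrib_left lookup_sum mult.left_commute[of "kprod N \<tau>"] lookup_const_mult)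
  then show ?thesis
    using assms unfolding represents_def pair_fun_lin by simp
qed

lemma vals_arc_entry:
  assumes "\<And>a. a < N \<Longrightarrow> X (\<tau> a) = arc_entry (i a) 1"
  shows "vals X N \<tau> l = mon (\<Sum>a<N. Poly_Mapping.single (i a, 1, lookup l a) 1)"
  unfolding vals_def mon_sum using assms
  by (intro prod.cong refl) (simp add: arc_entry_def arc_var_def mon_def)

lemma k_num_singletons: "k_num {i} {j} = 0"
proof -
  have *: "k_num {i} {j} = 0" if "i < j" for i j :: nat
    using that by (simp add: k_num_def k_ordered_def set_prec_def)
  consider "i < j" | "i = j" | "j < i" by linarith
  then show ?thesis using *[of i j] *[of j i] k_num_sym[of "{i}" "{j}"] by cases auto
qed

lemma representable_singletons:
  fixes X :: "nat set \<Rightarrow> 'a::comm_ring_1 arc_poly fps"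
  assumes X: "\<And>i. i \<in> {1..M} \<Longrightarrow> X {i} = arc_entry i 1"
  shows "representable X ((\<lambda>i. {i}) ` {1..M}) (\<lambda>_ _. False)"
  unfolding representable_def
proof (intro allI impI)
  fix N :: nat and \<tau> :: "nat \<Rightarrow> nat set" and e :: "nat \<Rightarrow>\<^sub>0 nat"
  let ?S = "(\<lambda>i. {i}) ` {1..M}"
  assume "(\<forall>a<N. \<tau> a \<in> ?S) \<and> keys e \<subseteq> {..<N}"
  then have \<tau>: "\<And>a. a < N \<Longrightarrow> \<tau> a \<in> ?S" and e: "keys e \<subseteq> {..<N}" by auto
  define \<xi> :: "nat \<Rightarrow> (nat \<Rightarrow> nat set) \<Rightarrow> (nat \<Rightarrow>\<^sub>0 nat) \<Rightarrow> (nat \<times> nat \<times> nat) \<Rightarrow>\<^sub>0 nat" where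
    "\<xi> N \<tau> l = (\<Sum>a<N. Poly_Mapping.single (the_elem (\<tau> a), 1, lookup l a) 1)" for N \<tau> l
  have vals: "vals X N' \<tau>' l = mon (\<xi> N' \<tau>' l)" if "\<And>a. a < N' \<Longrightarrow> \<tau>' a \<in> ?S" for N' \<tau>' l
    unfolding \<xi>_def using that X by (intro vals_arc_entry) fastforce
  have \<xi>_eq: "tms N' (\<lambda>a. (\<tau>' a, lookup l' a)) = tms N (\<lambda>a. (\<tau> a, lookup l a))"
    if "\<xi> N' \<tau>' l' = \<xi> N \<tau> l" "\<And>a. a < N' \<Longrightarrow> \<tau>' a \<in> ?S" "\<And>a. a < N \<Longrightarrow> \<tau> a \<in> ?S" for N' \<tau>' l' N \<tau> l
  proof -
    have *: "tms N (\<lambda>a. (\<tau> a, lookup l a))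
        = image_mset (\<lambda>(i, _, k). ({i}, k)) (tms N (\<lambda>a. (the_elem (\<tau> a), 1::nat, lookup l a)))"
      if "\<And>a. a < N \<Longrightarrow> \<tau> a \<in> ?S" for N \<tau> l
      unfolding tms_image using that by (intro tms_cong) fastforce
    show ?thesis using that unfolding \<xi>_def sum_single_eq_iff by (simp add: *)
  qed
  \<comment> \<open>All exponents that \<open>SOME\<close> could pick lie in one orbit of
    \<open>stab N \<tau>\<close>, on which the coefficients of \<open>av N \<tau> e\<close> are
    constant.\<close>
  define L where "L m = (if \<exists>l. keys l \<subseteq> {..<N} \<and> \<xi> N \<tau> l = m
      then lookup (av N \<tau> e :: (nat \<Rightarrow>\<^sub>0 nat) \<Rightarrow>\<^sub>0 'a) (SOME l. keys l \<subseteq> {..<N} \<and> \<xi> N \<tau> l = m) else 0)" for m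
  have "represents X ?S (\<lambda>_ _. False) N \<tau> (av N \<tau> e) L"
    unfolding represents_def
  proof (intro conjI allI impI)
    fix N' :: nat and \<tau>' :: "nat \<Rightarrow> nat set" and l :: "nat \<Rightarrow>\<^sub>0 nat"
    assume a: "(\<forall>a<N'. \<tau>' a \<in> ?S) \<and> keys l \<subseteq> {..<N'} \<and> tms N' \<tau>' \<noteq> tms N \<tau> \<and> \<not> False"
    have "\<xi> N \<tau> l' \<noteq> \<xi> N' \<tau>' l" for l'
    proof
      assume "\<xi> N \<tau> l' = \<xi> N' \<tau>' l"
      from arg_cong[OF \<xi>_eq[OF this], of "image_mset fst"] show False
        using a \<tau> by (simp add: tms_image)
    qed
    then have "L (\<xi> N' \<tau>' l) = 0" by (simp add: L_def)
    then show "pair L (vals X N' \<tau>' l) = 0"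
      using a by (simp add: vals mon_def)
  next
    fix l :: "nat \<Rightarrow>\<^sub>0 nat" assume l: "keys l \<subseteq> {..<N}"
    define l' where "l' = (SOME l'. keys l' \<subseteq> {..<N} \<and> \<xi> N \<tau> l' = \<xi> N \<tau> l)"
    have l': "keys l' \<subseteq> {..<N} \<and> \<xi> N \<tau> l' = \<xi> N \<tau> l"
      unfolding l'_def by (rule someI[of _ l]) (use l in auto)
    obtain \<sigma> where \<sigma>: "\<sigma> \<in> stab N \<tau>" "l' = act \<sigma> l"
      using stab_ex[OF \<xi>_eq, of N \<tau> l' l] l l' \<tau> by metis
    have "k_num (\<tau> a) (\<tau> b) = 0" if "a < N" "b < a" for a b
      using \<tau>[of a] \<tau>[of b] that k_num_singletons by fastforce
    then have "kprod N \<tau> = (1 :: (nat \<Rightarrow>\<^sub>0 nat) \<Rightarrow>\<^sub>0 'a)"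
      unfolding kprod_def by (intro prod.neutral) simp
    moreover have "L (\<xi> N \<tau> l) = lookup (av N \<tau> e :: (nat \<Rightarrow>\<^sub>0 nat) \<Rightarrow>\<^sub>0 'a) l'"
      using l unfolding L_def l'_def by auto
    ultimately show "pair L (vals X N \<tau> l) = lookup (kprod N \<tau> * av N \<tau> e) l"
      using \<sigma> \<tau> by (simp add: vals mon_def lookup_av_act)
  qed
  then show "\<exists>L. represents X ?S (\<lambda>_ _. False) N \<tau> (av N \<tau> e) L" by blast
qed

section \<open>Quotients of alternating sums by Vandermonde products\<close>

definition vars_in :: "'v set \<Rightarrow> (('v \<Rightarrow>\<^sub>0 nat) \<Rightarrow>\<^sub>0 'c::comm_ring_1) \<Rightarrow> bool" where
  "vars_in A p \<longleftrightarrow> (\<forall>m\<in>keys p. keys m \<subseteq> A)"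

lemma vars_in_zero [simp]: "vars_in A 0"
  and vars_in_one [simp]: "vars_in A 1"
  and vars_in_const [simp]: "vars_in A (Poly_Mapping.single 0 c)"
  by (simp_all add: vars_in_def)

lemma vars_in_mon [simp]: "keys m \<subseteq> A \<Longrightarrow> vars_in A (mon m)"
  by (simp add: vars_in_def mon_def)

lemma vars_in_pvar [simp]: "x \<in> A \<Longrightarrow> vars_in A (pvar x)"
  by (simp add: vars_in_def pvar_def)

lemma vars_in_add: "vars_in A p \<Longrightarrow> vars_in A q \<Longrightarrow> vars_in A (p + q)"
  using Poly_Mapping.keys_add[of p q] unfolding vars_in_def by blast

lemma vars_in_uminus: "vars_in A p \<Longrightarrow> vars_in A (- p)"
  unfolding vars_in_def by simp

lemma vars_in_diff: "vars_in A p \<Longrightarrow> vars_in A q \<Longrightarrow> vars_in A (p - q)"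
  using vars_in_add[of A p "- q"] vars_in_uminus[of A q] by simp

lemma vars_in_mult:
  assumes "vars_in A p" "vars_in A q"
  shows "vars_in A (p * q)"
  unfolding vars_in_def
proof
  fix m assume "m \<in> keys (p * q)"
  then obtain a b where "a \<in> keys p" "b \<in> keys q" "m = a + b"
    using keys_mult[of p q] by blast
  then show "keys m \<subseteq> A"
    using assms Poly_Mapping.keys_add[of a b] unfolding vars_in_def by blast
qed

lemma vars_in_sum: "(\<And>i. i \<in> B \<Longrightarrow> vars_in A (f i)) \<Longrightarrow> vars_in A (\<Sum>i\<in>B. f i)"
  by (induction B rule: infinite_finite_induct) (auto intro: vars_in_add)

lemma vars_in_prod: "(\<And>i. i \<in> B \<Longrightarrow> vars_in A (f i)) \<Longrightarrow> vars_in A (\<Prod>i\<in>B. f i)"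
  by (induction B rule: infinite_finite_induct) (auto intro: vars_in_mult)

lemma vars_in_power: "vars_in A p \<Longrightarrow> vars_in A (p ^ k)"
  by (induction k) (auto intro: vars_in_mult)

lemma evm_permute:
  assumes "w permutes A" "finite A" "keys e \<subseteq> A"
  shows "evm (\<lambda>k. v (w k)) (act w e) = evm v e"
proof -
  have "evm (\<lambda>k. v (w k)) (act w e) = (\<Prod>k\<in>A. v (w k) ^ lookup e (w k))"
    by (simp add: evm_superset[OF assms(2) keys_act[OF assms(1,3)]] lookup_act[OF assms(1)])
  also have "\<dots> = (\<Prod>k\<in>A. v k ^ lookup e k)"
    using prod.permute[OF assms(1), of "\<lambda>k. v k ^ lookup e k"] by (simp add: comp_def)
  finally show ?thesis by (simp add: evm_superset[OF assms(2,3)])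
qed

lemma lookup_ins_permute:
  fixes p :: "('v \<Rightarrow>\<^sub>0 nat) \<Rightarrow>\<^sub>0 'a::comm_ring_1"
  assumes w: "w permutes A" "finite A" and p: "vars_in A p" and e: "keys e \<subseteq> A"
  shows "lookup (ins (\<lambda>c. Poly_Mapping.single 0 c) (\<lambda>k. pvar (w k)) p) e = lookup p (act w e)"
proof -
  have "ins (\<lambda>c. Poly_Mapping.single 0 c) (\<lambda>k. pvar (w k)) p
      = (\<Sum>m\<in>keys p. Poly_Mapping.single (act (pinv w) m) (lookup p m))"
    unfolding ins_def
  proof (intro sum.cong refl)
    fix m assume "m \<in> keys p"
    then have m: "keys m \<subseteq> A" using p by (simp add: vars_in_def)
    have "act w (act (pinv w) m) = act (pinv w \<circ> w) m"
      using w permutes_inv by (intro act_comp)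
    then have "act w (act (pinv w) m) = m"
      by (simp add: permutes_inv_o(2)[OF w(1)])
    then have "evm (\<lambda>k. pvar (w k)) m = (mon (act (pinv w) m) :: ('v \<Rightarrow>\<^sub>0 nat) \<Rightarrow>\<^sub>0 'a)"
      using evm_permute[OF w keys_act[OF permutes_inv[OF w(1)] m], of "pvar :: 'v \<Rightarrow> ('v \<Rightarrow>\<^sub>0 nat) \<Rightarrow>\<^sub>0 'a"]
      by (simp add: evm_pvar)
    then show "Poly_Mapping.single 0 (lookup p m) * evm (\<lambda>k. pvar (w k)) m
        = Poly_Mapping.single (act (pinv w) m) (lookup p m)"
      by (simp add: mon_def mult_single)
  qed
  then have "lookup (ins (\<lambda>c. Poly_Mapping.single 0 c) (\<lambda>k. pvar (w k)) p) e
      = (\<Sum>m\<in>keys p. if act (pinv w) m = e then lookup p m else 0)"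
    by (simp add: lookup_sum lookup_single when_def)
  also have "\<dots> = (\<Sum>m\<in>keys p. if m = act w e then lookup p m else 0)"
  proof (intro sum.cong refl)
    fix m :: "'v \<Rightarrow>\<^sub>0 nat"
    have "act w (act (pinv w) m) = act (pinv w \<circ> w) m"
      using w permutes_inv by (intro act_comp)
    then have "act (pinv w) m = e \<longleftrightarrow> m = act w e"
      using act_inj[OF w(1), of "act (pinv w) m" e] by (simp add: permutes_inv_o(2)[OF w(1)])
    then show "(if act (pinv w) m = e then lookup p m else 0) = (if m = act w e then lookup p m else 0)"
      by simp
  qed
  also have "\<dots> = lookup p (act w e)"
    by (auto simp: in_keys_iff)
  finally show ?thesis .
qed

text \<open>The linear extension of \<open>av\<close>: once all \<open>av N \<rho> e\<close> are
  represented, so are all polynomials of this form.\<close>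

definition avp :: "nat \<Rightarrow> (nat \<Rightarrow> 't) \<Rightarrow> ((nat \<Rightarrow>\<^sub>0 nat) \<Rightarrow>\<^sub>0 'a::comm_ring_1) \<Rightarrow> (nat \<Rightarrow>\<^sub>0 nat) \<Rightarrow>\<^sub>0 'a" where
  "avp N \<rho> p = (\<Sum>m\<in>keys p. Poly_Mapping.single 0 (lookup p m) * av N \<rho> m)"

abbreviation sub :: "(nat \<Rightarrow> nat) \<Rightarrow> ((nat \<Rightarrow>\<^sub>0 nat) \<Rightarrow>\<^sub>0 'a::comm_ring_1) \<Rightarrow> (nat \<Rightarrow>\<^sub>0 nat) \<Rightarrow>\<^sub>0 'a" where
  "sub \<sigma> \<equiv> ins (\<lambda>c. Poly_Mapping.single 0 c) (\<lambda>b. pvar (\<sigma> b))"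

lemma comm_ring_hom_sub: "comm_ring_hom (sub \<sigma>)"
  by (rule comm_ring_hom.ins_hom[OF comm_ring_hom_const])

lemma sub_mon:
  assumes "\<sigma> permutes {..<N}" "keys e \<subseteq> {..<N}"
  shows "sub (pinv \<sigma>) (mon e) = (mon (act \<sigma> e) :: (nat \<Rightarrow>\<^sub>0 nat) \<Rightarrow>\<^sub>0 'a::comm_ring_1)"
proof -
  interpret comm_ring_hom "\<lambda>c::'a. Poly_Mapping.single (0::nat \<Rightarrow>\<^sub>0 nat) c"
    by (rule comm_ring_hom_const)
  have "evm (\<lambda>k. pvar (pinv \<sigma> (\<sigma> k)) :: (nat \<Rightarrow>\<^sub>0 nat) \<Rightarrow>\<^sub>0 'a) (act \<sigma> e) = evm (\<lambda>k. pvar (pinv \<sigma> k)) e"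
    by (rule evm_permute[OF assms(1) _ assms(2)]) simp
  then have "evm (\<lambda>k. pvar (pinv \<sigma> k)) e = (mon (act \<sigma> e) :: (nat \<Rightarrow>\<^sub>0 nat) \<Rightarrow>\<^sub>0 'a)"
    by (simp add: permutes_inverses[OF assms(1)] evm_pvar)
  moreover have "sub (pinv \<sigma>) (mon e) = (evm (\<lambda>k. pvar (pinv \<sigma> k)) e :: (nat \<Rightarrow>\<^sub>0 nat) \<Rightarrow>\<^sub>0 'a)"
    by (simp add: mon_def)
  ultimately show ?thesis by simp
qed

lemma avp_sub:
  assumes "vars_in {..<N} p"
  shows "avp N \<rho> p = (\<Sum>\<sigma>\<in>stab N \<rho>. sub (pinv \<sigma>) p)"
proof -
  have "sub (pinv \<sigma>) p = (\<Sum>m\<in>keys p. Poly_Mapping.single 0 (lookup p m) * mon (act \<sigma> m))"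
    if "\<sigma> \<in> stab N \<rho>" for \<sigma>
  proof -
    interpret comm_ring_hom "sub (pinv \<sigma>) :: _ \<Rightarrow> (nat \<Rightarrow>\<^sub>0 nat) \<Rightarrow>\<^sub>0 'a" by (rule comm_ring_hom_sub)
    interpret c: comm_ring_hom "\<lambda>c::'a. Poly_Mapping.single (0::nat \<Rightarrow>\<^sub>0 nat) c"
      by (rule comm_ring_hom_const)
    have "p = (\<Sum>m\<in>keys p. Poly_Mapping.single 0 (lookup p m) * mon m)"
      using poly_mapping_expand[of p] by (simp add: mon_def mult_single)
    then have "sub (pinv \<sigma>) p = (\<Sum>m\<in>keys p. sub (pinv \<sigma>) (Poly_Mapping.single 0 (lookup p m)) * sub (pinv \<sigma>) (mon m))"
      by (metis (no_types, lifting) hom_mult hom_sum sum.cong)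
    also have "\<dots> = (\<Sum>m\<in>keys p. Poly_Mapping.single 0 (lookup p m) * mon (act \<sigma> m))"
    proof (intro sum.cong refl)
      fix m assume "m \<in> keys p"
      then have "keys m \<subseteq> {..<N}" using assms by (simp add: vars_in_def)
      then show "sub (pinv \<sigma>) (Poly_Mapping.single 0 (lookup p m)) * sub (pinv \<sigma>) (mon m)
          = Poly_Mapping.single 0 (lookup p m) * mon (act \<sigma> m)"
        by (simp add: sub_mon[OF stabD(1)[OF that]])
    qed
    finally show ?thesis .
  qed
  then have "(\<Sum>\<sigma>\<in>stab N \<rho>. sub (pinv \<sigma>) p)
      = (\<Sum>\<sigma>\<in>stab N \<rho>. \<Sum>m\<in>keys p. Poly_Mapping.single 0 (lookup p m) * mon (act \<sigma> m))"
    by simp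
  also have "\<dots> = (\<Sum>m\<in>keys p. \<Sum>\<sigma>\<in>stab N \<rho>. Poly_Mapping.single 0 (lookup p m) * mon (act \<sigma> m))"
    by (rule sum.swap)
  finally show ?thesis
    by (simp add: avp_def av_def sum_distrib_left)
qed

lemma sorted_enumeration:
  fixes r :: "nat \<Rightarrow> nat"
  assumes "finite A"
  obtains a where "bij_betw a {..<card A} A" "\<And>i j. i \<le> j \<Longrightarrow> j < card A \<Longrightarrow> r (a i) \<le> r (a j)"
proof -
  define xs where "xs = sort_key r (sls A)"
  have xs: "distinct xs" "set xs = A" "length xs = card A" "sorted (map r xs)"
    using assms by (auto simp: xs_def)
  have "bij_betw (nth xs) {..<card A} A"
    using bij_betw_nth[OF xs(1) refl refl] xs(2,3) by simp
  moreover have "r (xs ! i) \<le> r (xs ! j)" if "i \<le> j" "j < card A" for i j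
    using sorted_nth_mono[OF xs(4), of i j] that xs(3) by simp
  ultimately show ?thesis using that by blast
qed

text \<open>
  The positions \<open>a 0, \<dots>, a (m - 1)\<close> are those whose row set is extended by the new row; \<open>\<rho>\<close> gives
  the row sets before the extension.
\<close>

locale symmetrization =
  fixes N m :: nat and \<rho> :: "nat \<Rightarrow> nat set" and E :: "nat set set" and a :: "nat \<Rightarrow> nat"
  assumes a_inj: "inj_on a {..<m}" and a_lt: "\<And>k. k < m \<Longrightarrow> a k < N"
    and a_E: "\<And>k. k < m \<Longrightarrow> \<rho> (a k) \<in> E"
    and a_mono: "\<And>i j. i \<le> j \<Longrightarrow> j < m \<Longrightarrow> bin (\<rho> (a i)) \<le> bin (\<rho> (a j))"
begin

abbreviation rk :: "nat \<Rightarrow> nat" where "rk k \<equiv> bin (\<rho> (a k))"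

text \<open>Positions of smaller rank count whether they are extended or not. The extended ones will
  cancel against \<open>vdiff\<close>; the others give the factors that \<open>kprod\<close>
  gains.\<close>

definition low :: "nat \<Rightarrow> nat set" where
  "low k = {b. b < N \<and> \<rho> b \<in> E \<and> bin (\<rho> b) < rk k}"

definition vsame :: "(nat \<Rightarrow> 'r::comm_ring_1) \<Rightarrow> 'r" where
  "vsame v = (\<Prod>b<m. \<Prod>c | c < b \<and> rk c = rk b. (v b - v c))"

definition vdiff :: "(nat \<Rightarrow> 'r::comm_ring_1) \<Rightarrow> 'r" where
  "vdiff v = (\<Prod>b<m. \<Prod>c | c < m \<and> rk c < rk b. (v b - v c))"

definition theta :: "(nat \<Rightarrow> 'r::comm_ring_1) \<Rightarrow> (nat \<Rightarrow> 'r) \<Rightarrow> 'r" where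
  "theta s v = (\<Prod>k<m. \<Prod>b\<in>low k. (v k - s b))"

text \<open>Since \<open>a\<close> lists the positions by increasing rank, the indices below
  \<open>b\<close> are those of smaller rank together with the earlier ones of equal rank.\<close>

lemma vand_split: "vand m v = vsame v * vdiff v"
proof -
  have "(\<Prod>c<b. (v b - v c)) = (\<Prod>c | c < b \<and> rk c = rk b. (v b - v c)) * (\<Prod>c | c < m \<and> rk c < rk b. (v b - v c))"
    if b: "b < m" for b
  proof -
    have "rk c \<le> rk b" if "c < b" for c using a_mono[of c b] that b by simp
    moreover have "c < b" if "rk c < rk b" "c < m" for c
      using a_mono[of b c] that by (cases "c < b") auto
    ultimately have "{..<b} = {c. c < b \<and> rk c = rk b} \<union> {c. c < m \<and> rk c < rk b}"
      using b by (auto simp: le_less)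
    then show ?thesis
      by (simp add: prod.union_disjoint[symmetric] disjoint_iff)
  qed
  then show ?thesis by (simp add: vand_def vsame_def vdiff_def prod.distrib)
qed

definition rkperms :: "(nat \<Rightarrow> nat) set" where
  "rkperms = {w. w permutes {..<m} \<and> (\<forall>k<m. rk (w k) = rk k)}"

lemma finite_low [simp]: "finite (low k)"
  by (simp add: low_def)

lemma vdiff_perm:
  assumes "w \<in> rkperms"
  shows "vdiff (\<lambda>k. v (w k)) = vdiff v"
proof -
  have w: "w permutes {..<m}" "\<And>k. k < m \<Longrightarrow> rk (w k) = rk k" using assms by (auto simp: rkperms_def)
  have wl: "w k < m \<longleftrightarrow> k < m" for k using permutes_in_image[OF w(1), of k] by simp
  have "(\<Prod>c | c < m \<and> rk c < rk b. (v (w b) - v (w c))) = (\<Prod>c | c < m \<and> rk c < rk (w b). (v (w b) - v c))"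
    if "b < m" for b
  proof (rule prod.reindex_bij_betw)
    show "bij_betw w {c. c < m \<and> rk c < rk b} {c. c < m \<and> rk c < rk (w b)}"
    proof (rule bij_betw_byWitness[where f' = "pinv w"])
      have p: "pinv w permutes {..<m}" by (rule permutes_inv[OF w(1)])
      have il: "pinv w c < m \<longleftrightarrow> c < m" for c using permutes_in_image[OF p, of c] by simp
      have "rk (pinv w c) = rk c" if "c < m" for c
        using w(2)[of "pinv w c"] il that permutes_inverses(1)[OF w(1)] by simp
      then show "pinv w ` {c. c < m \<and> rk c < rk (w b)} \<subseteq> {c. c < m \<and> rk c < rk b}"
        using il w(2) that by auto
      show "w ` {c. c < m \<and> rk c < rk b} \<subseteq> {c. c < m \<and> rk c < rk (w b)}"
        using wl w(2) that by auto
    qed (simp_all add: permutes_inverses[OF w(1)])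
  qed
  then have "vdiff (\<lambda>k. v (w k)) = (\<Prod>b<m. \<Prod>c | c < m \<and> rk c < rk (w b). (v (w b) - v c))"
    by (simp add: vdiff_def)
  also have "\<dots> = vdiff v"
    unfolding vdiff_def
    using prod.permute[OF w(1), of "\<lambda>b. \<Prod>c | c < m \<and> rk c < rk b. (v b - v c)"] by (simp add: comp_def)
  finally show ?thesis .
qed

text \<open>The full Vandermonde product changes by \<open>signof w\<close> and \<open>vdiff\<close>
  not at all; cancelling the nonzero \<open>vdiff\<close> leaves the sign with
  \<open>vsame\<close>.\<close>

lemma vsame_perm:
  fixes v :: "nat \<Rightarrow> 'r::idom"
  assumes "w \<in> rkperms" "inj_on v {..<m}"
  shows "vsame (\<lambda>k. v (w k)) = signof w * vsame v"
proof -
  have w: "w permutes {..<m}" using assms by (auto simp: rkperms_def)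
  have "vsame (\<lambda>k. v (w k)) * vdiff v = signof w * vsame v * vdiff v"
    using vand_permute[OF w, of v] vand_split[of v] vand_split[of "\<lambda>k. v (w k)"] vdiff_perm[OF assms(1), of v]
    by (simp add: mult.assoc)
  moreover have "vdiff v \<noteq> 0" using vand_nonzero[OF assms(2)] vand_split[of v] by auto
  ultimately show ?thesis by simp
qed

lemma theta_perm:
  assumes "w \<in> rkperms"
  shows "theta s (\<lambda>k. v (w k)) = theta s v"
proof -
  have w: "w permutes {..<m}" "\<And>k. k < m \<Longrightarrow> rk (w k) = rk k" using assms by (auto simp: rkperms_def)
  have "theta s (\<lambda>k. v (w k)) = (\<Prod>k<m. \<Prod>b\<in>low (w k). (v (w k) - s b))"
    unfolding theta_def using w(2) by (intro prod.cong refl) (simp add: low_def)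
  also have "\<dots> = theta s v"
    unfolding theta_def using prod.permute[OF w(1), of "\<lambda>k. \<Prod>b\<in>low k. (v k - s b)"] by (simp add: comp_def)
  finally show ?thesis .
qed

definition offset :: "(nat \<Rightarrow>\<^sub>0 nat) \<Rightarrow>\<^sub>0 'a::comm_ring_1" where
  "offset = (\<Prod>k<m. \<Prod>b\<in>low k - a ` {..<m}. (pvar (a k) - pvar b))"

lemma theta_split:
  "theta pvar (\<lambda>k. pvar (a k)) = vdiff (\<lambda>k. pvar (a k)) * (offset :: (nat \<Rightarrow>\<^sub>0 nat) \<Rightarrow>\<^sub>0 'a::comm_ring_1)"
proof -
  have "(\<Prod>b\<in>low k. (pvar (a k) - pvar b :: (nat \<Rightarrow>\<^sub>0 nat) \<Rightarrow>\<^sub>0 'a)) =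
      (\<Prod>c | c < m \<and> rk c < rk k. (pvar (a k) - pvar (a c))) * (\<Prod>b\<in>low k - a ` {..<m}. (pvar (a k) - pvar b))" for k
  proof -
    have l: "low k = a ` {c. c < m \<and> rk c < rk k} \<union> (low k - a ` {..<m})"
      using a_lt a_E by (auto simp: low_def)
    have "(\<Prod>b\<in>low k. (pvar (a k) - pvar b :: (nat \<Rightarrow>\<^sub>0 nat) \<Rightarrow>\<^sub>0 'a)) =
        (\<Prod>b\<in>a ` {c. c < m \<and> rk c < rk k}. (pvar (a k) - pvar b)) * (\<Prod>b\<in>low k - a ` {..<m}. (pvar (a k) - pvar b))"
      by (subst l, rule prod.union_disjoint) auto
    moreover have "inj_on a {c. c < m \<and> rk c < rk k}" by (rule inj_on_subset[OF a_inj]) auto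
    ultimately show ?thesis by (simp add: prod.reindex)
  qed
  then show ?thesis by (simp add: theta_def vdiff_def offset_def prod.distrib)
qed

text \<open>The term to be antisymmetrized. The factor \<open>theta\<close> forces the ranks, and
  \<open>vsame\<close> supplies the sign that compensates \<open>signof w\<close> for
  rank-preserving \<open>w\<close>; at the target their product contains the Vandermonde product to
  be divided out. The coefficient map \<open>f\<close> is a parameter, so that the formula can be
  formed with independent \<open>v\<close> and specialized afterwards.\<close>

definition hval :: "(nat \<Rightarrow>\<^sub>0 nat) \<Rightarrow> (nat \<Rightarrow>\<^sub>0 nat) \<Rightarrow>
    (((nat \<Rightarrow>\<^sub>0 nat) \<Rightarrow>\<^sub>0 'a::comm_ring_1) \<Rightarrow> 'r::comm_ring_1) \<Rightarrow> (nat \<Rightarrow> 'r) \<Rightarrow> 'r" where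
  "hval \<alpha> \<beta> f v = f (mon \<alpha>) * (\<Prod>k<m. v k ^ lookup \<beta> k) * vsame v * theta (\<lambda>b. f (pvar b)) v"

lemma hom_hval:
  assumes "comm_ring_hom \<phi>"
  shows "\<phi> (hval \<alpha> \<beta> f v) = hval \<alpha> \<beta> (\<lambda>c. \<phi> (f c)) (\<lambda>k. \<phi> (v k))"
proof -
  interpret comm_ring_hom \<phi> by (rule assms)
  show ?thesis
    by (simp add: hval_def vsame_def theta_def hom_mult hom_prod hom_power hom_minus)
qed

end

lemma pvar_inj: "pvar x = (pvar y :: ('v \<Rightarrow>\<^sub>0 nat) \<Rightarrow>\<^sub>0 'c::comm_ring_1) \<longleftrightarrow> x = y"
proof
  assume "pvar x = (pvar y :: ('v \<Rightarrow>\<^sub>0 nat) \<Rightarrow>\<^sub>0 'c)"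
  then have "keys (pvar x :: ('v \<Rightarrow>\<^sub>0 nat) \<Rightarrow>\<^sub>0 'c) = keys (pvar y :: ('v \<Rightarrow>\<^sub>0 nat) \<Rightarrow>\<^sub>0 'c)" by simp
  then have "keys (Poly_Mapping.single x (1::nat)) = keys (Poly_Mapping.single y (1::nat))"
    by (simp add: pvar_def)
  then show "x = y" by simp
qed simp

lemma evm_truncate:
  "evm (\<lambda>k. if k \<in> A then pvar k else 0) e = (if keys e \<subseteq> A then mon e else 0)"
proof (cases "keys e \<subseteq> A")
  case True
  then have "evm (\<lambda>k. if k \<in> A then pvar k else 0) e = evm pvar e"
    unfolding evm_def by (intro prod.cong refl) auto
  with True show ?thesis by (simp add: evm_pvar)
next
  case False
  then obtain x where "x \<in> keys e" "x \<notin> A" by blast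
  then have "evm (\<lambda>k. if k \<in> A then pvar k else 0) e = 0"
    unfolding evm_def by (intro prod_zero[OF finite_keys] bexI[of _ x]) (auto simp: in_keys_iff zero_power)
  with False show ?thesis by simp
qed

lemma ins_truncate_mon:
  assumes "keys e \<subseteq> A"
  shows "ins (\<lambda>c. Poly_Mapping.single 0 c) (\<lambda>k. if k \<in> A then pvar k else 0) (mon e) = (mon e :: ('v \<Rightarrow>\<^sub>0 nat) \<Rightarrow>\<^sub>0 'c::comm_ring_1)"
proof -
  interpret comm_ring_hom "\<lambda>c::'c. Poly_Mapping.single (0::'v \<Rightarrow>\<^sub>0 nat) c" by (rule comm_ring_hom_const)
  show ?thesis using assms by (subst mon_def) (simp add: evm_truncate)
qed

lemma vars_in_truncate:
  "vars_in A (ins (\<lambda>c. Poly_Mapping.single 0 c) (\<lambda>k. if k \<in> A then pvar k else 0) p)"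
  unfolding ins_def evm_truncate by (intro vars_in_sum vars_in_mult) auto

abbreviation pconst :: "'c::comm_ring_1 \<Rightarrow> ('v \<Rightarrow>\<^sub>0 nat) \<Rightarrow>\<^sub>0 'c" where
  "pconst c \<equiv> Poly_Mapping.single 0 c"

context symmetrization
begin

lemma hval_cong:
  assumes "f (mon \<alpha>) = f' (mon \<alpha>)" "\<And>b. b < N \<Longrightarrow> f (pvar b) = f' (pvar b)"
    and "\<And>k. k < m \<Longrightarrow> v k = v' k"
  shows "hval \<alpha> \<beta> f v = hval \<alpha> \<beta> f' v'"
proof -
  have "vsame v = vsame v'"
    unfolding vsame_def using assms(3) by (intro prod.cong refl) auto
  moreover have "theta (\<lambda>b. f (pvar b)) v = theta (\<lambda>b. f' (pvar b)) v'"
    unfolding theta_def using assms(2,3) by (intro prod.cong refl) (auto simp: low_def)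
  ultimately show ?thesis using assms(1,3) by (simp add: hval_def)
qed

definition alternant :: "(nat \<Rightarrow>\<^sub>0 nat) \<Rightarrow> (nat \<Rightarrow>\<^sub>0 nat) \<Rightarrow>
    (((nat \<Rightarrow>\<^sub>0 nat) \<Rightarrow>\<^sub>0 'a::comm_ring_1) \<Rightarrow> 'r::comm_ring_1) \<Rightarrow> (nat \<Rightarrow> 'r) \<Rightarrow> 'r" where
  "alternant \<alpha> \<beta> f v = (\<Sum>w | w permutes {..<m}. signof w * hval \<alpha> \<beta> f (\<lambda>k. v (w k)))"

lemma hom_alternant:
  assumes "comm_ring_hom \<phi>"
  shows "\<phi> (alternant \<alpha> \<beta> f v) = alternant \<alpha> \<beta> (\<lambda>c. \<phi> (f c)) (\<lambda>k. \<phi> (v k))"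
proof -
  interpret comm_ring_hom \<phi> by (rule assms)
  show ?thesis
    unfolding alternant_def hom_sum
    by (intro sum.cong refl) (simp add: hom_mult hom_hval[OF assms] hom_signof)
qed

lemma alternant_cong:
  assumes "f (mon \<alpha>) = f' (mon \<alpha>)" "\<And>b. b < N \<Longrightarrow> f (pvar b) = f' (pvar b)"
    and "\<And>k. k < m \<Longrightarrow> v k = v' k"
  shows "alternant \<alpha> \<beta> f v = alternant \<alpha> \<beta> f' v'"
  unfolding alternant_def
proof (intro sum.cong refl arg_cong2[of _ _ _ _ "(*)"] hval_cong)
  fix w k assume "w \<in> {w. w permutes {..<m}}" "k < m"
  then show "v (w k) = v' (w k)" using assms(3) permutes_in_image[of w "{..<m}" k] by simp
qed (use assms in auto)

text \<open>
  The alternating sum of \<open>hval\<close> is divisible by the Vandermonde product. The quotient \<open>G\<close>, evaluated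
  at the positions of the new type, vanishes unless that type is at least the target in the dominance
  order of ranks, because one of the factors of \<open>theta\<close> is then zero.
\<close>

definition quotient :: "(nat \<Rightarrow>\<^sub>0 nat) \<Rightarrow> (nat \<Rightarrow>\<^sub>0 nat) \<Rightarrow>
    ((nat \<Rightarrow>\<^sub>0 nat) \<Rightarrow>\<^sub>0 (nat \<Rightarrow>\<^sub>0 nat) \<Rightarrow>\<^sub>0 'a::comm_ring_1) \<Rightarrow> bool" where
  "quotient \<alpha> \<beta> G \<longleftrightarrow> vars_in {..<m} G \<and> (\<forall>e. vars_in {..<N} (lookup G e)) \<and>
     alternant \<alpha> \<beta> pconst pvar = vand m pvar * G"

text \<open>The quotient \<open>g\<close> supplied by \<open>alternating_sum\<close> may involve
  stray variables. Setting to zero all variables outside \<open>{..<m}\<close>, and in the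
  coefficients all outside \<open>{..<N}\<close>, changes neither the alternating sum nor the
  Vandermonde product and turns \<open>g\<close> into \<open>G\<close>.\<close>

lemma quotient_ex:
  assumes \<alpha>: "keys \<alpha> \<subseteq> {..<N}"
  shows "\<exists>G :: (nat \<Rightarrow>\<^sub>0 nat) \<Rightarrow>\<^sub>0 (nat \<Rightarrow>\<^sub>0 nat) \<Rightarrow>\<^sub>0 'a::comm_ring_1. quotient \<alpha> \<beta> G"
proof -
  define h :: "(nat \<Rightarrow>\<^sub>0 nat) \<Rightarrow>\<^sub>0 (nat \<Rightarrow>\<^sub>0 nat) \<Rightarrow>\<^sub>0 'a" where "h = hval \<alpha> \<beta> pconst pvar"
  have "vars_in {..<m} h"
    unfolding h_def hval_def vsame_def theta_def
    by (intro vars_in_mult vars_in_prod vars_in_power vars_in_diff vars_in_const vars_in_pvar) auto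
  then obtain g where g: "(\<Sum>w | w permutes {..<m}. signof w * ins pconst (\<lambda>k. pvar (w k)) h) = vand m pvar * g"
    using alternating_sum[of h m pconst pvar] by (auto simp: vars_in_def)
  interpret c: comm_ring_hom "pconst :: ((nat \<Rightarrow>\<^sub>0 nat) \<Rightarrow>\<^sub>0 'a) \<Rightarrow> (nat \<Rightarrow>\<^sub>0 nat) \<Rightarrow>\<^sub>0 (nat \<Rightarrow>\<^sub>0 nat) \<Rightarrow>\<^sub>0 'a"
    by (rule comm_ring_hom_const)
  have insp: "ins pconst v (pvar x) = v x" for v :: "nat \<Rightarrow> (nat \<Rightarrow>\<^sub>0 nat) \<Rightarrow>\<^sub>0 (nat \<Rightarrow>\<^sub>0 nat) \<Rightarrow>\<^sub>0 'a" and x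
    by (simp add: pvar_def)
  have "ins pconst (\<lambda>k. pvar (w k)) h = hval \<alpha> \<beta> (\<lambda>c. ins pconst (\<lambda>k. pvar (w k)) (pconst c))
      (\<lambda>x. ins pconst (\<lambda>k. pvar (w k)) (pvar x))" for w :: "nat \<Rightarrow> nat"
    unfolding h_def by (rule hom_hval[OF c.ins_hom])
  then have "ins pconst (\<lambda>k. pvar (w k)) h = hval \<alpha> \<beta> pconst (\<lambda>k. pvar (w k))" for w :: "nat \<Rightarrow> nat"
    by (simp add: insp)
  then have alt: "alternant \<alpha> \<beta> pconst pvar = vand m pvar * g"
    using g by (simp add: alternant_def)
  define r :: "((nat \<Rightarrow>\<^sub>0 nat) \<Rightarrow>\<^sub>0 'a) \<Rightarrow> (nat \<Rightarrow>\<^sub>0 nat) \<Rightarrow>\<^sub>0 'a" where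
    "r = ins pconst (\<lambda>k. if k \<in> {..<N} then pvar k else 0)"
  have r: "comm_ring_hom r" unfolding r_def by (rule comm_ring_hom.ins_hom[OF comm_ring_hom_const])
  interpret r: comm_ring_hom r by (rule r)
  have cr: "comm_ring_hom (\<lambda>c. pconst (r c) :: (nat \<Rightarrow>\<^sub>0 nat) \<Rightarrow>\<^sub>0 (nat \<Rightarrow>\<^sub>0 nat) \<Rightarrow>\<^sub>0 'a)"
    by unfold_locales (simp_all add: r.hom_add r.hom_mult c.hom_add c.hom_mult)
  interpret cr: comm_ring_hom "\<lambda>c. pconst (r c) :: (nat \<Rightarrow>\<^sub>0 nat) \<Rightarrow>\<^sub>0 (nat \<Rightarrow>\<^sub>0 nat) \<Rightarrow>\<^sub>0 'a" by (rule cr)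
  define t :: "nat \<Rightarrow> (nat \<Rightarrow>\<^sub>0 nat) \<Rightarrow>\<^sub>0 (nat \<Rightarrow>\<^sub>0 nat) \<Rightarrow>\<^sub>0 'a" where
    "t = (\<lambda>k. if k \<in> {..<m} then pvar k else 0)"
  define \<psi> where "\<psi> = ins (\<lambda>c. pconst (r c)) t"
  have \<psi>: "comm_ring_hom \<psi>" unfolding \<psi>_def by (rule cr.ins_hom)
  interpret \<psi>: comm_ring_hom \<psi> by (rule \<psi>)
  have \<psi>p: "\<psi> (pvar x) = t x" for x by (simp add: \<psi>_def pvar_def)
  have \<psi>c: "\<psi> (pconst c) = pconst (r c)" for c by (simp add: \<psi>_def)
  have r_pvar: "r (pvar b) = pvar b" if "b < N" for b
    using that ins_truncate_mon[of "Poly_Mapping.single b 1" "{..<N}"] by (simp add: r_def pvar_def mon_def)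
  have r_mon: "r (mon \<alpha>) = mon \<alpha>" unfolding r_def by (rule ins_truncate_mon[OF \<alpha>])
  define G where "G = (\<Sum>e | e \<in> keys g \<and> keys e \<subseteq> {..<m}. Poly_Mapping.single e (r (lookup g e)))"
  have "\<psi> g = (\<Sum>e\<in>keys g. if keys e \<subseteq> {..<m} then Poly_Mapping.single e (r (lookup g e)) else 0)"
    unfolding \<psi>_def ins_def t_def evm_truncate by (intro sum.cong refl) (simp add: mon_def mult_single)
  also have "\<dots> = G"
    unfolding G_def by (subst sum.inter_filter[symmetric]) auto
  finally have \<psi>g: "\<psi> g = G" .
  have "\<psi> (alternant \<alpha> \<beta> pconst pvar) = alternant \<alpha> \<beta> (\<lambda>c. \<psi> (pconst c)) (\<lambda>x. \<psi> (pvar x))"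
    by (rule hom_alternant[OF \<psi>])
  also have "\<dots> = alternant \<alpha> \<beta> pconst pvar"
    by (rule alternant_cong) (simp_all add: \<psi>c \<psi>p r_pvar r_mon t_def)
  finally have "\<psi> (alternant \<alpha> \<beta> pconst pvar) = alternant \<alpha> \<beta> pconst pvar" .
  moreover have "\<psi> (vand m pvar) = vand m pvar"
    unfolding \<psi>.hom_vand unfolding vand_def by (intro prod.cong refl) (auto simp: \<psi>p t_def)
  ultimately have "alternant \<alpha> \<beta> pconst pvar = vand m pvar * G"
    using arg_cong[OF alt, of \<psi>] by (simp add: \<psi>.hom_mult \<psi>g)
  moreover have "lookup G e = (\<Sum>e'\<in>{e'. e' \<in> keys g \<and> keys e' \<subseteq> {..<m}}. if e' = e then r (lookup g e') else 0)" for e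
    by (simp add: G_def lookup_sum lookup_single when_def)
  then have lG: "lookup G e = (if e \<in> keys g \<and> keys e \<subseteq> {..<m} then r (lookup g e) else 0)" for e
    by simp
  have "vars_in {..<N} (r p)" for p
    unfolding r_def by (rule vars_in_truncate)
  then have "vars_in {..<N} (lookup G e)" for e
    by (simp add: lG)
  moreover have "vars_in {..<m} G"
    by (auto simp: vars_in_def in_keys_iff[of _ G] lG split: if_splits)
  ultimately show ?thesis unfolding quotient_def by blast
qed

lemma quotient_eval:
  assumes G: "quotient \<alpha> \<beta> G" and f: "comm_ring_hom f"
  shows "alternant \<alpha> \<beta> f v = vand m v * ins f v G"
proof -
  interpret f: comm_ring_hom f by (rule f)
  interpret i: comm_ring_hom "ins f v" by (rule f.ins_hom)
  have "ins f v (alternant \<alpha> \<beta> pconst pvar)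
      = alternant \<alpha> \<beta> (\<lambda>c. ins f v (pconst c)) (\<lambda>x. ins f v (pvar x))"
    by (rule hom_alternant[OF f.ins_hom])
  then have "ins f v (alternant \<alpha> \<beta> pconst pvar) = alternant \<alpha> \<beta> f v"
    by (simp add: pvar_def)
  moreover have "ins f v (vand m pvar * G) = vand m v * ins f v G"
    by (simp add: i.hom_mult i.hom_vand) (simp add: pvar_def)
  ultimately show ?thesis using G unfolding quotient_def by metis
qed

lemma signof_square: "signof w * (signof w * x) = (x :: 'r::comm_ring_1)"
  by (cases w rule: sign_cases) auto

lemma alternant_permute:
  assumes w0: "w0 permutes {..<m}"
  shows "alternant \<alpha> \<beta> f (\<lambda>k. v (w0 k)) = signof w0 * alternant \<alpha> \<beta> f v"
proof -
  have "signof w0 * alternant \<alpha> \<beta> f v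
      = signof w0 * (\<Sum>w | w permutes {..<m}. signof (w0 \<circ> w) * hval \<alpha> \<beta> f (\<lambda>k. v ((w0 \<circ> w) k)))"
    unfolding alternant_def
    using setum_permutations_compose_left[OF w0, of "\<lambda>w. signof w * hval \<alpha> \<beta> f (\<lambda>k. v (w k))"]
    by (rule arg_cong)
  also have "\<dots> = (\<Sum>w | w permutes {..<m}. signof w * hval \<alpha> \<beta> f (\<lambda>k. v (w0 (w k))))"
    unfolding sum_distrib_left
  proof (intro sum.cong refl)
    fix w assume "w \<in> {w. w permutes {..<m}}"
    then have "sign (w0 \<circ> w) = sign w0 * sign w"
      using w0 permutes_imp_permutation[of "{..<m}"] by (intro sign_compose) auto
    then show "signof w0 * (signof (w0 \<circ> w) * hval \<alpha> \<beta> f (\<lambda>k. v ((w0 \<circ> w) k))) = signof w * hval \<alpha> \<beta> f (\<lambda>k. v (w0 (w k)))"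
      by (simp add: mult.assoc signof_square)
  qed
  finally show ?thesis by (simp add: alternant_def)
qed

text \<open>The alternating sum and the Vandermonde product change by the same sign, and the latter
  can be cancelled in a domain. This symmetry lets \<open>G\<close> be paired with monomials of the
  new entry, which forget the order of the exponents.\<close>

lemma quotient_symmetric:
  fixes G :: "(nat \<Rightarrow>\<^sub>0 nat) \<Rightarrow>\<^sub>0 (nat \<Rightarrow>\<^sub>0 nat) \<Rightarrow>\<^sub>0 'a::idom"
  assumes G: "quotient \<alpha> \<beta> G" and w: "w permutes {..<m}" and e: "keys e \<subseteq> {..<m}"
  shows "lookup G (act w e) = lookup G e"
proof -
  let ?P = "pvar :: nat \<Rightarrow> (nat \<Rightarrow>\<^sub>0 nat) \<Rightarrow>\<^sub>0 (nat \<Rightarrow>\<^sub>0 nat) \<Rightarrow>\<^sub>0 'a"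
  let ?W = "ins pconst (\<lambda>k. pvar (w k)) G"
  have "signof w * vand m ?P * ?W = alternant \<alpha> \<beta> pconst (\<lambda>k. ?P (w k))"
    using quotient_eval[OF G comm_ring_hom_const, of "\<lambda>k. ?P (w k)"] vand_permute[OF w, of ?P] by simp
  also have "\<dots> = signof w * (vand m ?P * G)"
    using alternant_permute[OF w, of \<alpha> \<beta> pconst ?P] G by (simp add: quotient_def)
  finally have "signof w * (signof w * (vand m ?P * ?W)) = signof w * (signof w * (vand m ?P * G))"
    by (simp add: mult.assoc)
  then have "vand m ?P * ?W = vand m ?P * G" by (simp only: signof_square)
  moreover have "vand m (pvar :: nat \<Rightarrow> (nat \<Rightarrow>\<^sub>0 nat) \<Rightarrow>\<^sub>0 (nat \<Rightarrow>\<^sub>0 nat) \<Rightarrow>\<^sub>0 'a) \<noteq> 0"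
    by (intro vand_nonzero inj_onI) (simp add: pvar_inj)
  ultimately have "?W = G" by simp
  moreover have "lookup ?W e = lookup G (act w e)"
    using G by (intro lookup_ins_permute[OF w _ _ e]) (auto simp: quotient_def)
  ultimately show ?thesis by simp
qed

text \<open>The coefficients of \<open>G\<close> are symmetrized under \<open>stab N \<rho>\<close>
  because functionals for the old row sets are available only for symmetrized polynomials.\<close>

definition gavg :: "((nat \<Rightarrow>\<^sub>0 nat) \<Rightarrow>\<^sub>0 (nat \<Rightarrow>\<^sub>0 nat) \<Rightarrow>\<^sub>0 'a::comm_ring_1) \<Rightarrow>
    (nat \<Rightarrow> (nat \<Rightarrow>\<^sub>0 nat) \<Rightarrow>\<^sub>0 'a) \<Rightarrow> (nat \<Rightarrow>\<^sub>0 nat) \<Rightarrow>\<^sub>0 'a" where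
  "gavg G v = (\<Sum>e\<in>keys G. avp N \<rho> (lookup G e) * evm v e)"

lemma theta_stab:
  assumes "\<sigma> \<in> stab N \<rho>"
  shows "theta (\<lambda>b. s (\<sigma> b)) v = theta s v"
  unfolding theta_def
proof (rule prod.cong[OF refl])
  fix k
  have "bij_betw \<sigma> (low k) (low k)"
  proof (rule bij_betw_byWitness[where f' = "pinv \<sigma>"])
    show "\<sigma> ` low k \<subseteq> low k"
      using stabD(2,3)[OF assms] by (auto simp: low_def)
    show "pinv \<sigma> ` low k \<subseteq> low k"
      using stabD(2,3)[OF stab_inv[OF assms]] by (auto simp: low_def)
  qed (simp_all add: permutes_inverses[OF stabD(1)[OF assms]])
  then show "(\<Prod>b\<in>low k. (v k - s (\<sigma> b))) = (\<Prod>b\<in>low k. (v k - s b))"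
    by (rule prod.reindex_bij_betw)
qed

text \<open>The factor \<open>theta\<close> is invariant under \<open>stab N \<rho>\<close>, so
  symmetrizing the coefficients affects only the factor \<open>mon \<alpha>\<close>.\<close>

lemma gavg_eq:
  assumes G: "quotient \<alpha> \<beta> G" and \<alpha>: "keys \<alpha> \<subseteq> {..<N}"
  shows "vand m v * gavg G v = av N \<rho> \<alpha> * (\<Sum>w | w permutes {..<m}. signof w *
    ((\<Prod>k<m. v (w k) ^ lookup \<beta> k) * vsame (\<lambda>k. v (w k)) * theta pvar (\<lambda>k. v (w k))))" (is "_ = _ * ?T")
proof -
  have "gavg G v = (\<Sum>\<sigma>\<in>stab N \<rho>. ins (sub (pinv \<sigma>)) v G)"
  proof -
    have "gavg G v = (\<Sum>e\<in>keys G. \<Sum>\<sigma>\<in>stab N \<rho>. sub (pinv \<sigma>) (lookup G e) * evm v e)"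
      using G unfolding gavg_def quotient_def by (intro sum.cong refl) (simp add: avp_sub sum_distrib_right)
    also have "\<dots> = (\<Sum>\<sigma>\<in>stab N \<rho>. \<Sum>e\<in>keys G. sub (pinv \<sigma>) (lookup G e) * evm v e)"
      by (rule sum.swap)
    finally show ?thesis by (simp add: ins_def)
  qed
  then have "vand m v * gavg G v = (\<Sum>\<sigma>\<in>stab N \<rho>. vand m v * ins (sub (pinv \<sigma>)) v G)"
    by (simp add: sum_distrib_left)
  also have "\<dots> = (\<Sum>\<sigma>\<in>stab N \<rho>. mon (act \<sigma> \<alpha>) * ?T)"
  proof (intro sum.cong refl)
    fix \<sigma> assume \<sigma>: "\<sigma> \<in> stab N \<rho>"
    have "vand m v * ins (sub (pinv \<sigma>)) v G = alternant \<alpha> \<beta> (sub (pinv \<sigma>)) v"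
      using quotient_eval[OF G comm_ring_hom_sub] by simp
    also have "\<dots> = mon (act \<sigma> \<alpha>) * ?T"
    proof -
      have "sub (pinv \<sigma>) (pvar b) = (pvar (pinv \<sigma> b) :: (nat \<Rightarrow>\<^sub>0 nat) \<Rightarrow>\<^sub>0 'a)" for b
      proof -
        interpret comm_ring_hom "\<lambda>c::'a. Poly_Mapping.single (0::nat \<Rightarrow>\<^sub>0 nat) c" by (rule comm_ring_hom_const)
        show ?thesis by (subst (1) pvar_def) simp
      qed
      then have "theta (\<lambda>b. sub (pinv \<sigma>) (pvar b)) u = theta (pvar :: nat \<Rightarrow> (nat \<Rightarrow>\<^sub>0 nat) \<Rightarrow>\<^sub>0 'a) u" for u
        using theta_stab[OF stab_inv[OF \<sigma>], of pvar u] by simp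
      then show ?thesis
        by (simp add: alternant_def hval_def sum_distrib_left sub_mon[OF stabD(1)[OF \<sigma>] \<alpha>] algebra_simps)
    qed
    finally show "vand m v * ins (sub (pinv \<sigma>)) v G = mon (act \<sigma> \<alpha>) * ?T" .
  qed
  also have "\<dots> = av N \<rho> \<alpha> * ?T"
    by (simp add: av_def sum_distrib_right)
  finally show ?thesis .
qed

lemma gavg_vanish:
  fixes G :: "(nat \<Rightarrow>\<^sub>0 nat) \<Rightarrow>\<^sub>0 (nat \<Rightarrow>\<^sub>0 nat) \<Rightarrow>\<^sub>0 'a::idom"
  assumes G: "quotient \<alpha> \<beta> G" and \<alpha>: "keys \<alpha> \<subseteq> {..<N}"
    and a': "inj_on a' {..<m}" "\<And>k. k < m \<Longrightarrow> a' k < N \<and> \<rho> (a' k) \<in> E"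
    and no: "\<And>w. w permutes {..<m} \<Longrightarrow> \<exists>k<m. bin (\<rho> (a' (w k))) < rk k"
  shows "gavg G (\<lambda>k. pvar (a' k)) = 0"
proof -
  have "theta pvar (\<lambda>k. pvar (a' (w k))) = (0 :: (nat \<Rightarrow>\<^sub>0 nat) \<Rightarrow>\<^sub>0 'a)" if "w permutes {..<m}" for w
  proof -
    obtain k where k: "k < m" "bin (\<rho> (a' (w k))) < rk k" using no \<open>w permutes _\<close> by blast
    have "w k < m" using permutes_in_image[OF that, of k] k by simp
    then have "a' (w k) \<in> low k" using a' k by (simp add: low_def)
    then have "(\<Prod>b\<in>low k. (pvar (a' (w k)) - pvar b :: (nat \<Rightarrow>\<^sub>0 nat) \<Rightarrow>\<^sub>0 'a)) = 0"
      by (intro prod_zero bexI[of _ "a' (w k)"]) auto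
    then show ?thesis
      unfolding theta_def using k by (intro prod_zero[OF finite_lessThan]) blast
  qed
  then have "vand m (\<lambda>k. pvar (a' k)) * gavg G (\<lambda>k. pvar (a' k)) = 0"
    by (subst gavg_eq[OF G \<alpha>]) simp
  moreover have "vand m (\<lambda>k. pvar (a' k) :: (nat \<Rightarrow>\<^sub>0 nat) \<Rightarrow>\<^sub>0 'a) \<noteq> 0"
    using a'(1) by (intro vand_nonzero) (auto simp: inj_on_def pvar_inj)
  ultimately show ?thesis by simp
qed

text \<open>At the positions \<open>a\<close> only rank-preserving \<open>w\<close> survive. For
  them the signs of \<open>w\<close> and \<open>vsame\<close> cancel and \<open>theta\<close> splits
  into \<open>vdiff\<close> and \<open>offset\<close>, so the Vandermonde product is a common factor
  and can be cancelled.\<close>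

lemma gavg_target:
  fixes G :: "(nat \<Rightarrow>\<^sub>0 nat) \<Rightarrow>\<^sub>0 (nat \<Rightarrow>\<^sub>0 nat) \<Rightarrow>\<^sub>0 'a::idom"
  assumes G: "quotient \<alpha> \<beta> G" and \<alpha>: "keys \<alpha> \<subseteq> {..<N}"
  shows "gavg G (\<lambda>k. pvar (a k))
    = av N \<rho> \<alpha> * offset * (\<Sum>w\<in>rkperms. \<Prod>k<m. pvar (a (w k)) ^ lookup \<beta> k)"
proof -
  let ?v = "\<lambda>k. pvar (a k) :: (nat \<Rightarrow>\<^sub>0 nat) \<Rightarrow>\<^sub>0 'a"
  have inj: "inj_on ?v {..<m}" using a_inj by (auto simp: inj_on_def pvar_inj)
  let ?t = "\<lambda>w. signof w * ((\<Prod>k<m. ?v (w k) ^ lookup \<beta> k) * vsame (\<lambda>k. ?v (w k)) * theta pvar (\<lambda>k. ?v (w k)))"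
  have zero: "?t w = 0" if w: "w permutes {..<m}" "w \<notin> rkperms" for w
  proof -
    have wl: "w k < m" if "k < m" for k using permutes_in_image[OF w(1), of k] that by simp
    \<comment> \<open>A permutation that lowers no rank preserves every rank, because the sum of the
      ranks is unchanged.\<close>
    have "\<exists>k<m. rk (w k) < rk k"
    proof (rule ccontr)
      assume "\<not> ?thesis"
      then have ge: "\<And>k. k \<in> {..<m} \<Longrightarrow> rk k \<le> rk (w k)" by force
      have "(\<Sum>k<m. rk (w k)) = (\<Sum>k<m. rk k)"
        using sum.permute[OF w(1), of rk] by (simp add: comp_def)
      then have "rk k = rk (w k)" if "k \<in> {..<m}" for k
        using sum_mono_inv[of rk "{..<m}" "\<lambda>k. rk (w k)" k] ge that by simp
      then have "w \<in> rkperms" using w(1) by (simp add: rkperms_def)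
      then show False using w(2) by simp
    qed
    then obtain k where k: "k < m" "rk (w k) < rk k" by blast
    then have "a (w k) \<in> low k" using a_lt a_E wl by (simp add: low_def)
    then have "(\<Prod>b\<in>low k. (?v (w k) - pvar b)) = 0"
      by (intro prod_zero bexI[of _ "a (w k)"]) auto
    then have "theta pvar (\<lambda>k. ?v (w k)) = 0"
      unfolding theta_def using k by (intro prod_zero[OF finite_lessThan]) blast
    then show ?thesis by simp
  qed
  have fin: "finite {w. w permutes {..<m}}" by (simp add: finite_permutations)
  have "vand m ?v * gavg G ?v = av N \<rho> \<alpha> * (\<Sum>w | w permutes {..<m}. ?t w)"
    by (rule gavg_eq[OF G \<alpha>])
  also have "(\<Sum>w | w permutes {..<m}. ?t w) = (\<Sum>w\<in>rkperms. ?t w)"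
    using zero fin by (intro sum.mono_neutral_right) (auto simp: rkperms_def)
  also have "\<dots> = (\<Sum>w\<in>rkperms. vsame ?v * vdiff ?v * offset * (\<Prod>k<m. ?v (w k) ^ lookup \<beta> k))"
  proof (intro sum.cong refl)
    fix w assume w: "w \<in> rkperms"
    have "vsame (\<lambda>k. ?v (w k)) = signof w * vsame ?v" by (rule vsame_perm[OF w inj])
    moreover have "theta pvar (\<lambda>k. ?v (w k)) = vdiff ?v * offset"
      using theta_perm[OF w, of pvar ?v] theta_split by simp
    ultimately show "?t w = vsame ?v * vdiff ?v * offset * (\<Prod>k<m. ?v (w k) ^ lookup \<beta> k)"
      using signof_square[of w "1 :: (nat \<Rightarrow>\<^sub>0 nat) \<Rightarrow>\<^sub>0 'a"] by (simp add: mult.assoc mult.left_commute)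
  qed
  also have "\<dots> = vand m ?v * (offset * (\<Sum>w\<in>rkperms. \<Prod>k<m. ?v (w k) ^ lookup \<beta> k))"
    by (simp add: vand_split sum_distrib_left mult.assoc)
  finally have "vand m ?v * gavg G ?v
      = vand m ?v * (av N \<rho> \<alpha> * offset * (\<Sum>w\<in>rkperms. \<Prod>k<m. ?v (w k) ^ lookup \<beta> k))"
    by (simp add: algebra_simps)
  moreover have "vand m ?v \<noteq> 0" by (rule vand_nonzero[OF inj])
  ultimately show ?thesis by simp
qed

end

section \<open>Adjoining one matrix entry\<close>

lemma lookup_mult_mon_le:
  fixes q :: "('v \<Rightarrow>\<^sub>0 nat) \<Rightarrow>\<^sub>0 'c::comm_ring_1"
  shows "lookup (q * mon u) l = (if \<forall>x. lookup u x \<le> lookup l x then lookup q (l - u) else 0)"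
proof (cases "\<forall>x. lookup u x \<le> lookup l x")
  case True
  then have "l = (l - u) + u"
    by (intro poly_mapping_eqI) (simp add: lookup_add lookup_minus)
  with True show ?thesis using lookup_mult_mon_add[of q u "l - u"] by simp
next
  case False
  then have "j + u \<noteq> l" for j by (metis lookup_add le_add2)
  then have "lookup (q * mon u) l = 0" by (simp add: lookup_mult_mon)
  then show ?thesis unfolding if_not_P[OF False] .
qed

lemma prod_square_split:
  "(\<Prod>a<N. \<Prod>b<N. f a b) = (\<Prod>a<N. f a a * (\<Prod>b<a. f a b * f b a :: 'r::comm_monoid_mult))"
  for N :: nat
proof (induction N)
  case (Suc N)
  have "(\<Prod>a<Suc N. \<Prod>b<Suc N. f a b) = (\<Prod>a<N. \<Prod>b<N. f a b) * (f N N * (\<Prod>b<N. f N b * f b N))"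
    by (simp add: prod.distrib mult.assoc mult.left_commute mult.commute)
  then show ?case using Suc by simp
qed simp

section \<open>Separating the coefficients of the new entry from the other variables\<close>

definition yrow :: "nat \<Rightarrow> nat \<Rightarrow> (nat \<times> nat \<times> nat) set" where
  "yrow n p = {v. fst v = n \<and> fst (snd v) = p}"

definition ypart :: "nat \<Rightarrow> nat \<Rightarrow> (nat \<times> nat \<times> nat \<Rightarrow>\<^sub>0 nat) \<Rightarrow> (nat \<times> nat \<times> nat \<Rightarrow>\<^sub>0 nat)" where
  "ypart n p \<mu> = (\<Sum>x\<in>keys \<mu> \<inter> yrow n p. Poly_Mapping.single x (lookup \<mu> x))"

lemma lookup_ypart: "lookup (ypart n p \<mu>) x = (if x \<in> yrow n p then lookup \<mu> x else 0)"
proof -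
  have "lookup (ypart n p \<mu>) x = (\<Sum>x'\<in>keys \<mu> \<inter> yrow n p. if x' = x then lookup \<mu> x' else 0)"
    by (simp add: ypart_def lookup_sum lookup_single when_def)
  then show ?thesis by (auto simp: in_keys_iff)
qed

lemma ypart_add:
  assumes "keys u \<subseteq> yrow n p" "keys r \<subseteq> - yrow n p"
  shows "ypart n p (u + r) = u" "u + r - ypart n p (u + r) = r"
proof -
  show *: "ypart n p (u + r) = u"
    using assms by (intro poly_mapping_eqI) (auto simp: lookup_ypart lookup_add in_keys_iff)
  show "u + r - ypart n p (u + r) = r" unfolding * by simp
qed

text \<open>The monomial contributed by the new entry when the extended positions take the exponents
  \<open>e\<close>; it depends on \<open>e\<close> only up to permutation.\<close>

definition ysum :: "nat \<Rightarrow> nat \<Rightarrow> nat \<Rightarrow> (nat \<Rightarrow>\<^sub>0 nat) \<Rightarrow> (nat \<times> nat \<times> nat \<Rightarrow>\<^sub>0 nat)" where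
  "ysum n p m e = (\<Sum>k<m. Poly_Mapping.single (n, p, lookup e k) 1)"

lemma keys_ysum: "keys (ysum n p m e) \<subseteq> yrow n p"
  unfolding ysum_def yrow_def by (rule order_trans[OF Poly_Mapping.keys_sum]) auto

text \<open>A functional may be chosen separately for each monomial in the new variables; on that
  monomial times an old polynomial it acts as the functional chosen.\<close>

lemma pair_ysum:
  assumes "\<And>\<mu>. L' \<mu> = Ls (ypart n p \<mu>) (\<mu> - ypart n p \<mu>)" "vars_in (- yrow n p) q"
  shows "pair L' (mon (ysum n p m e) * q) = pair (Ls (ysum n p m e)) q"
  unfolding pair_mon_mult
proof (rule pair_cong)
  fix r assume "r \<in> keys q"
  then have "keys r \<subseteq> - yrow n p" using assms(2) by (auto simp: vars_in_def)
  then show "L' (ysum n p m e + r) = Ls (ysum n p m e) r"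
    by (simp add: assms(1) ypart_add[OF keys_ysum])
qed

text \<open>The index set of a multiple Cauchy product: how much of each exponent goes to the new
  entry.\<close>

definition boxes :: "nat \<Rightarrow> (nat \<Rightarrow> nat) \<Rightarrow> (nat \<Rightarrow>\<^sub>0 nat) set" where
  "boxes m c = {e. keys e \<subseteq> {..<m} \<and> (\<forall>k<m. lookup e k \<le> c k)}"

lemma boxes_bij:
  "bij_betw (\<lambda>f. \<Sum>k<m. Poly_Mapping.single k (f k)) (PiE {..<m} (\<lambda>k. {0..c k})) (boxes m c)"
proof (rule bij_betw_byWitness[where f' = "\<lambda>e. restrict (lookup e) {..<m}"])
  have l: "lookup (\<Sum>k<m. Poly_Mapping.single k (f k)) x = (if x < m then f x else 0)" for f :: "nat \<Rightarrow> nat" and x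
    by (simp add: lookup_sum lookup_single when_def)
  show "\<forall>f\<in>PiE {..<m} (\<lambda>k. {0..c k}). restrict (lookup (\<Sum>k<m. Poly_Mapping.single k (f k))) {..<m} = f"
    by (auto simp: l fun_eq_iff PiE_def extensional_def)
  show "\<forall>e\<in>boxes m c. (\<Sum>k<m. Poly_Mapping.single k (restrict (lookup e) {..<m} k)) = e"
    by (auto intro!: poly_mapping_eqI simp: l boxes_def in_keys_iff)
  show "(\<lambda>f. \<Sum>k<m. Poly_Mapping.single k (f k)) ` PiE {..<m} (\<lambda>k. {0..c k}) \<subseteq> boxes m c"
    by (auto simp: boxes_def l PiE_def Pi_def in_keys_iff split: if_splits)
  show "(\<lambda>e. restrict (lookup e) {..<m}) ` boxes m c \<subseteq> PiE {..<m} (\<lambda>k. {0..c k})"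
    by (intro image_subsetI) (simp add: boxes_def PiE_iff)
qed

lemma finite_boxes: "finite (boxes m c)"
proof -
  have "finite (PiE {..<m} (\<lambda>k. {0..c k}))" by (rule finite_PiE) auto
  then show ?thesis using bij_betw_finite[OF boxes_bij] by blast
qed

definition shift :: "nat \<Rightarrow> (nat \<Rightarrow> nat) \<Rightarrow> (nat \<Rightarrow>\<^sub>0 nat) \<Rightarrow> (nat \<Rightarrow>\<^sub>0 nat)" where
  "shift m a e = (\<Sum>k<m. Poly_Mapping.single (a k) (lookup e k))"

lemma lookup_shift:
  assumes "inj_on a {..<m}"
  shows "k < m \<Longrightarrow> lookup (shift m a e) (a k) = lookup e k"
    and "x \<notin> a ` {..<m} \<Longrightarrow> lookup (shift m a e) x = 0"
proof -
  have *: "lookup (shift m a e) x = (\<Sum>k<m. if a k = x then lookup e k else 0)" for x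
    by (simp add: shift_def lookup_sum lookup_single when_def)
  show "x \<notin> a ` {..<m} \<Longrightarrow> lookup (shift m a e) x = 0"
    unfolding * by (intro sum.neutral) auto
  assume k: "k < m"
  have "(\<Sum>k'<m. if a k' = a k then lookup e k' else 0) = (\<Sum>k'<m. if k' = k then lookup e k' else 0)"
    using assms k by (intro sum.cong refl) (auto simp: inj_on_def)
  then show "lookup (shift m a e) (a k) = lookup e k"
    unfolding * using k by simp
qed

lemma evm_shift:
  assumes "keys e \<subseteq> {..<m}"
  shows "evm (\<lambda>k. pvar (a k)) e = mon (shift m a e)"
  unfolding shift_def mon_sum evm_superset[OF finite_lessThan assms]
  by (intro prod.cong refl) (simp add: pvar_power)

text \<open>
  The entry \<open>(n, p)\<close> is adjoined: \<open>E\<close> consists of the row sets of size \<open>p - 1\<close> below \<open>n\<close>, and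
  \<open>insert n ` E\<close> are the row sets whose product of entries involves \<open>(n, p)\<close>.
\<close>

locale step =
  fixes X :: "nat set \<Rightarrow> 'a::field_char_0 arc_poly fps" and S E :: "nat set set" and n p :: nat
    and gr :: "nat set multiset \<Rightarrow> nat set multiset \<Rightarrow> bool"
  assumes repr: "representable X S gr"
    and gr_irrefl: "\<not> gr T T" and gr_trans: "gr T T' \<Longrightarrow> gr T' T'' \<Longrightarrow> gr T T''"
    and E_sub: "E \<subseteq> S"
    and E_notin: "C \<in> E \<Longrightarrow> n \<notin> C"
    and E_new: "C \<in> E \<Longrightarrow> insert n C \<notin> S"
    and bin_inj_E: "C \<in> E \<Longrightarrow> D \<in> E \<Longrightarrow> bin C = bin D \<Longrightarrow> C = D"
    and X_new: "C \<in> E \<Longrightarrow> X (insert n C) = X C * arc_entry n p"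
    and X_old: "I \<in> S \<Longrightarrow> vars_in (- yrow n p) (fps_nth (X I) k)"
    and k_both: "C \<in> E \<Longrightarrow> D \<in> E \<Longrightarrow> k_num (insert n C) (insert n D) = k_num C D"
    and k_one: "C \<in> E \<Longrightarrow> D \<in> E \<Longrightarrow> k_num (insert n C) D = k_num C D + (if bin D < bin C then 1 else 0)"
    and k_other: "C \<in> E \<Longrightarrow> D \<in> S \<Longrightarrow> D \<notin> E \<Longrightarrow> k_num (insert n C) D = k_num C D"
    and k_sym: "I \<in> S \<union> insert n ` E \<Longrightarrow> J \<in> S \<union> insert n ` E \<Longrightarrow> k_num I J = k_num J I"
begin

abbreviation new :: "nat set set" where "new \<equiv> insert n ` E"
abbreviation S' :: "nat set set" where "S' \<equiv> S \<union> new"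

definition base :: "nat set \<Rightarrow> nat set" where
  "base I = (if I \<in> new then I - {n} else I)"

lemma base_new: "C \<in> E \<Longrightarrow> base (insert n C) = C"
  using E_notin by (auto simp: base_def)

lemma base_old: "I \<in> S \<Longrightarrow> base I = I"
  using E_new by (auto simp: base_def)

lemma base_new': "I \<in> new \<Longrightarrow> base I \<in> E \<and> I = insert n (base I)"
proof -
  assume "I \<in> new"
  then obtain C where "C \<in> E" "I = insert n C" by blast
  then show ?thesis using base_new[of C] by simp
qed

lemma base_in: "I \<in> S' \<Longrightarrow> base I \<in> S"
proof (cases "I \<in> new")
  case True
  then show ?thesis using base_new'[OF True] E_sub by blast
next
  case False
  moreover assume "I \<in> S'"
  ultimately show ?thesis using base_old[of I] by simp
qed

definition twt :: "nat set multiset \<Rightarrow> nat" where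
  "twt T = (\<Sum>I\<in>#T. if I \<in> new then bin (base I) else 0)"

text \<open>Lexicographic: the old order on the bases, then the total rank of the extended sets.
  What \<open>theta\<close> detects is domination of the ranks position by position, and this
  implies the inequality between the sums used here.\<close>

definition gr' :: "nat set multiset \<Rightarrow> nat set multiset \<Rightarrow> bool" where
  "gr' T' T \<longleftrightarrow> gr (image_mset base T') (image_mset base T) \<or>
     image_mset base T' = image_mset base T \<and> twt T < twt T'"

lemma gr'_irrefl: "\<not> gr' T T"
  using gr_irrefl by (auto simp: gr'_def)

lemma gr'_trans: "gr' T T' \<Longrightarrow> gr' T' T'' \<Longrightarrow> gr' T T''"
proof -
  assume "gr' T T'" "gr' T' T''"
  then show "gr' T T''"
    unfolding gr'_def
  proof (elim disjE conjE)
    assume "gr (image_mset base T) (image_mset base T')" "gr (image_mset base T') (image_mset base T'')"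
    then show "gr (image_mset base T) (image_mset base T'') \<or> image_mset base T = image_mset base T'' \<and> twt T'' < twt T"
      using gr_trans by blast
  qed simp_all
qed

lemma X_split: "I \<in> new \<Longrightarrow> fps_nth (X I) l = (\<Sum>j\<in>{0..l}. mon (Poly_Mapping.single (n, p, j) 1) * fps_nth (X (base I)) (l - j))"
proof -
  assume "I \<in> new"
  then have "X I = arc_entry n p * X (base I)"
    using X_new[of "base I"] base_new'[of I] by (simp add: mult.commute)
  then show ?thesis by (simp add: fps_mult_nth arc_entry_def arc_var_def mon_def)
qed

text \<open>Multiplies out \<open>X (insert n C) = X C * arc_entry n p\<close> at all extended
  positions at once.\<close>

lemma vals_expand:
  assumes \<tau>: "\<And>b. b < N \<Longrightarrow> \<tau> b \<in> S'"
    and a: "bij_betw a {..<m} {b. b < N \<and> \<tau> b \<in> new}"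
  shows "vals X N \<tau> l = (\<Sum>e\<in>boxes m (\<lambda>k. lookup l (a k)).
    mon (ysum n p m e) * vals X N (\<lambda>b. base (\<tau> b)) (l - shift m a e))"
proof -
  let ?A = "{b. b < N \<and> \<tau> b \<in> new}"
  have inj: "inj_on a {..<m}" and im: "a ` {..<m} = ?A" using a by (auto simp: bij_betw_def)
  have split: "(\<Prod>b<N. F b) = (\<Prod>k<m. F (a k)) * (\<Prod>b\<in>{..<N} - ?A. F b)" for F :: "nat \<Rightarrow> 'a arc_poly"
  proof -
    have "(\<Prod>b<N. F b) = (\<Prod>b\<in>?A. F b) * (\<Prod>b\<in>{..<N} - ?A. F b)"
      by (subst prod.subset_diff[of ?A "{..<N}"]) (auto simp: mult.commute)
    also have "(\<Prod>b\<in>?A. F b) = (\<Prod>k<m. F (a k))"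
      using prod.reindex_bij_betw[OF a] by metis
    finally show ?thesis .
  qed
  let ?Y = "\<lambda>k j. mon (Poly_Mapping.single (n, p, j) 1) * fps_nth (X (base (\<tau> (a k)))) (lookup l (a k) - j)"
  let ?R = "\<Prod>b\<in>{..<N} - ?A. fps_nth (X (\<tau> b)) (lookup l b)"
  have "vals X N \<tau> l = (\<Prod>k<m. fps_nth (X (\<tau> (a k))) (lookup l (a k))) * ?R"
    unfolding vals_def by (rule split)
  also have "(\<Prod>k<m. fps_nth (X (\<tau> (a k))) (lookup l (a k))) = (\<Prod>k<m. \<Sum>j\<in>{0..lookup l (a k)}. ?Y k j)"
    using im by (intro prod.cong refl X_split) auto
  also have "\<dots> = (\<Sum>f\<in>PiE {..<m} (\<lambda>k. {0..lookup l (a k)}). \<Prod>k<m. ?Y k (f k))"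
    by (rule prod_sum_PiE) auto
  also have "\<dots> = (\<Sum>f\<in>PiE {..<m} (\<lambda>k. {0..lookup l (a k)}).
      \<Prod>k<m. ?Y k (lookup (\<Sum>k<m. Poly_Mapping.single k (f k)) k))"
    by (intro sum.cong prod.cong refl) (simp add: lookup_sum lookup_single when_def)
  also have "\<dots> = (\<Sum>e\<in>boxes m (\<lambda>k. lookup l (a k)). \<Prod>k<m. ?Y k (lookup e k))"
    by (rule sum.reindex_bij_betw[OF boxes_bij])
  finally have "vals X N \<tau> l = (\<Sum>e\<in>boxes m (\<lambda>k. lookup l (a k)). (\<Prod>k<m. ?Y k (lookup e k)) * ?R)"
    by (simp add: sum_distrib_right)
  also have "\<dots> = (\<Sum>e\<in>boxes m (\<lambda>k. lookup l (a k)).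
    mon (ysum n p m e) * vals X N (\<lambda>b. base (\<tau> b)) (l - shift m a e))"
  proof (intro sum.cong refl)
    fix e
    have "vals X N (\<lambda>b. base (\<tau> b)) (l - shift m a e)
        = (\<Prod>k<m. fps_nth (X (base (\<tau> (a k)))) (lookup l (a k) - lookup e k)) *
          (\<Prod>b\<in>{..<N} - ?A. fps_nth (X (base (\<tau> b))) (lookup (l - shift m a e) b))"
      unfolding vals_def by (subst split) (simp add: lookup_minus lookup_shift(1)[OF inj])
    also have "(\<Prod>b\<in>{..<N} - ?A. fps_nth (X (base (\<tau> b))) (lookup (l - shift m a e) b)) = ?R"
    proof (intro prod.cong refl)
      fix b assume b: "b \<in> {..<N} - ?A"
      then have "b \<notin> a ` {..<m}" "base (\<tau> b) = \<tau> b" unfolding im using \<tau> base_old by auto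
      then show "fps_nth (X (base (\<tau> b))) (lookup (l - shift m a e) b) = fps_nth (X (\<tau> b)) (lookup l b)"
        by (simp add: lookup_minus lookup_shift(2)[OF inj])
    qed
    finally show "(\<Prod>k<m. ?Y k (lookup e k)) * ?R
        = mon (ysum n p m e) * vals X N (\<lambda>b. base (\<tau> b)) (l - shift m a e)"
      by (simp add: prod.distrib ysum_def mon_sum mult.assoc)
  qed
  finally show ?thesis .
qed

lemma vars_in_vals:
  assumes "\<And>b. b < N \<Longrightarrow> \<tau> b \<in> S"
  shows "vars_in (- yrow n p) (vals X N \<tau> l)"
  unfolding vals_def using assms by (intro vars_in_prod X_old) auto

lemma represents_avp:
  assumes "\<And>b. b < N \<Longrightarrow> \<rho> b \<in> S" "vars_in {..<N} g"
  shows "\<exists>L. represents X S gr N \<rho> (avp N \<rho> g) L"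
proof -
  have "\<exists>L. represents X S gr N \<rho> (av N \<rho> e) L" if "e \<in> keys g" for e
    using repr assms that unfolding representable_def vars_in_def by blast
  then obtain L where "\<And>e. e \<in> keys g \<Longrightarrow> represents X S gr N \<rho> (av N \<rho> e) (L e)" by metis
  from represents_linear[OF this, of "keys g" "\<lambda>e. e" "lookup g"] show ?thesis
    unfolding avp_def by blast
qed

end

lemma represents_zero:
  assumes "represents X S gr N \<tau> H L" "\<And>a. a < N' \<Longrightarrow> \<tau>' a \<in> S" "keys l \<subseteq> {..<N'}"
    and "tms N' \<tau>' \<noteq> tms N \<tau>" "\<not> gr (tms N' \<tau>') (tms N \<tau>)"
  shows "pair L (vals X N' \<tau>' l) = 0"
  using assms unfolding represents_def by simp

locale step_target = step +
  fixes N :: nat and \<tau> :: "nat \<Rightarrow> nat set" and A :: "nat set" and m :: nat and a :: "nat \<Rightarrow> nat"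
  assumes \<tau>_in: "b < N \<Longrightarrow> \<tau> b \<in> S \<union> insert n ` E"
    and A_def: "A = {b. b < N \<and> \<tau> b \<in> insert n ` E}"
    and a_bij: "bij_betw a {..<m} A"
    and a_sorted: "i \<le> j \<Longrightarrow> j < m \<Longrightarrow> bin (base (\<tau> (a i))) \<le> bin (base (\<tau> (a j)))"
begin

definition rho :: "nat \<Rightarrow> nat set" where
  "rho b = base (\<tau> b)"

lemma rho_in: "b < N \<Longrightarrow> rho b \<in> S"
  unfolding rho_def using base_in[OF \<tau>_in] .

lemma rho_A: "b \<in> A \<Longrightarrow> rho b \<in> E" "b \<in> A \<Longrightarrow> \<tau> b = insert n (rho b)"
  using base_new'[of "\<tau> b"] by (auto simp: rho_def A_def)

lemma rho_notA: "b < N \<Longrightarrow> b \<notin> A \<Longrightarrow> \<tau> b = rho b"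
  using base_old[of "\<tau> b"] \<tau>_in[of b] by (auto simp: rho_def A_def)

lemma A_lt: "b \<in> A \<Longrightarrow> b < N"
  by (simp add: A_def)

lemma finite_A: "finite A"
  by (simp add: A_def)

lemma a_A: "k < m \<Longrightarrow> a k \<in> A"
  using a_bij by (auto simp: bij_betw_def)

lemma a_image: "a ` {..<m} = A"
  using a_bij by (auto simp: bij_betw_def)

sublocale sy: symmetrization N m rho E a
proof
  show "inj_on a {..<m}" using a_bij by (simp add: bij_betw_def)
  show "a k < N" if "k < m" for k using A_lt[OF a_A[OF that]] .
  show "rho (a k) \<in> E" if "k < m" for k using rho_A(1)[OF a_A[OF that]] .
  show "bin (rho (a i)) \<le> bin (rho (a j))" if "i \<le> j" "j < m" for i j
    using a_sorted[OF that] by (simp add: rho_def)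
qed

text \<open>Written additively to avoid subtraction of multisets: for given bases, the multiset of
  the bases of the extended sets determines the type. Its total rank is the tie-break of
  \<open>gr'\<close>.\<close>

lemma tms_decompose:
  assumes "\<And>b. b < N \<Longrightarrow> \<tau>' b \<in> S'" "\<And>b. b < N \<Longrightarrow> base (\<tau>' b) = rho b"
    and a': "bij_betw a' {..<m} {b. b < N \<and> \<tau>' b \<in> new}"
  shows "tms N \<tau>' + tms m (\<lambda>k. rho (a' k)) = tms N rho + tms m (\<lambda>k. insert n (rho (a' k)))"
    and "twt (tms N \<tau>') = (\<Sum>k<m. bin (rho (a' k)))"
proof -
  let ?A = "{b. b < N \<and> \<tau>' b \<in> new}"
  have old: "\<tau>' b = rho b" if "b < N" "\<tau>' b \<notin> new" for b
    using base_old[of "\<tau>' b"] assms(1,2)[OF that(1)] that(2) by auto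
  have new: "\<tau>' b = insert n (rho b)" if "b < N" "\<tau>' b \<in> new" for b
    using base_new'[OF that(2)] assms(2)[OF that(1)] by simp
  have split: "mset_set {..<N} = mset_set ({..<N} - ?A) + mset_set ?A"
    by (subst mset_set_Union[symmetric]) (auto intro!: arg_cong[where f = mset_set])
  have re: "image_mset f (mset_set ?A) = tms m (\<lambda>k. f (a' k))" for f :: "nat \<Rightarrow> nat set"
  proof -
    have "mset_set ?A = image_mset a' (mset_set {..<m})"
      using a' by (simp add: bij_betw_def image_mset_mset_set)
    then show ?thesis by (simp add: tms_def image_mset.compositionality comp_def)
  qed
  have "tms N \<tau>' = image_mset \<tau>' (mset_set ({..<N} - ?A)) + image_mset \<tau>' (mset_set ?A)"
    by (simp add: tms_def split)
  also have "image_mset \<tau>' (mset_set ({..<N} - ?A)) = image_mset rho (mset_set ({..<N} - ?A))"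
    using old by (intro image_mset_cong) auto
  also have "image_mset \<tau>' (mset_set ?A) = image_mset (\<lambda>b. insert n (rho b)) (mset_set ?A)"
    using new by (intro image_mset_cong) auto
  finally have "tms N \<tau>' = image_mset rho (mset_set ({..<N} - ?A)) + tms m (\<lambda>k. insert n (rho (a' k)))"
    by (simp add: re)
  moreover have "tms N rho = image_mset rho (mset_set ({..<N} - ?A)) + tms m (\<lambda>k. rho (a' k))"
    by (simp add: tms_def[of N] split re)
  ultimately show "tms N \<tau>' + tms m (\<lambda>k. rho (a' k)) = tms N rho + tms m (\<lambda>k. insert n (rho (a' k)))"
    by simp
  have "twt (tms N \<tau>') = (\<Sum>b<N. if \<tau>' b \<in> new then bin (base (\<tau>' b)) else 0)"
    by (simp add: twt_def tms_def image_mset.compositionality comp_def sum_unfold_sum_mset)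
  also have "\<dots> = (\<Sum>b\<in>?A. bin (rho b))"
    using assms(2) by (subst sum.inter_filter[symmetric]) (auto intro!: sum.cong)
  also have "\<dots> = (\<Sum>k<m. bin (rho (a' k)))"
    using sum.reindex_bij_betw[OF a', of "\<lambda>b. bin (rho b)"] by simp
  finally show "twt (tms N \<tau>') = (\<Sum>k<m. bin (rho (a' k)))" .
qed

lemma ysum_eqD:
  assumes "ysum n p m' e' = ysum n p m e" "keys e' \<subseteq> {..<m'}" "keys e \<subseteq> {..<m}"
  obtains w where "m' = m" "w permutes {..<m}" "e' = act w e"
proof -
  have "tms m' (\<lambda>k. (n, p, lookup e' k)) = tms m (\<lambda>k. (n, p, lookup e k))"
    using assms(1) unfolding ysum_def sum_single_eq_iff .
  from arg_cong[OF this, of "image_mset (\<lambda>(x, y, z). ((), z))"]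
  have *: "tms m' (\<lambda>k. ((), lookup e' k)) = tms m (\<lambda>k. ((), lookup e k))" by (simp add: tms_image)
  then have m: "m' = m" by (metis size_tms)
  obtain w where "w \<in> stab m (\<lambda>_. ())" "e' = act w e"
    using stab_ex[OF *[unfolded m]] assms(2,3) unfolding m by metis
  then show ?thesis using that m stabD(1) by blast
qed

text \<open>The part of a monomial in the new entry selects a coefficient of \<open>G\<close>, and
  the rest is fed to the old functional for that coefficient, symmetrized. At any family with the
  same bases the generating function is then \<open>kprod N rho\<close> times \<open>gavg G\<close>
  at the extended positions of that family. So \<open>H\<close> gives the value at the target, and
  \<open>gavg_vanish\<close> the zeros.\<close>

lemma functional_ex:
  fixes G :: "(nat \<Rightarrow>\<^sub>0 nat) \<Rightarrow>\<^sub>0 (nat \<Rightarrow>\<^sub>0 nat) \<Rightarrow>\<^sub>0 'a"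
  assumes G: "sy.quotient \<alpha> \<beta> G" and \<alpha>: "keys \<alpha> \<subseteq> {..<N}"
    and H: "kprod N \<tau> * H = kprod N rho * sy.gavg G (\<lambda>k. pvar (a k))"
  shows "\<exists>L. represents X S' gr' N \<tau> H L"
proof -
  have Gvars: "vars_in {..<m} G" "vars_in {..<N} (lookup G e)" for e
    using G by (auto simp: sy.quotient_def)
  define Lc where "Lc g = (SOME L. represents X S gr N rho (avp N rho g) L)" for g :: "(nat \<Rightarrow>\<^sub>0 nat) \<Rightarrow>\<^sub>0 'a"
  have Lc: "represents X S gr N rho (avp N rho (lookup G e)) (Lc (lookup G e))" for e
    unfolding Lc_def by (rule someI_ex[OF represents_avp[OF rho_in Gvars(2)]])
  define Ls where "Ls u = (if \<exists>e. keys e \<subseteq> {..<m} \<and> ysum n p m e = u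
      then Lc (lookup G (SOME e. keys e \<subseteq> {..<m} \<and> ysum n p m e = u)) else (\<lambda>_. 0))" for u
  \<comment> \<open>Exponents with the same monomial differ by a permutation, and \<open>G\<close>
    is symmetric, so the choice made by \<open>SOME\<close> does not matter.\<close>
  have Ls_in: "Ls (ysum n p m e) = Lc (lookup G e)" if e: "keys e \<subseteq> {..<m}" for e
  proof -
    define e' where "e' = (SOME e'. keys e' \<subseteq> {..<m} \<and> ysum n p m e' = ysum n p m e)"
    have e': "keys e' \<subseteq> {..<m} \<and> ysum n p m e' = ysum n p m e"
      unfolding e'_def by (rule someI[of _ e]) (use e in auto)
    then obtain w where "w permutes {..<m}" "e' = act w e"
      using ysum_eqD[of m e' e] e by metis
    then have "lookup G e' = lookup G e" using sy.quotient_symmetric[OF G _ e] by simp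
    moreover have "Ls (ysum n p m e) = Lc (lookup G e')"
      unfolding Ls_def e'_def using e by auto
    ultimately show ?thesis by simp
  qed
  \<comment> \<open>The degree in the new entry reveals the number of extended positions.\<close>
  have Ls_out: "Ls (ysum n p m' e) = (\<lambda>_. 0)" if "m' \<noteq> m" "keys e \<subseteq> {..<m'}" for m' e
    unfolding Ls_def using that ysum_eqD[of m' e] by (metis (no_types, lifting))
  have Ls_cases: "Ls u = (\<lambda>_. 0) \<or> (\<exists>e. Ls u = Lc (lookup G e))" for u
    by (auto simp: Ls_def)
  define L where "L \<mu> = Ls (ypart n p \<mu>) (\<mu> - ypart n p \<mu>)" for \<mu>
  have expand: "pair L (vals X N' \<tau>' l) = (\<Sum>e\<in>boxes m' (\<lambda>k. lookup l (a' k)).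
      pair (Ls (ysum n p m' e)) (vals X N' (\<lambda>b. base (\<tau>' b)) (l - shift m' a' e)))"
    if \<tau>': "\<And>b. b < N' \<Longrightarrow> \<tau>' b \<in> S'" and a': "bij_betw a' {..<m'} {b. b < N' \<and> \<tau>' b \<in> new}" for N' \<tau>' l m' a'
  proof -
    have "vars_in (- yrow n p) (vals X N' (\<lambda>b. base (\<tau>' b)) l')" for l'
      using \<tau>' base_in by (intro vars_in_vals) auto
    then have *: "pair L (mon (ysum n p m' e) * vals X N' (\<lambda>b. base (\<tau>' b)) l')
        = pair (Ls (ysum n p m' e)) (vals X N' (\<lambda>b. base (\<tau>' b)) l')" for e l'
      by (intro pair_ysum) (simp_all add: L_def)
    have "vals X N' \<tau>' l = (\<Sum>e\<in>boxes m' (\<lambda>k. lookup l (a' k)).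
        mon (ysum n p m' e) * vals X N' (\<lambda>b. base (\<tau>' b)) (l - shift m' a' e))"
      by (rule vals_expand[OF \<tau>' a'])
    then show ?thesis by (simp add: pair_sum *)
  qed
  have val_eq: "pair L (vals X N \<tau>' l) = lookup (kprod N rho * sy.gavg G (\<lambda>k. pvar (a' k))) l"
    if \<tau>': "\<And>b. b < N \<Longrightarrow> \<tau>' b \<in> S'" "\<And>b. b < N \<Longrightarrow> base (\<tau>' b) = rho b"
      and a': "bij_betw a' {..<m} {b. b < N \<and> \<tau>' b \<in> new}" and l: "keys l \<subseteq> {..<N}" for \<tau>' l a'
  proof -
    have inj: "inj_on a' {..<m}" using a' by (simp add: bij_betw_def)
    let ?B = "boxes m (\<lambda>k. lookup l (a' k))"
    let ?T = "\<lambda>e. lookup (kprod N rho * avp N rho (lookup G e)) (l - shift m a' e)"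
    have vc: "vals X N (\<lambda>b. base (\<tau>' b)) l' = vals X N rho l'" for l'
      unfolding vals_def using \<tau>'(2) by (intro prod.cong refl) simp
    have sub: "keys (l - u) \<subseteq> {..<N}" for u :: "nat \<Rightarrow>\<^sub>0 nat"
      using l by (auto simp: in_keys_iff lookup_minus subset_eq)
    have "pair L (vals X N \<tau>' l)
        = (\<Sum>e\<in>?B. pair (Ls (ysum n p m e)) (vals X N (\<lambda>b. base (\<tau>' b)) (l - shift m a' e)))"
      by (rule expand[OF \<tau>'(1) a'])
    also have "\<dots> = (\<Sum>e\<in>?B. ?T e)"
      unfolding vc
    proof (rule sum.cong[OF refl])
      fix e assume "e \<in> ?B"
      then have "Ls (ysum n p m e) = Lc (lookup G e)" by (intro Ls_in) (simp add: boxes_def)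
      then show "pair (Ls (ysum n p m e)) (vals X N rho (l - shift m a' e)) = ?T e"
        using Lc[of e] sub by (simp add: represents_def)
    qed
    also have "\<dots> = (\<Sum>e\<in>keys G \<inter> ?B. ?T e)"
    proof (rule sum.mono_neutral_right)
      show "\<forall>e\<in>?B - keys G \<inter> ?B. ?T e = 0"
      proof
        fix e assume "e \<in> ?B - keys G \<inter> ?B"
        then have "lookup G e = 0" by (auto simp: in_keys_iff)
        then show "?T e = 0" by (simp add: avp_def)
      qed
    qed (use finite_boxes in auto)
    also have "\<dots> = (\<Sum>e\<in>keys G. if e \<in> ?B then ?T e else 0)"
      by (simp add: sum.inter_restrict)
    also have "\<dots> = (\<Sum>e\<in>keys G. lookup (kprod N rho * (avp N rho (lookup G e) * evm (\<lambda>k. pvar (a' k)) e)) l)"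
    proof (intro sum.cong refl)
      fix e assume "e \<in> keys G"
      then have e: "keys e \<subseteq> {..<m}" using Gvars(1) by (simp add: vars_in_def)
      have "e \<in> ?B \<longleftrightarrow> (\<forall>x. lookup (shift m a' e) x \<le> lookup l x)"
      proof
        assume e': "e \<in> ?B"
        show "\<forall>x. lookup (shift m a' e) x \<le> lookup l x"
        proof
          fix x
          show "lookup (shift m a' e) x \<le> lookup l x"
          proof (cases "x \<in> a' ` {..<m}")
            case True
            then show ?thesis using e' lookup_shift(1)[OF inj] by (auto simp: boxes_def)
          next
            case False
            then show ?thesis by (simp add: lookup_shift(2)[OF inj])
          qed
        qed
      next
        assume "\<forall>x. lookup (shift m a' e) x \<le> lookup l x"
        then have "lookup e k \<le> lookup l (a' k)" if "k < m" for k
          using lookup_shift(1)[OF inj that, of e] by metis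
        then show "e \<in> ?B" using e by (simp add: boxes_def)
      qed
      then show "(if e \<in> ?B then ?T e else 0) = lookup (kprod N rho * (avp N rho (lookup G e) * evm (\<lambda>k. pvar (a' k)) e)) l"
        unfolding evm_shift[OF e] mult.assoc[symmetric] lookup_mult_mon_le by simp
    qed
    finally show ?thesis
      by (simp add: sy.gavg_def sum_distrib_left lookup_sum)
  qed
  have "represents X S' gr' N \<tau> H L"
    unfolding represents_def
  proof (intro conjI allI impI)
    fix l :: "nat \<Rightarrow>\<^sub>0 nat" assume l: "keys l \<subseteq> {..<N}"
    have "pair L (vals X N \<tau> l) = lookup (kprod N rho * sy.gavg G (\<lambda>k. pvar (a k))) l"
      using \<tau>_in a_bij l by (intro val_eq) (auto simp: rho_def A_def)
    then show "pair L (vals X N \<tau> l) = lookup (kprod N \<tau> * H) l" by (simp add: H)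
  next
    fix N' :: nat and \<tau>' :: "nat \<Rightarrow> nat set" and l :: "nat \<Rightarrow>\<^sub>0 nat"
    assume "(\<forall>b<N'. \<tau>' b \<in> S') \<and> keys l \<subseteq> {..<N'} \<and>
        tms N' \<tau>' \<noteq> tms N \<tau> \<and> \<not> gr' (tms N' \<tau>') (tms N \<tau>)"
    then have \<tau>': "\<And>b. b < N' \<Longrightarrow> \<tau>' b \<in> S'" and l: "keys l \<subseteq> {..<N'}"
      and ne: "tms N' \<tau>' \<noteq> tms N \<tau>" and ng: "\<not> gr' (tms N' \<tau>') (tms N \<tau>)" by auto
    let ?b = "\<lambda>b. base (\<tau>' b)"
    have base_tms: "image_mset base (tms N' \<tau>') = tms N' ?b" "image_mset base (tms N \<tau>) = tms N rho"
      by (simp_all add: tms_image rho_def[abs_def])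
    have sub: "keys (l - u) \<subseteq> {..<N'}" for u :: "nat \<Rightarrow>\<^sub>0 nat"
      using l by (auto simp: in_keys_iff lookup_minus subset_eq)
    define m' where "m' = card {b. b < N' \<and> \<tau>' b \<in> new}"
    obtain a' where a': "bij_betw a' {..<m'} {b. b < N' \<and> \<tau>' b \<in> new}"
      using ex_bij_betw_nat_finite[of "{b. b < N' \<and> \<tau>' b \<in> new}"] by (auto simp: m'_def atLeast0LessThan)
    have expand': "pair L (vals X N' \<tau>' l) = (\<Sum>e\<in>boxes m' (\<lambda>k. lookup l (a' k)).
        pair (Ls (ysum n p m' e)) (vals X N' ?b (l - shift m' a' e)))"
      by (rule expand[OF \<tau>' a'])
    show "pair L (vals X N' \<tau>' l) = 0"
    proof (cases "tms N' ?b = tms N rho")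
      case False
      have "\<not> gr (tms N' ?b) (tms N rho)" using ng by (simp add: gr'_def base_tms)
      then have "pair (Lc (lookup G e)) (vals X N' ?b l') = 0" if "keys l' \<subseteq> {..<N'}" for e l'
        using \<tau>' base_in False that by (intro represents_zero[OF Lc]) auto
      then have "pair (Ls u) (vals X N' ?b l') = 0" if "keys l' \<subseteq> {..<N'}" for u l'
        using Ls_cases[of u] that by (auto simp: pair_def)
      then show ?thesis unfolding expand' using sub by simp
    next
      case True
      show ?thesis
      proof (cases "m' = m")
        case False
        then have "Ls (ysum n p m' e) = (\<lambda>_. 0)" if "e \<in> boxes m' c" for e c
          using that by (intro Ls_out) (auto simp: boxes_def)
        then show ?thesis unfolding expand' by (simp add: pair_def)
      next
        case m': True
        \<comment> \<open>After this rearrangement the bases agree with those of the target position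
          by position; only the choice of extended positions can differ.\<close>
        obtain \<sigma> where N': "N' = N" and \<sigma>: "\<sigma> permutes {..<N}" "\<And>b. b < N \<Longrightarrow> rho b = base (\<tau>' (\<sigma> b))"
          using tms_eqD[OF True[symmetric]] by metis
        define \<tau>'' where "\<tau>'' b = \<tau>' (\<sigma> b)" for b
        have \<sigma>_lt: "\<sigma> b < N" if "b < N" for b using permutes_in_image[OF \<sigma>(1), of b] that by simp
        have \<tau>'': "\<tau>'' b \<in> S'" "base (\<tau>'' b) = rho b" if "b < N" for b
          using \<tau>'[of "\<sigma> b"] \<sigma>(2) \<sigma>_lt that by (auto simp: \<tau>''_def N')
        have tms'': "tms N \<tau>'' = tms N' \<tau>'"
          using tms_permute[OF \<sigma>(1), of \<tau>'] by (simp add: \<tau>''_def[abs_def] N')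
        have "bij_betw \<sigma> {b. b < N \<and> \<tau>'' b \<in> new} {b. b < N' \<and> \<tau>' b \<in> new}"
        proof (rule bij_betw_byWitness[where f' = "pinv \<sigma>"])
          have "pinv \<sigma> b < N" if "b < N" for b
            using permutes_in_image[OF permutes_inv[OF \<sigma>(1)], of b] that by simp
          then show "pinv \<sigma> ` {b. b < N' \<and> \<tau>' b \<in> new} \<subseteq> {b. b < N \<and> \<tau>'' b \<in> new}"
            by (auto simp: \<tau>''_def permutes_inverses[OF \<sigma>(1)] N')
          show "\<sigma> ` {b. b < N \<and> \<tau>'' b \<in> new} \<subseteq> {b. b < N' \<and> \<tau>' b \<in> new}"
            using \<sigma>_lt by (auto simp: \<tau>''_def N')
        qed (simp_all add: permutes_inverses[OF \<sigma>(1)])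
        from bij_betw_same_card[OF this] have "card {b. b < N \<and> \<tau>'' b \<in> new} = m"
          using m' by (simp add: m'_def)
        then obtain a'' where a'': "bij_betw a'' {..<m} {b. b < N \<and> \<tau>'' b \<in> new}"
          using ex_bij_betw_nat_finite[of "{b. b < N \<and> \<tau>'' b \<in> new}"] by (auto simp: atLeast0LessThan)
        have "pair L (vals X N' \<tau>' l) = pair L (vals X N \<tau>'' (act \<sigma> l))"
          using vals_permute[OF \<sigma>(1), of X \<tau>' l] by (simp add: \<tau>''_def[abs_def] N')
        also have "\<dots> = lookup (kprod N rho * sy.gavg G (\<lambda>k. pvar (a'' k))) (act \<sigma> l)"
          using keys_act[OF \<sigma>(1)] l by (intro val_eq[OF \<tau>'' a'']) (simp_all add: N')
        also have "sy.gavg G (\<lambda>k. pvar (a'' k)) = 0"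
        proof (rule sy.gavg_vanish[OF G \<alpha>])
          show "inj_on a'' {..<m}" using a'' by (simp add: bij_betw_def)
          have a''_in: "a'' k < N \<and> \<tau>'' (a'' k) \<in> new" if "k < m" for k
            using bij_betwE[OF a''] that by auto
          show "a'' k < N \<and> rho (a'' k) \<in> E" if "k < m" for k
            using a''_in[OF that] base_new'[of "\<tau>'' (a'' k)"] \<tau>''(2) by auto
          then have rE: "rho (a'' k) \<in> E" if "k < m" for k using that by blast
          fix w assume w: "w permutes {..<m}"
          have wl: "w k < m" if "k < m" for k using permutes_in_image[OF w, of k] that by simp
          \<comment> \<open>Otherwise the ranks dominate those of the target. The total rank is not
            larger, so all ranks are equal; \<open>bin\<close> then determines the sets, and the two
            types coincide.\<close>
          show "\<exists>k<m. bin (rho (a'' (w k))) < sy.rk k"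
          proof (rule ccontr)
            assume "\<not> ?thesis"
            then have ge: "sy.rk k \<le> bin (rho (a'' (w k)))" if "k \<in> {..<m}" for k
              using that by (meson lessThan_iff not_le)
            have sum_eq: "(\<Sum>k<m. bin (rho (a'' (w k)))) = twt (tms N' \<tau>')"
              using sum.permute[OF w, of "\<lambda>k. bin (rho (a'' k))"] tms_decompose(2)[OF \<tau>'' a''] tms''
              by (simp add: comp_def)
            have tgt: "twt (tms N \<tau>) = (\<Sum>k<m. sy.rk k)"
              using \<tau>_in a_bij by (intro tms_decompose(2)) (auto simp: rho_def A_def)
            have "\<not> twt (tms N \<tau>) < twt (tms N' \<tau>')"
              using ng True by (simp add: gr'_def base_tms)
            moreover have "(\<Sum>k<m. sy.rk k) \<le> (\<Sum>k<m. bin (rho (a'' (w k))))"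
              by (rule sum_mono) (rule ge)
            ultimately have "(\<Sum>k<m. sy.rk k) = (\<Sum>k<m. bin (rho (a'' (w k))))"
              using sum_eq tgt by simp
            then have "sy.rk k = bin (rho (a'' (w k)))" if "k < m" for k
              using sum_mono_inv[of "\<lambda>k. sy.rk k" "{..<m}" "\<lambda>k. bin (rho (a'' (w k)))" k] ge that by simp
            then have eq: "rho (a k) = rho (a'' (w k))" if "k < m" for k
              using bin_inj_E[OF sy.a_E[OF that] rE[OF wl[OF that]]] that by simp
            have "tms m (\<lambda>k. f (rho (a'' k))) = tms m (\<lambda>k. f (rho (a k)))" for f :: "nat set \<Rightarrow> nat set"
            proof -
              have "tms m (\<lambda>k. f (rho (a'' (w k)))) = tms m (\<lambda>k. f (rho (a'' k)))"
                using tms_permute[OF w, of "\<lambda>k. f (rho (a'' k))"] .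
              moreover have "tms m (\<lambda>k. f (rho (a'' (w k)))) = tms m (\<lambda>k. f (rho (a k)))"
                by (intro tms_cong) (simp add: eq)
              ultimately show ?thesis by simp
            qed
            from this[of "\<lambda>x. x"] this[of "insert n"]
            have "tms N \<tau>'' + tms m (\<lambda>k. rho (a k)) = tms N rho + tms m (\<lambda>k. insert n (rho (a k)))"
              using tms_decompose(1)[OF \<tau>'' a''] by simp
            moreover have "tms N \<tau> + tms m (\<lambda>k. rho (a k)) = tms N rho + tms m (\<lambda>k. insert n (rho (a k)))"
              using \<tau>_in a_bij by (intro tms_decompose(1)) (auto simp: rho_def A_def)
            ultimately have "tms N \<tau>'' = tms N \<tau>" by (metis add_right_cancel)
            then show False using ne tms'' by simp
          qed
        qed
        finally show ?thesis by simp
      qed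
    qed
  qed
  then show ?thesis by blast
qed

end

lemma minus_one_power_const: "((- 1) ^ M :: ('v \<Rightarrow>\<^sub>0 nat) \<Rightarrow>\<^sub>0 'c::comm_ring_1) = pconst ((- 1) ^ M)"
  by (cases "even M") (auto simp: single_uminus)

lemma pconst_inverse_of_nat:
  fixes x :: "('v \<Rightarrow>\<^sub>0 nat) \<Rightarrow>\<^sub>0 'c::field_char_0"
  assumes "(of_nat c :: 'c) \<noteq> 0"
  shows "x = pconst (inverse (of_nat c)) * (of_nat c * x)"
proof -
  have "pconst (inverse (of_nat c)) * (of_nat c * x) = pconst (inverse (of_nat c) * of_nat c) * x"
    by (simp only: mult.assoc[symmetric] single_of_nat[symmetric] mult_single add_0)
  also have "inverse (of_nat c) * of_nat c = (1 :: 'c)" using assms by (rule left_inverse)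
  finally show ?thesis by simp
qed

section \<open>From the constructed functionals to all symmetrized monomials\<close>

context step_target
begin

text \<open>The extra exponent in the recursion for \<open>k_num\<close>: an extended position
  against one of smaller rank that could have been extended but is not.\<close>

definition dk :: "nat \<Rightarrow> nat \<Rightarrow> nat" where
  "dk b c = (if b \<in> A \<and> c \<notin> A \<and> rho c \<in> E \<and> bin (rho c) < bin (rho b) then 1 else 0)"

lemma k_decompose:
  assumes "b < N" "c < N"
  shows "k_num (\<tau> b) (\<tau> c) = k_num (rho b) (rho c) + dk b c + dk c b"
proof -
  have *: "k_num (\<tau> b) (\<tau> c) = k_num (rho b) (rho c) + dk b c"
    if "b \<in> A" "c < N" "c \<notin> A" for b c
    using k_one[OF rho_A(1)[OF that(1)], of "rho c"] k_other[OF rho_A(1)[OF that(1)] rho_in[OF that(2)]]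
      rho_A(2)[OF that(1)] rho_notA[OF that(2,3)] that
    by (cases "rho c \<in> E") (auto simp: dk_def)
  consider "b \<in> A" "c \<in> A" | "b \<in> A" "c \<notin> A" | "b \<notin> A" "c \<in> A" | "b \<notin> A" "c \<notin> A" by blast
  then show ?thesis
  proof cases
    case 1
    then have "k_num (\<tau> b) (\<tau> c) = k_num (rho b) (rho c)"
      using k_both[OF rho_A(1)[OF 1(1)] rho_A(1)[OF 1(2)]] rho_A(2)[OF 1(1)] rho_A(2)[OF 1(2)] by simp
    with 1 show ?thesis by (simp add: dk_def)
  next
    case 2
    then show ?thesis using *[of b c] assms by (simp add: dk_def)
  next
    case 3
    then show ?thesis
      using *[of c b] assms k_sym[OF \<tau>_in[OF assms(1)] \<tau>_in[OF assms(2)]] k_sym[of "rho b" "rho c"] rho_in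
      by (simp add: dk_def)
  next
    case 4
    then show ?thesis using rho_notA assms by (simp add: dk_def)
  qed
qed

lemma offset_eq:
  "(sy.offset :: (nat \<Rightarrow>\<^sub>0 nat) \<Rightarrow>\<^sub>0 'a) = (\<Prod>b<N. \<Prod>c<N. (pvar b - pvar c) ^ dk b c)"
proof -
  have inner: "(\<Prod>c\<in>sy.low k - a ` {..<m}. (pvar (a k) - pvar c :: (nat \<Rightarrow>\<^sub>0 nat) \<Rightarrow>\<^sub>0 'a))
      = (\<Prod>c<N. (pvar (a k) - pvar c) ^ dk (a k) c)" if "k < m" for k
  proof -
    have l: "sy.low k - a ` {..<m} = {c \<in> {..<N}. c \<notin> A \<and> rho c \<in> E \<and> bin (rho c) < bin (rho (a k))}"
      unfolding a_image by (auto simp: sy.low_def)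
    show ?thesis
      unfolding l using a_A[OF that]
      by (subst prod.inter_filter[OF finite_lessThan]) (intro prod.cong refl; simp add: dk_def)
  qed
  have "(sy.offset :: (nat \<Rightarrow>\<^sub>0 nat) \<Rightarrow>\<^sub>0 'a) = (\<Prod>k<m. \<Prod>c<N. (pvar (a k) - pvar c) ^ dk (a k) c)"
    unfolding sy.offset_def by (intro prod.cong refl inner) simp
  also have "\<dots> = (\<Prod>b\<in>A. \<Prod>c<N. (pvar b - pvar c) ^ dk b c)"
    by (rule prod.reindex_bij_betw[OF a_bij])
  also have "\<dots> = (\<Prod>b<N. \<Prod>c<N. (pvar b - pvar c) ^ dk b c)"
    using A_lt by (intro prod.mono_neutral_left) (auto simp: dk_def)
  finally show ?thesis .
qed

text \<open>In \<open>offset\<close> the extended position is the minuend of a difference, in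
  \<open>kprod\<close> the position of larger index; the mismatches make up the sign.\<close>

lemma kprod_eq:
  obtains M where "(kprod N \<tau> :: (nat \<Rightarrow>\<^sub>0 nat) \<Rightarrow>\<^sub>0 'a) = (- 1) ^ M * (kprod N rho * sy.offset)"
proof -
  let ?x = "pvar :: nat \<Rightarrow> (nat \<Rightarrow>\<^sub>0 nat) \<Rightarrow>\<^sub>0 'a"
  let ?F = "\<lambda>b c. (?x b - ?x c) ^ dk b c"
  have flip: "(?x b - ?x c) ^ dk c b = (- 1) ^ dk c b * ?F c b" for b c
    by (metis minus_diff_eq power_minus)
  have "kprod N \<tau> = (\<Prod>b<N. \<Prod>c<b. (?x b - ?x c) ^ k_num (rho b) (rho c) * ((- 1) ^ dk c b * (?F b c * ?F c b)))"
    unfolding kprod_def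
    by (intro prod.cong refl) (simp add: k_decompose power_add flip mult.left_commute mult.assoc)
  also have "\<dots> = (\<Prod>b<N. \<Prod>c<b. (- 1) ^ dk c b) * (kprod N rho * (\<Prod>b<N. \<Prod>c<b. ?F b c * ?F c b))"
    unfolding kprod_def prod.distrib by (simp only: mult.left_commute mult.assoc)
  also have "(\<Prod>b<N. \<Prod>c<b. ?F b c * ?F c b) = (\<Prod>b<N. ?F b b * (\<Prod>c<b. ?F b c * ?F c b))"
    by (simp add: dk_def)
  also have "\<dots> = sy.offset"
    unfolding offset_eq prod_square_split ..
  also have "(\<Prod>b<N. \<Prod>c<b. (- 1 :: (nat \<Rightarrow>\<^sub>0 nat) \<Rightarrow>\<^sub>0 'a) ^ dk c b) = (- 1) ^ (\<Sum>b<N. \<Sum>c<b. dk c b)"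
    by (simp add: power_sum)
  finally show ?thesis using that by blast
qed

definition RR :: "((nat \<Rightarrow>\<^sub>0 nat) \<Rightarrow>\<^sub>0 'a) set" where
  "RR = {H. \<exists>L. represents X S' gr' N \<tau> H L}"

lemma RR_sum: "(\<And>i. i \<in> I \<Longrightarrow> H i \<in> RR) \<Longrightarrow> (\<Sum>i\<in>I. pconst (c i) * H i) \<in> RR"
proof -
  assume "\<And>i. i \<in> I \<Longrightarrow> H i \<in> RR"
  then have "\<forall>i\<in>I. \<exists>L. represents X S' gr' N \<tau> (H i) L" by (simp add: RR_def)
  then obtain L where L: "\<And>i. i \<in> I \<Longrightarrow> represents X S' gr' N \<tau> (H i) (L i)" by metis
  show ?thesis
    unfolding RR_def mem_Collect_eq by (rule exI) (rule represents_linear[OF L])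
qed

lemma RR_scale: "H \<in> RR \<Longrightarrow> pconst c * H \<in> RR"
  using RR_sum[of "{()}" "\<lambda>_. H" "\<lambda>_. c"] by simp

lemma RR_sum': "(\<And>i. i \<in> I \<Longrightarrow> H i \<in> RR) \<Longrightarrow> (\<Sum>i\<in>I. H i) \<in> RR"
  using RR_sum[of I H "\<lambda>_. 1"] by simp

lemma RR_diff: "H \<in> RR \<Longrightarrow> H' \<in> RR \<Longrightarrow> H - H' \<in> RR"
  using RR_sum[of "UNIV :: bool set" "\<lambda>b. if b then H else H'" "\<lambda>b. if b then 1 else - 1"]
  by (simp add: UNIV_bool single_uminus)

text \<open>By \<open>gavg_target\<close> the quotient for \<open>\<alpha>\<close> and
  \<open>\<beta>\<close> produces \<open>kprod N rho * offset\<close>, which is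
  \<open>kprod N \<tau>\<close> up to sign, times the given product. Here \<open>\<alpha>\<close> is
  still spread over all of \<open>stab N rho\<close>, which may mix extended and other
  positions.\<close>

lemma RR_basic:
  assumes \<alpha>: "keys \<alpha> \<subseteq> {..<N}"
  shows "av N rho \<alpha> * (\<Sum>w\<in>sy.rkperms. \<Prod>k<m. pvar (a (w k)) ^ lookup \<beta> k) \<in> RR" (is "?H \<in> RR")
proof -
  obtain G :: "(nat \<Rightarrow>\<^sub>0 nat) \<Rightarrow>\<^sub>0 (nat \<Rightarrow>\<^sub>0 nat) \<Rightarrow>\<^sub>0 'a" where G: "sy.quotient \<alpha> \<beta> G"
    using sy.quotient_ex[OF \<alpha>] by blast
  obtain M where M: "(kprod N \<tau> :: (nat \<Rightarrow>\<^sub>0 nat) \<Rightarrow>\<^sub>0 'a) = (- 1) ^ M * (kprod N rho * sy.offset)"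
    by (rule kprod_eq)
  have sq: "(- 1) ^ M * ((- 1) ^ M * x) = (x :: (nat \<Rightarrow>\<^sub>0 nat) \<Rightarrow>\<^sub>0 'a)" for x
    by (simp add: mult.assoc[symmetric] power_add[symmetric])
  have "kprod N \<tau> * ((- 1) ^ M * ?H) = kprod N rho * sy.gavg G (\<lambda>k. pvar (a k))"
  proof -
    have ac: "u * (k * d) * (u * (v * w)) = u * (u * (k * (v * d * w)))" for u k d v w :: "(nat \<Rightarrow>\<^sub>0 nat) \<Rightarrow>\<^sub>0 'a"
      by (simp add: algebra_simps)
    show ?thesis
      unfolding M sy.gavg_target[OF G \<alpha>] ac sq ..
  qed
  then have "(- 1) ^ M * ?H \<in> RR"
    using functional_ex[OF G \<alpha>] by (simp add: RR_def)
  from RR_scale[OF this, of "(- 1) ^ M"] show ?thesis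
    by (simp only: minus_one_power_const[symmetric] sq)
qed

text \<open>The part of \<open>stab N \<tau>\<close> supported on the extended positions.\<close>

definition WA :: "(nat \<Rightarrow> nat) set" where
  "WA = {\<pi>. \<pi> permutes A \<and> (\<forall>x\<in>A. rho (\<pi> x) = rho x)}"

lemma WA_stab: "\<pi> \<in> WA \<Longrightarrow> \<pi> \<in> stab N \<tau>"
proof -
  assume \<pi>: "\<pi> \<in> WA"
  then have p: "\<pi> permutes A" and r: "\<And>x. x \<in> A \<Longrightarrow> rho (\<pi> x) = rho x" by (auto simp: WA_def)
  have "\<tau> (\<pi> x) = \<tau> x" for x
  proof (cases "x \<in> A")
    case True
    then have "\<pi> x \<in> A" using permutes_in_image[OF p] by simp
    then show ?thesis using rho_A(2) r True by metis
  next
    case False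
    then show ?thesis using p by (simp add: permutes_def)
  qed
  moreover have "\<pi> permutes {..<N}" by (rule permutes_subset[OF p]) (use A_lt in blast)
  ultimately show ?thesis by (simp add: stab_def)
qed

lemma stab_rho: "\<kappa> \<in> stab N \<tau> \<Longrightarrow> \<kappa> \<in> stab N rho"
  by (simp add: stab_def rho_def)

lemma WA_inv: "\<pi> \<in> WA \<Longrightarrow> pinv \<pi> \<in> WA"
proof -
  assume \<pi>: "\<pi> \<in> WA"
  then have p: "\<pi> permutes A" and r: "\<And>x. x \<in> A \<Longrightarrow> rho (\<pi> x) = rho x" by (auto simp: WA_def)
  have "rho (pinv \<pi> x) = rho x" if "x \<in> A" for x
    using r[of "pinv \<pi> x"] permutes_in_image[OF permutes_inv[OF p], of x] that
    by (simp add: permutes_inverses[OF p])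
  then show ?thesis using permutes_inv[OF p] by (simp add: WA_def)
qed

lemma finite_WA [simp]: "finite WA"
  unfolding WA_def using finite_permutations[OF finite_A] by simp

lemma WA_comp_bij:
  assumes "\<kappa> \<in> WA"
  shows "bij_betw (\<lambda>\<pi>. \<pi> \<circ> \<kappa>) WA WA"
proof (rule bij_betw_byWitness[where f' = "\<lambda>\<pi>. \<pi> \<circ> pinv \<kappa>"])
  have p: "\<kappa> permutes A" using assms by (simp add: WA_def)
  have "\<kappa> \<circ> pinv \<kappa> = id" "pinv \<kappa> \<circ> \<kappa> = id"
    using permutes_inv_o[OF p] by auto
  then show "\<forall>\<pi>\<in>WA. \<pi> \<circ> \<kappa> \<circ> pinv \<kappa> = \<pi>" "\<forall>\<pi>\<in>WA. \<pi> \<circ> pinv \<kappa> \<circ> \<kappa> = \<pi>"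
    by (auto simp: comp_assoc)
  have *: "\<pi> \<circ> \<kappa>' \<in> WA" if "\<pi> \<in> WA" "\<kappa>' \<in> WA" for \<pi> \<kappa>'
  proof -
    have "\<kappa>' x \<in> A" if "x \<in> A" for x using \<open>\<kappa>' \<in> WA\<close> that permutes_in_image[of \<kappa>' A x] by (simp add: WA_def)
    then show ?thesis using that by (simp add: WA_def permutes_compose)
  qed
  show "(\<lambda>\<pi>. \<pi> \<circ> \<kappa>) ` WA \<subseteq> WA" "(\<lambda>\<pi>. \<pi> \<circ> pinv \<kappa>) ` WA \<subseteq> WA"
    using *[OF _ assms] *[OF _ WA_inv[OF assms]] by auto
qed

definition onA :: "(nat \<Rightarrow>\<^sub>0 nat) \<Rightarrow> (nat \<Rightarrow>\<^sub>0 nat)" where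
  "onA e = (\<Sum>x\<in>A. Poly_Mapping.single x (lookup e x))"

lemma lookup_onA: "lookup (onA e) x = (if x \<in> A then lookup e x else 0)"
  using finite_A by (simp add: onA_def lookup_sum lookup_single when_def)

lemma keys_onA: "keys (onA e) \<subseteq> A"
  by (auto simp: in_keys_iff lookup_onA split: if_splits)

text \<open>The enumeration \<open>a\<close> carries rank-preserving permutations of the indices to
  \<open>WA\<close>, because equal rank means equal base on \<open>E\<close>. The inverse
  permutations that arise are absorbed by the sum over the group.\<close>

lemma rkperms_sum:
  "(\<Sum>w\<in>sy.rkperms. \<Prod>k<m. pvar (a (w k)) ^ lookup e (a k))
    = (\<Sum>\<pi>\<in>WA. mon (act \<pi> (onA e)) :: (nat \<Rightarrow>\<^sub>0 nat) \<Rightarrow>\<^sub>0 'a)"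
proof -
  define \<Phi> where "\<Phi> w x = (if x \<in> A then a (w (inv_into {..<m} a x)) else x)" for w x
  have bij: "bij_betw \<Phi> {w. w permutes {..<m}} {\<pi>. \<pi> permutes A}"
    unfolding \<Phi>_def[abs_def] by (rule bij_betw_permutations[OF a_bij])
  have \<Phi>a: "\<Phi> w (a k) = a (w k)" if "k < m" for w k
    using that sy.a_inj a_A by (simp add: \<Phi>_def)
  have cond: "w \<in> sy.rkperms \<longleftrightarrow> \<Phi> w \<in> WA" if "w permutes {..<m}" for w
  proof -
    have wl: "w k < m" if "k < m" for k using permutes_in_image[OF \<open>w permutes _\<close>, of k] that by simp
    have "\<Phi> w permutes A" using bij_betwE[OF bij] that by blast
    then have "\<Phi> w \<in> WA \<longleftrightarrow> (\<forall>x\<in>A. rho (\<Phi> w x) = rho x)"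
      by (simp add: WA_def)
    also have "\<dots> \<longleftrightarrow> (\<forall>x\<in>a ` {..<m}. rho (\<Phi> w x) = rho x)"
      by (simp only: a_image)
    also have "\<dots> \<longleftrightarrow> (\<forall>k<m. rho (\<Phi> w (a k)) = rho (a k))"
      by auto
    also have "\<dots> \<longleftrightarrow> (\<forall>k<m. rho (a (w k)) = rho (a k))"
      by (simp add: \<Phi>a)
    also have "\<dots> \<longleftrightarrow> (\<forall>k<m. sy.rk (w k) = sy.rk k)"
      using bin_inj_E[OF sy.a_E sy.a_E] wl by metis
    finally show ?thesis using that by (simp add: sy.rkperms_def)
  qed
  have bij': "bij_betw \<Phi> sy.rkperms WA"
  proof (rule bij_betw_imageI)
    show "inj_on \<Phi> sy.rkperms"
      using bij by (auto simp: bij_betw_def sy.rkperms_def intro: inj_on_subset)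
    show "\<Phi> ` sy.rkperms = WA"
    proof
      show "\<Phi> ` sy.rkperms \<subseteq> WA" using cond by (auto simp: sy.rkperms_def)
      show "WA \<subseteq> \<Phi> ` sy.rkperms"
      proof
        fix \<pi> assume \<pi>: "\<pi> \<in> WA"
        then have "\<pi> \<in> \<Phi> ` {w. w permutes {..<m}}" using bij by (simp add: bij_betw_def WA_def)
        then obtain w where "w permutes {..<m}" "\<pi> = \<Phi> w" by blast
        then show "\<pi> \<in> \<Phi> ` sy.rkperms" using cond[of w] \<pi> by blast
      qed
    qed
  qed
  have "(\<Sum>w\<in>sy.rkperms. \<Prod>k<m. pvar (a (w k)) ^ lookup e (a k))
      = (\<Sum>w\<in>sy.rkperms. mon (act (pinv (\<Phi> w)) (onA e)) :: (nat \<Rightarrow>\<^sub>0 nat) \<Rightarrow>\<^sub>0 'a)"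
  proof (intro sum.cong refl)
    fix w assume "w \<in> sy.rkperms"
    then have p: "\<Phi> w permutes A" using bij_betwE[OF bij'] by (auto simp: WA_def)
    have "(\<Prod>k<m. pvar (a (w k)) ^ lookup e (a k)) = (\<Prod>k<m. pvar (\<Phi> w (a k)) ^ lookup e (a k) :: (nat \<Rightarrow>\<^sub>0 nat) \<Rightarrow>\<^sub>0 'a)"
      by (intro prod.cong refl) (simp add: \<Phi>a)
    also have "\<dots> = (\<Prod>x\<in>A. pvar (\<Phi> w x) ^ lookup e x)"
      by (rule prod.reindex_bij_betw[OF a_bij])
    also have "\<dots> = (\<Prod>x\<in>A. pvar (\<Phi> w x) ^ lookup (onA e) x)"
      by (intro prod.cong refl) (simp add: lookup_onA)
    also have "\<dots> = evm (\<lambda>x. pvar (\<Phi> w x)) (onA e)"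
      by (rule evm_superset[OF finite_A keys_onA, symmetric])
    also have "\<dots> = evm (\<lambda>x. pvar (\<Phi> w (pinv (\<Phi> w) x))) (act (pinv (\<Phi> w)) (onA e))"
      by (rule evm_permute[OF permutes_inv[OF p] finite_A keys_onA, symmetric])
    also have "\<dots> = mon (act (pinv (\<Phi> w)) (onA e))"
      by (simp add: permutes_inverses[OF p] evm_pvar)
    finally show "(\<Prod>k<m. pvar (a (w k)) ^ lookup e (a k)) = (mon (act (pinv (\<Phi> w)) (onA e)) :: (nat \<Rightarrow>\<^sub>0 nat) \<Rightarrow>\<^sub>0 'a)" .
  qed
  also have "\<dots> = (\<Sum>\<pi>\<in>WA. mon (act (pinv \<pi>) (onA e)))"
    by (rule sum.reindex_bij_betw[OF bij'])
  also have "\<dots> = (\<Sum>\<pi>\<in>WA. mon (act \<pi> (onA e)))"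
  proof (rule sum.reindex_bij_witness[where i = pinv and j = pinv])
    fix \<pi> assume \<pi>: "\<pi> \<in> WA"
    then have "\<pi> permutes A" by (simp add: WA_def)
    then show "pinv (pinv \<pi>) = \<pi>" "pinv (pinv \<pi>) = \<pi>" by (simp_all add: permutes_inv_inv)
    show "pinv \<pi> \<in> WA" "pinv \<pi> \<in> WA" using WA_inv[OF \<pi>] by auto
  qed simp
  finally show ?thesis .
qed

lemma stab_restrict:
  assumes "\<kappa> \<in> stab N \<tau>"
  shows "(\<lambda>x. if x \<in> A then \<kappa> x else x) \<in> WA" (is "?\<kappa> \<in> WA")
proof -
  have A_iff: "\<kappa> x \<in> A" if "x \<in> A" for x
    using stabD(2,3)[OF assms A_lt[OF that]] that by (simp add: A_def)
  have "inj_on \<kappa> A" using permutes_inj_on[OF stabD(1)[OF assms]] .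
  moreover have "\<kappa> ` A = A"
    using A_iff finite_A \<open>inj_on \<kappa> A\<close> by (intro card_subset_eq) (auto simp: card_image)
  ultimately have "bij_betw \<kappa> A A" by (simp add: bij_betw_def)
  then have "bij_betw ?\<kappa> A A" by (rule bij_betw_cong[THEN iffD1, rotated]) simp
  then have "?\<kappa> permutes A" by (intro bij_imp_permutes) auto
  moreover have "rho (?\<kappa> x) = rho x" if "x \<in> A" for x
    using stabD(2)[OF assms A_lt[OF that]] that by (simp add: rho_def)
  ultimately show ?thesis by (simp add: WA_def)
qed

text \<open>Symmetrized for \<open>\<tau>\<close>, but with \<open>\<alpha>\<close> first spread by
  \<open>stab N rho\<close>, which can carry it into \<open>A\<close>.\<close>

definition orbit_sum :: "(nat \<Rightarrow>\<^sub>0 nat) \<Rightarrow> (nat \<Rightarrow>\<^sub>0 nat) \<Rightarrow> (nat \<Rightarrow>\<^sub>0 nat) \<Rightarrow>\<^sub>0 'a" where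
  "orbit_sum \<alpha> e = (\<Sum>\<sigma>\<in>stab N rho. av N \<tau> (act \<sigma> \<alpha> + onA e))"

text \<open>The double sum \<open>?D\<close> is computed in two ways. It is the sum of the images of
  \<open>?H\<close> under \<open>stab N \<tau>\<close>, all equal to \<open>?H\<close>; and,
  absorbing \<open>\<pi>\<close> into the sum over \<open>stab N rho\<close>, it is
  \<open>card WA\<close> copies of \<open>orbit_sum\<close>. Characteristic zero permits the
  division by \<open>card WA\<close>.\<close>

lemma orbit_sum_RR:
  assumes \<alpha>: "keys \<alpha> \<subseteq> {..<N}"
  shows "orbit_sum \<alpha> e \<in> RR"
proof -
  define \<beta> where "\<beta> = (\<Sum>k<m. Poly_Mapping.single k (lookup e (a k)))"
  have \<beta>: "lookup \<beta> k = lookup e (a k)" if "k < m" for k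
    using that by (simp add: \<beta>_def lookup_sum lookup_single when_def)
  let ?P = "\<Sum>\<pi>\<in>WA. mon (act \<pi> (onA e)) :: (nat \<Rightarrow>\<^sub>0 nat) \<Rightarrow>\<^sub>0 'a"
  let ?H = "av N rho \<alpha> * ?P"
  have "?H = av N rho \<alpha> * (\<Sum>w\<in>sy.rkperms. \<Prod>k<m. pvar (a (w k)) ^ lookup \<beta> k)"
    unfolding rkperms_sum[symmetric] by (simp add: \<beta>)
  with RR_basic[OF \<alpha>, of \<beta>] have H: "?H \<in> RR" by (simp only:)
  let ?D = "\<Sum>\<sigma>\<in>stab N rho. \<Sum>\<pi>\<in>WA. av N \<tau> (act \<sigma> \<alpha> + act \<pi> (onA e)) :: (nat \<Rightarrow>\<^sub>0 nat) \<Rightarrow>\<^sub>0 'a"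
  have "?D = (\<Sum>\<kappa>\<in>stab N \<tau>. ?H)"
  proof -
    have "?D = (\<Sum>\<sigma>\<in>stab N rho. \<Sum>\<pi>\<in>WA. \<Sum>\<kappa>\<in>stab N \<tau>. mon (act (\<sigma> \<circ> \<kappa>) \<alpha>) * mon (act (\<pi> \<circ> \<kappa>) (onA e)))"
      unfolding av_def
    proof (intro sum.cong refl)
      fix \<sigma> \<pi> \<kappa> assume "\<sigma> \<in> stab N rho" "\<pi> \<in> WA" "\<kappa> \<in> stab N \<tau>"
      then have p: "\<sigma> permutes {..<N}" "\<pi> permutes {..<N}" "\<kappa> permutes {..<N}"
        using stabD(1) WA_stab by blast+
      show "mon (act \<kappa> (act \<sigma> \<alpha> + act \<pi> (onA e))) = (mon (act (\<sigma> \<circ> \<kappa>) \<alpha>) * mon (act (\<pi> \<circ> \<kappa>) (onA e)) :: (nat \<Rightarrow>\<^sub>0 nat) \<Rightarrow>\<^sub>0 'a)"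
        by (simp add: act_add[OF p(3)] act_comp[OF p(3,1)] act_comp[OF p(3,2)] mon_add)
    qed
    also have "\<dots> = (\<Sum>\<sigma>\<in>stab N rho. \<Sum>\<kappa>\<in>stab N \<tau>. \<Sum>\<pi>\<in>WA. mon (act (\<sigma> \<circ> \<kappa>) \<alpha>) * mon (act (\<pi> \<circ> \<kappa>) (onA e)))"
      by (intro sum.cong refl sum.swap)
    also have "\<dots> = (\<Sum>\<kappa>\<in>stab N \<tau>. \<Sum>\<sigma>\<in>stab N rho. \<Sum>\<pi>\<in>WA. mon (act (\<sigma> \<circ> \<kappa>) \<alpha>) * mon (act (\<pi> \<circ> \<kappa>) (onA e)))"
      by (rule sum.swap)
    also have "\<dots> = (\<Sum>\<kappa>\<in>stab N \<tau>. ?H)"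
    proof (intro sum.cong refl)
      fix \<kappa> assume \<kappa>: "\<kappa> \<in> stab N \<tau>"
      let ?\<kappa> = "\<lambda>x. if x \<in> A then \<kappa> x else x"
      have "(\<Sum>\<sigma>\<in>stab N rho. mon (act (\<sigma> \<circ> \<kappa>) \<alpha>)) = (av N rho \<alpha> :: (nat \<Rightarrow>\<^sub>0 nat) \<Rightarrow>\<^sub>0 'a)"
        unfolding av_def
        using sum.reindex_bij_betw[OF stab_comp_bij[OF stab_rho[OF \<kappa>]], of "\<lambda>\<sigma>. mon (act \<sigma> \<alpha>)"] by simp
      moreover have "(\<Sum>\<pi>\<in>WA. mon (act (\<pi> \<circ> \<kappa>) (onA e))) = ?P"
      proof -
        \<comment> \<open>For an exponent supported on \<open>A\<close> only the values of
          \<open>\<kappa>\<close> on \<open>A\<close> matter, and \<open>\<kappa>\<close> maps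
          \<open>A\<close> to itself.\<close>
        have "act (\<pi> \<circ> \<kappa>) (onA e) = act (\<pi> \<circ> ?\<kappa>) (onA e)" if "\<pi> \<in> WA" for \<pi>
        proof (rule poly_mapping_eqI)
          fix x
          have p: "\<pi> permutes A" using that by (simp add: WA_def)
          have q: "\<pi> \<circ> \<kappa> permutes {..<N}" "\<pi> \<circ> ?\<kappa> permutes {..<N}"
            using stabD(1)[OF stab_comp[OF WA_stab[OF that] \<kappa>]]
              stabD(1)[OF stab_comp[OF WA_stab[OF that] WA_stab[OF stab_restrict[OF \<kappa>]]]] by auto
          have "\<kappa> x \<in> A \<longleftrightarrow> x \<in> A"
          proof (cases "x < N")
            case True
            then show ?thesis using stabD(2,3)[OF \<kappa> True] by (simp add: A_def)
          next
            case False
            then have "\<kappa> x = x" using stabD(1)[OF \<kappa>] by (simp add: permutes_def)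
            then show ?thesis by simp
          qed
          then have "\<pi> (\<kappa> x) \<in> A \<longleftrightarrow> x \<in> A" "\<pi> x \<in> A \<longleftrightarrow> x \<in> A"
            using permutes_in_image[OF p] by auto
          then show "lookup (act (\<pi> \<circ> \<kappa>) (onA e)) x = lookup (act (\<pi> \<circ> ?\<kappa>) (onA e)) x"
            unfolding lookup_act[OF q(1)] lookup_act[OF q(2)] by (simp add: lookup_onA)
        qed
        then have "(\<Sum>\<pi>\<in>WA. mon (act (\<pi> \<circ> \<kappa>) (onA e)) :: (nat \<Rightarrow>\<^sub>0 nat) \<Rightarrow>\<^sub>0 'a) = (\<Sum>\<pi>\<in>WA. mon (act (\<pi> \<circ> ?\<kappa>) (onA e)))"
          by (intro sum.cong refl) simp
        also have "\<dots> = ?P"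
          by (rule sum.reindex_bij_betw[OF WA_comp_bij[OF stab_restrict[OF \<kappa>]]])
        finally show ?thesis .
      qed
      ultimately show "(\<Sum>\<sigma>\<in>stab N rho. \<Sum>\<pi>\<in>WA. mon (act (\<sigma> \<circ> \<kappa>) \<alpha>) * mon (act (\<pi> \<circ> \<kappa>) (onA e))) = ?H"
        by (simp add: sum_product[symmetric])
    qed
    finally show ?thesis .
  qed
  moreover have "?D = (\<Sum>\<pi>\<in>WA. orbit_sum \<alpha> e)"
  proof -
    have "?D = (\<Sum>\<pi>\<in>WA. \<Sum>\<sigma>\<in>stab N rho. av N \<tau> (act \<sigma> \<alpha> + act \<pi> (onA e)))"
      by (rule sum.swap)
    also have "\<dots> = (\<Sum>\<pi>\<in>WA. orbit_sum \<alpha> e)"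
    proof (intro sum.cong refl)
      fix \<pi> assume \<pi>: "\<pi> \<in> WA"
      have i: "pinv \<pi> \<in> stab N \<tau>" using WA_stab[OF WA_inv[OF \<pi>]] .
      have ip: "pinv \<pi> permutes {..<N}" "\<pi> permutes {..<N}" using stabD(1)[OF i] stabD(1)[OF WA_stab[OF \<pi>]] by auto
      have "av N \<tau> (act \<sigma> \<alpha> + act \<pi> (onA e)) = (av N \<tau> (act (\<sigma> \<circ> pinv \<pi>) \<alpha> + onA e) :: (nat \<Rightarrow>\<^sub>0 nat) \<Rightarrow>\<^sub>0 'a)"
        if "\<sigma> \<in> stab N rho" for \<sigma>
      proof -
        have "av N \<tau> (act \<sigma> \<alpha> + act \<pi> (onA e)) = (av N \<tau> (act (pinv \<pi>) (act \<sigma> \<alpha> + act \<pi> (onA e))) :: (nat \<Rightarrow>\<^sub>0 nat) \<Rightarrow>\<^sub>0 'a)"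
          by (rule av_act[OF i, symmetric])
        also have "act (pinv \<pi>) (act \<sigma> \<alpha> + act \<pi> (onA e)) = act (\<sigma> \<circ> pinv \<pi>) \<alpha> + onA e"
          by (simp add: act_add[OF ip(1)] act_comp[OF ip(1) stabD(1)[OF that]] act_comp[OF ip]
              permutes_inv_o[OF ip(2)])
        finally show ?thesis .
      qed
      then have "(\<Sum>\<sigma>\<in>stab N rho. av N \<tau> (act \<sigma> \<alpha> + act \<pi> (onA e)) :: (nat \<Rightarrow>\<^sub>0 nat) \<Rightarrow>\<^sub>0 'a)
          = (\<Sum>\<sigma>\<in>stab N rho. av N \<tau> (act (\<sigma> \<circ> pinv \<pi>) \<alpha> + onA e))"
        by (intro sum.cong refl)
      also have "\<dots> = orbit_sum \<alpha> e"
        unfolding orbit_sum_def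
        by (rule sum.reindex_bij_betw[OF stab_comp_bij[OF stab_rho[OF i]]])
      finally show "(\<Sum>\<sigma>\<in>stab N rho. av N \<tau> (act \<sigma> \<alpha> + act \<pi> (onA e))) = orbit_sum \<alpha> e" .
    qed
    finally show ?thesis .
  qed
  ultimately have eq: "of_nat (card WA) * orbit_sum \<alpha> e = of_nat (card (stab N \<tau>)) * ?H" by simp
  have "id \<in> WA" by (simp add: WA_def permutes_id)
  then have c: "(of_nat (card WA) :: 'a) \<noteq> 0" by (auto simp: card_eq_0_iff)
  have "orbit_sum \<alpha> e = pconst (inverse (of_nat (card WA))) * (of_nat (card WA) * orbit_sum \<alpha> e)"
    by (rule pconst_inverse_of_nat[OF c])
  also have "\<dots> = pconst (inverse (of_nat (card WA))) * (pconst (of_nat (card (stab N \<tau>))) * ?H)"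
    unfolding eq by simp
  finally show ?thesis using RR_scale[OF RR_scale[OF H]] by metis
qed

definition offdeg :: "(nat \<Rightarrow>\<^sub>0 nat) \<Rightarrow> nat" where
  "offdeg e = (\<Sum>x\<in>{..<N} - A. lookup e x)"

text \<open>Induction on the degree outside \<open>A\<close>. Split \<open>e\<close> into its parts
  off and on \<open>A\<close> and consider their \<open>orbit_sum\<close>: a permutation that
  carries some of the first part into \<open>A\<close> gives a term of smaller degree off
  \<open>A\<close>, every other one gives \<open>av N \<tau> e\<close>. The identity is of the
  second kind, so the coefficient to be divided by is not zero.\<close>

lemma av_RR:
  assumes "keys e \<subseteq> {..<N}"
  shows "av N \<tau> e \<in> RR"
  using assms
proof (induction "offdeg e" arbitrary: e rule: less_induct)
  case less
  define \<alpha> where "\<alpha> = e - onA e"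
  have la: "lookup \<alpha> x = (if x \<in> A then 0 else lookup e x)" for x
    by (simp add: \<alpha>_def lookup_minus lookup_onA)
  have "keys \<alpha> \<subseteq> keys e" by (auto simp: in_keys_iff la split: if_splits)
  then have ka: "keys \<alpha> \<subseteq> {..<N}" using less.prems by blast
  define es where "es \<sigma> = act \<sigma> \<alpha> + onA e" for \<sigma>
  have les: "lookup (es \<sigma>) x = lookup \<alpha> (\<sigma> x) + (if x \<in> A then lookup e x else 0)" if "\<sigma> \<in> stab N rho" for \<sigma> x
    using lookup_act[OF stabD(1)[OF that]] by (simp add: es_def lookup_add lookup_onA)
  have kes: "keys (es \<sigma>) \<subseteq> {..<N}" if "\<sigma> \<in> stab N rho" for \<sigma>
    using Poly_Mapping.keys_add[of "act \<sigma> \<alpha>" "onA e"] keys_act[OF stabD(1)[OF that] ka] keys_onA[of e] A_lt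
    unfolding es_def by fastforce
  \<comment> \<open>As \<open>\<alpha>\<close> vanishes on \<open>A\<close>, what
    \<open>\<sigma>\<close> carries into \<open>A\<close> is exactly what the degree off
    \<open>A\<close> loses.\<close>
  have sumA: "offdeg (es \<sigma>) + (\<Sum>x\<in>A. lookup \<alpha> (\<sigma> x)) = offdeg e" if "\<sigma> \<in> stab N rho" for \<sigma>
  proof -
    have "offdeg (es \<sigma>) = (\<Sum>x\<in>{..<N} - A. lookup \<alpha> (\<sigma> x))"
      unfolding offdeg_def by (intro sum.cong refl) (simp add: les[OF that])
    then have "offdeg (es \<sigma>) + (\<Sum>x\<in>A. lookup \<alpha> (\<sigma> x)) = (\<Sum>x<N. lookup \<alpha> (\<sigma> x))"
      using A_lt by (subst sum.subset_diff[of A "{..<N}"]) auto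
    also have "\<dots> = (\<Sum>x<N. lookup \<alpha> x)"
      using sum.permute[OF stabD(1)[OF that], of "lookup \<alpha>"] by (simp add: comp_def)
    also have "\<dots> = offdeg e"
      unfolding offdeg_def using A_lt by (intro sum.mono_neutral_cong_right) (auto simp: la)
    finally show ?thesis .
  qed
  let ?Good = "{\<sigma> \<in> stab N rho. \<not> offdeg (es \<sigma>) < offdeg e}"
  let ?Bad = "{\<sigma> \<in> stab N rho. offdeg (es \<sigma>) < offdeg e}"
  have good: "av N \<tau> (es \<sigma>) = (av N \<tau> e :: (nat \<Rightarrow>\<^sub>0 nat) \<Rightarrow>\<^sub>0 'a)" if "\<sigma> \<in> ?Good" for \<sigma>
  proof -
    have \<sigma>: "\<sigma> \<in> stab N rho" using that by simp
    have z: "lookup \<alpha> (\<sigma> x) = 0" if "x \<in> A" for x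
    proof -
      have "(\<Sum>x\<in>A. lookup \<alpha> (\<sigma> x)) = 0"
        using sumA[OF \<sigma>] \<open>\<sigma> \<in> ?Good\<close> by simp
      then show ?thesis using finite_A that by simp
    qed
    let ?B = "{..<N} - A"
    have split: "mset_set {..<N} = mset_set ?B + mset_set A"
      using A_lt finite_A by (subst mset_set_Union[symmetric]) (auto intro!: arg_cong[where f = mset_set])
    \<comment> \<open>Both \<open>\<alpha>\<close> and its image under \<open>\<sigma>\<close>
      vanish on \<open>A\<close>, so removing \<open>A\<close> leaves equal multisets off
      \<open>A\<close>, where \<open>rho\<close> and \<open>\<tau>\<close> agree.\<close>
    have "tms N (\<lambda>x. (rho x, lookup \<alpha> (\<sigma> x))) = tms N (\<lambda>x. (rho (\<sigma> x), lookup \<alpha> (\<sigma> x)))"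
      using stabD(2)[OF \<sigma>] by (intro tms_cong) simp
    also have "\<dots> = tms N (\<lambda>x. (rho x, lookup \<alpha> x))"
      using tms_permute[OF stabD(1)[OF \<sigma>], of "\<lambda>x. (rho x, lookup \<alpha> x)"] .
    finally have "image_mset (\<lambda>x. (rho x, lookup \<alpha> (\<sigma> x))) (mset_set ?B) + image_mset (\<lambda>x. (rho x, lookup \<alpha> (\<sigma> x))) (mset_set A)
        = image_mset (\<lambda>x. (rho x, lookup \<alpha> x)) (mset_set ?B) + image_mset (\<lambda>x. (rho x, lookup \<alpha> x)) (mset_set A)"
      by (simp add: tms_def split)
    moreover have "image_mset (\<lambda>x. (rho x, lookup \<alpha> (\<sigma> x))) (mset_set A) = image_mset (\<lambda>x. (rho x, lookup \<alpha> x)) (mset_set A)"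
    proof (intro image_mset_cong)
      fix x assume "x \<in># mset_set A"
      then have "x \<in> A" using finite_A by simp
      then show "(rho x, lookup \<alpha> (\<sigma> x)) = (rho x, lookup \<alpha> x)" using z[of x] la[of x] by simp
    qed
    ultimately have B: "image_mset (\<lambda>x. (rho x, lookup \<alpha> (\<sigma> x))) (mset_set ?B) = image_mset (\<lambda>x. (rho x, lookup \<alpha> x)) (mset_set ?B)"
      by simp
    have "image_mset (\<lambda>x. (\<tau> x, lookup (es \<sigma>) x)) (mset_set ?B) = image_mset (\<lambda>x. (rho x, lookup \<alpha> (\<sigma> x))) (mset_set ?B)"
      using rho_notA by (intro image_mset_cong) (simp add: les[OF \<sigma>])
    also have "\<dots> = image_mset (\<lambda>x. (rho x, lookup \<alpha> x)) (mset_set ?B)" by (rule B)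
    also have "\<dots> = image_mset (\<lambda>x. (\<tau> x, lookup e x)) (mset_set ?B)"
      using rho_notA by (intro image_mset_cong) (simp add: la)
    finally have "image_mset (\<lambda>x. (\<tau> x, lookup (es \<sigma>) x)) (mset_set ?B) = image_mset (\<lambda>x. (\<tau> x, lookup e x)) (mset_set ?B)" .
    moreover have "image_mset (\<lambda>x. (\<tau> x, lookup (es \<sigma>) x)) (mset_set A) = image_mset (\<lambda>x. (\<tau> x, lookup e x)) (mset_set A)"
    proof (intro image_mset_cong)
      fix x assume "x \<in># mset_set A"
      then have "x \<in> A" using finite_A by simp
      then show "(\<tau> x, lookup (es \<sigma>) x) = (\<tau> x, lookup e x)" using z[of x] les[OF \<sigma>, of x] by simp
    qed
    ultimately have "tms N (\<lambda>x. (\<tau> x, lookup (es \<sigma>) x)) = tms N (\<lambda>x. (\<tau> x, lookup e x))"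
      by (simp add: tms_def split)
    from stab_ex[OF this kes[OF \<sigma>] less.prems] obtain \<kappa>
      where "\<kappa> \<in> stab N \<tau>" "es \<sigma> = act \<kappa> e" .
    then show ?thesis by (simp add: av_act)
  qed
  have "orbit_sum \<alpha> e = (\<Sum>\<sigma>\<in>?Good \<union> ?Bad. av N \<tau> (es \<sigma>))"
    unfolding orbit_sum_def es_def by (intro sum.cong) auto
  also have "\<dots> = (\<Sum>\<sigma>\<in>?Good. av N \<tau> (es \<sigma>)) + (\<Sum>\<sigma>\<in>?Bad. av N \<tau> (es \<sigma>))"
    by (intro sum.union_disjoint) auto
  also have "(\<Sum>\<sigma>\<in>?Good. av N \<tau> (es \<sigma>)) = of_nat (card ?Good) * (av N \<tau> e :: (nat \<Rightarrow>\<^sub>0 nat) \<Rightarrow>\<^sub>0 'a)"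
    using good by simp
  finally have eq: "of_nat (card ?Good) * av N \<tau> e = orbit_sum \<alpha> e - (\<Sum>\<sigma>\<in>?Bad. av N \<tau> (es \<sigma>))"
    by simp
  have "(\<Sum>\<sigma>\<in>?Bad. av N \<tau> (es \<sigma>)) \<in> RR"
    using less.hyps kes by (intro RR_sum') auto
  then have "of_nat (card ?Good) * av N \<tau> e \<in> RR"
    unfolding eq by (intro RR_diff orbit_sum_RR[OF ka])
  then have scaled: "pconst (inverse (of_nat (card ?Good))) * (of_nat (card ?Good) * av N \<tau> e) \<in> RR"
    by (rule RR_scale)
  have "(av N \<tau> e :: (nat \<Rightarrow>\<^sub>0 nat) \<Rightarrow>\<^sub>0 'a)
      = pconst (inverse (of_nat (card ?Good))) * (of_nat (card ?Good) * av N \<tau> e)"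
  proof -
    have "es id = e"
      by (intro poly_mapping_eqI) (simp add: les[OF id_stab] la)
    then have "id \<in> ?Good" by simp
    then have "?Good \<noteq> {}" by blast
    moreover have "finite ?Good" by simp
    ultimately have "(of_nat (card ?Good) :: 'a) \<noteq> 0"
      by (simp only: card_eq_0_iff of_nat_eq_0_iff) simp
    then show ?thesis by (rule pconst_inverse_of_nat)
  qed
  with scaled show ?case by (simp only:)
qed

end

lemma (in step) representable_step: "representable X S' gr'"
  unfolding representable_def
proof (intro allI impI)
  fix N :: nat and \<tau> :: "nat \<Rightarrow> nat set" and e :: "nat \<Rightarrow>\<^sub>0 nat"
  assume *: "(\<forall>a<N. \<tau> a \<in> S') \<and> keys e \<subseteq> {..<N}"
  define A where "A = {b. b < N \<and> \<tau> b \<in> new}"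
  have "finite A" by (simp add: A_def)
  then obtain a where a: "bij_betw a {..<card A} A"
      "\<And>i j. i \<le> j \<Longrightarrow> j < card A \<Longrightarrow> bin (base (\<tau> (a i))) \<le> bin (base (\<tau> (a j)))"
    using sorted_enumeration[of A "\<lambda>b. bin (base (\<tau> b))"] by metis
  interpret step_target X S E n p gr N \<tau> A "card A" a
  proof unfold_locales
    show "A = {b. b < N \<and> \<tau> b \<in> new}" by (rule A_def)
    show "\<tau> b \<in> S'" if "b < N" for b using * that by blast
    show "bij_betw a {..<card A} A" by (rule a(1))
    show "bin (base (\<tau> (a i))) \<le> bin (base (\<tau> (a j)))" if "i \<le> j" "j < card A" for i j
      by (rule a(2)[OF that])
  qed
  show "\<exists>L. represents X S' gr' N \<tau> (av N \<tau> e) L"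
    using av_RR * by (auto simp: RR_def)
qed

section \<open>Products of diagonal entries\<close>

definition lead_minor :: "nat set \<Rightarrow> 'a::comm_ring_1 arc_poly fps" where
  "lead_minor I = (\<Prod>q<card I. arc_entry (sls I ! q) (Suc q))"

lemma vars_in_fps_prod:
  fixes F :: "'i \<Rightarrow> 'a::comm_ring_1 arc_poly fps"
  assumes "\<And>i k. i \<in> A \<Longrightarrow> vars_in V (fps_nth (F i) k)"
  shows "vars_in V (fps_nth (prod F A) k)"
  using assms
proof (induction A arbitrary: k rule: infinite_finite_induct)
  case (insert x A)
  then show ?case by (auto simp: fps_mult_nth intro!: vars_in_sum vars_in_mult)
qed (auto simp: fps_one_nth)

text \<open>The order is hidden because it changes with every adjoined entry; what is kept is enough
  to pick a maximal type in a finite set.\<close>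

definition order_representable where
  "order_representable X S \<longleftrightarrow>
    (\<exists>gr. (\<forall>T. \<not> gr T T) \<and> (\<forall>T T' T''. gr T T' \<longrightarrow> gr T' T'' \<longrightarrow> gr T T'') \<and> representable X S gr)"

lemma stage_Suc:
  assumes "p \<ge> 2" "n \<ge> 1" "n \<le> M"
  shows "stage M n p \<union> insert n ` {C. extension_step n p C} = stage M n (Suc p)"
proof (intro subset_antisym subsetI)
  fix I assume "I \<in> stage M n p \<union> insert n ` {C. extension_step n p C}"
  then show "I \<in> stage M n (Suc p)"
  proof
    assume "I \<in> insert n ` {C. extension_step n p C}"
    then obtain C where ex: "extension_step n p C" and I: "I = insert n C" by blast
    show ?thesis
      using I extension_step.card_insert_C[OF ex] assms extension_step.C[OF ex] by (auto simp: stage_def)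
  qed (auto simp: stage_def)
next
  fix I assume I: "I \<in> stage M n (Suc p)"
  show "I \<in> stage M n p \<union> insert n ` {C. extension_step n p C}"
  proof (cases "I \<in> stage M n p")
    case False
    then have *: "I \<subseteq> {1..n}" "\<not> I \<subseteq> {1..<n}" "card I = p"
      using I by (auto simp: stage_def)
    then have "I - {n} \<subseteq> {1..<n}" by force
    moreover from this have "n \<in> I" using * by blast
    moreover from this have "card (I - {n}) = p - 1" using * by simp
    ultimately have "extension_step n p (I - {n})" "I = insert n (I - {n})"
      using assms by (auto simp: extension_step_def)
    then show ?thesis by blast
  qed simp
qed

lemma vars_in_lead_minor:
  assumes "I \<in> stage M n p" "p \<ge> 2"
  shows "vars_in (- yrow n p) (fps_nth (lead_minor I :: 'a::comm_ring_1 arc_poly fps) k)"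
  unfolding lead_minor_def
proof (rule vars_in_fps_prod)
  fix q k assume "q \<in> {..<card I}"
  then have q: "q < card I" by simp
  have fin: "finite I" using assms(1) finite_subset by (auto simp: stage_def)
  have "\<not> (sls I ! q = n \<and> Suc q = p)"
  proof
    assume *: "sls I ! q = n \<and> Suc q = p"
    then have "n \<in> I" using sls_nth_mem[OF fin q] by simp
    then show False using assms * q by (auto simp: stage_def)
  qed
  then have "vars_in (- yrow n p) (pvar (sls I ! q, Suc q, k) :: 'a arc_poly)"
    by (intro vars_in_pvar) (auto simp: yrow_def)
  then show "vars_in (- yrow n p) (fps_nth (arc_entry (sls I ! q) (Suc q) :: 'a arc_poly fps) k)"
    by (simp add: arc_entry_def arc_var_def pvar_def mon_def)
qed

lemma lead_minor_insert:
  assumes "extension_step n p C"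
  shows "lead_minor (insert n C) = lead_minor C * (arc_entry n p :: 'a::comm_ring_1 arc_poly fps)"
proof -
  interpret extension_step n p C by fact
  have p': "p = Suc (card C)" using card_C p by simp
  have "lead_minor (insert n C) = (\<Prod>q<Suc (card C). arc_entry ((sls C @ [n]) ! q) (Suc q) :: 'a arc_poly fps)"
    unfolding lead_minor_def sls_insert card_insert_C using p' by simp
  also have "\<dots> = lead_minor C * (arc_entry n p :: 'a arc_poly fps)"
    unfolding lead_minor_def prod.lessThan_Suc p' by (simp add: nth_append)
  finally show ?thesis .
qed

lemma stage_representable_Suc:
  assumes p: "p \<ge> 2" and n: "n \<ge> 1" "n \<le> M"
    and rep: "order_representable (lead_minor :: nat set \<Rightarrow> 'a::field_char_0 arc_poly fps) (stage M n p)"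
  shows "order_representable (lead_minor :: nat set \<Rightarrow> 'a arc_poly fps) (stage M n (Suc p))"
proof -
  let ?X = "lead_minor :: nat set \<Rightarrow> 'a arc_poly fps"
  let ?E = "{C. extension_step n p C}"
  obtain gr where gr: "\<And>T. \<not> gr T T" "\<And>T T' T''. gr T T' \<Longrightarrow> gr T' T'' \<Longrightarrow> gr T T''"
      "representable ?X (stage M n p) gr"
    using rep unfolding order_representable_def by blast
  have fin: "finite I" if "I \<in> stage M n p \<union> insert n ` ?E" for I
  proof -
    have "I \<in> stage M n (Suc p)" using that stage_Suc[OF p n] by blast
    then show ?thesis using finite_subset[of I "{1..M}"] by (simp add: stage_def)
  qed
  interpret step ?X "stage M n p" ?E n p gr
  proof
    fix C assume "C \<in> ?E"
    then have "extension_step n p C" by simp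
    then interpret C: extension_step n p C .
    show "n \<notin> C" by (rule C.n_notin)
    show "insert n C \<notin> stage M n p" using C.card_insert_C p by (auto simp: stage_def)
  next
    show "?E \<subseteq> stage M n p"
    proof
      fix C assume "C \<in> ?E"
      then have "extension_step n p C" by simp
      then interpret C: extension_step n p C .
      have "C \<noteq> {}" using C.card_C p by auto
      then show "C \<in> stage M n p" using C.C n by (auto simp: stage_def)
    qed
  next
    fix C D assume "C \<in> ?E" "D \<in> ?E" "bin C = bin D"
    then show "C = D"
      using bin_inj[of C D] by (auto simp: extension_step.finite_C extension_step.card_C)
  next
    fix I k assume "I \<in> stage M n p"
    then show "vars_in (- yrow n p) (fps_nth (?X I) k)" using p by (rule vars_in_lead_minor)
  next
    fix I J assume "I \<in> stage M n p \<union> insert n ` ?E" "J \<in> stage M n p \<union> insert n ` ?E"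
    then show "k_num I J = k_num J I" by (intro k_num_sym fin)
  next
    fix C D assume "C \<in> ?E" "D \<in> stage M n p" "D \<notin> ?E"
    then show "k_num (insert n C) D = k_num C D" by (intro k_num_insert_other) auto
  next
    fix C D assume "C \<in> ?E" "D \<in> ?E"
    then show "k_num (insert n C) D = k_num C D + (if bin D < bin C then 1 else 0)"
      by (intro k_num_insert_same_card) auto
  qed (use gr in \<open>auto intro: k_num_insert_insert lead_minor_insert\<close>)
  have "representable ?X (stage M n (Suc p)) gr'"
    using representable_step unfolding stage_Suc[OF p n] .
  then show ?thesis
    unfolding order_representable_def using gr'_irrefl gr'_trans by (intro exI[of _ gr']) blast
qed

text \<open>Column \<open>1\<close> comes for free from the singletons; the other entries are
  adjoined row by row, in each row from column \<open>2\<close> on, and the last stage of a row is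
  the first stage of the next.\<close>

lemma lead_minor_representable:
  "order_representable (lead_minor :: nat set \<Rightarrow> 'a::field_char_0 arc_poly fps) {I. I \<noteq> {} \<and> I \<subseteq> {1..M}}"
proof -
  let ?X = "lead_minor :: nat set \<Rightarrow> 'a arc_poly fps"
  have stage: "order_representable ?X (stage M n (2 + d))"
    if "order_representable ?X (stage M n 2)" "n \<ge> 1" "n \<le> M" for n d
    using that by (induction d) (auto intro: stage_representable_Suc)
  have "order_representable ?X (stage M (Suc n) 2)" if "n \<le> M" for n
    using that
  proof (induction n)
    case 0
    have "stage M (Suc 0) 2 = (\<lambda>i. {i}) ` {1..M}"
    proof (intro subset_antisym subsetI)
      fix I assume I: "I \<in> stage M (Suc 0) 2"
      then have "card I = 1"
        using card_mono[of "{1..Suc 0}" I] by (cases "card I") (auto simp: stage_def dest: finite_subset)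
      then obtain i where "I = {i}" by (rule card_1_singletonE)
      then show "I \<in> (\<lambda>i. {i}) ` {1..M}" using I by (auto simp: stage_def)
    qed (auto simp: stage_def)
    moreover have "?X {i} = arc_entry i 1" for i by (simp add: lead_minor_def)
    then have "representable ?X ((\<lambda>i. {i}) ` {1..M}) (\<lambda>_ _. False)"
      by (intro representable_singletons)
    ultimately show ?case unfolding order_representable_def by auto
  next
    case (Suc n)
    \<comment> \<open>This goes one column beyond the diagonal. The additional step adjoins nothing,
      as no set of rows below \<open>Suc n\<close> has \<open>Suc n\<close> elements.\<close>
    have "stage M (Suc n) (2 + Suc n) = stage M (Suc (Suc n)) 2"
    proof (intro subset_antisym subsetI)
      fix I assume I: "I \<in> stage M (Suc (Suc n)) 2"
      then have "card I \<noteq> 0"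
        using finite_subset[of I "{1..M}"] by (auto simp: stage_def)
      then have "card I = 1 \<or> I \<subseteq> {1..Suc n}" using I by (auto simp: stage_def)
      moreover have "card I \<le> Suc n" if "I \<subseteq> {1..Suc n}"
        using card_mono[OF _ that] by simp
      ultimately show "I \<in> stage M (Suc n) (2 + Suc n)" using I by (auto simp: stage_def)
    qed (auto simp: stage_def)
    then show ?case using stage[OF Suc.IH] Suc.prems by (metis Suc_leD le_add1 plus_1_eq_Suc)
  qed
  from this[of M] have "order_representable ?X (stage M (Suc M) 2)" by simp
  moreover have "stage M (Suc M) 2 = {I. I \<noteq> {} \<and> I \<subseteq> {1..M}}"
    by (auto simp: stage_def)
  ultimately show ?thesis by simp
qed

section \<open>Triangularity for admissible exponents\<close>

text \<open>Whenever the types differ, the later position has the larger weight, so a difference has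
  leading term \<open>pvar a\<close>. Between equal types there is no factor, since
  \<open>k_num\<close> vanishes there.\<close>

lemma top_form_kprod:
  fixes \<tau> :: "nat \<Rightarrow> nat set" and \<omega> :: "nat \<Rightarrow> int"
  assumes sorted: "\<And>a b. b < a \<Longrightarrow> a < N \<Longrightarrow> \<tau> b = \<tau> a \<or> \<omega> b < \<omega> a"
  shows "top_form \<omega> (\<Sum>a<N. \<Sum>b<a. int (k_num (\<tau> a) (\<tau> b)) * \<omega> a) (kprod N \<tau>)
    (mon (\<Sum>a<N. Poly_Mapping.single a (\<Sum>b<a. k_num (\<tau> a) (\<tau> b))) :: (nat \<Rightarrow>\<^sub>0 nat) \<Rightarrow>\<^sub>0 'a::comm_ring_1)"
proof -
  have factor: "top_form \<omega> (int (k_num (\<tau> a) (\<tau> b)) * \<omega> a) ((pvar a - pvar b) ^ k_num (\<tau> a) (\<tau> b))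
      (pvar a ^ k_num (\<tau> a) (\<tau> b) :: (nat \<Rightarrow>\<^sub>0 nat) \<Rightarrow>\<^sub>0 'a)" if "b < a" "a < N" for a b
  proof (cases "\<tau> b = \<tau> a")
    case True
    then show ?thesis by (simp add: top_form_one)
  next
    case False
    have "top_form \<omega> (\<omega> a) (pvar a - pvar b) (pvar a :: (nat \<Rightarrow>\<^sub>0 nat) \<Rightarrow>\<^sub>0 'a)"
      using sorted[OF that] False by (simp add: top_form_def pvar_def)
    then show ?thesis by (rule top_form_power)
  qed
  have eq: "mon (\<Sum>a<N. Poly_Mapping.single a (\<Sum>b<a. k_num (\<tau> a) (\<tau> b)))
      = (\<Prod>a<N. \<Prod>b<a. pvar a ^ k_num (\<tau> a) (\<tau> b) :: (nat \<Rightarrow>\<^sub>0 nat) \<Rightarrow>\<^sub>0 'a)"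
    unfolding mon_sum pvar_power[symmetric] power_sum ..
  show ?thesis
    unfolding kprod_def eq by (rule top_form_prod, rule top_form_prod, rule factor) simp_all
qed

lemma mwt_act:
  fixes N :: nat
  assumes "\<sigma> permutes {..<N}" "keys e \<subseteq> {..<N}" "\<And>a. a < N \<Longrightarrow> \<omega> (\<sigma> a) = \<omega> a"
  shows "mwt \<omega> (act \<sigma> e) = mwt \<omega> e"
proof -
  have "mwt \<omega> (act \<sigma> e) = (\<Sum>a<N. int (lookup e (\<sigma> a)) * \<omega> (\<sigma> a))"
    unfolding mwt_superset[OF finite_lessThan keys_act[OF assms(1,2)]]
    using assms(3) by (intro sum.cong refl) (simp add: lookup_act[OF assms(1)])
  also have "\<dots> = mwt \<omega> e"
    unfolding mwt_superset[OF finite_lessThan assms(2)]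
    using sum.permute[OF assms(1), of "\<lambda>a. int (lookup e a) * \<omega> a"] by (simp add: comp_def)
  finally show ?thesis .
qed

lemma top_form_av:
  assumes "keys e \<subseteq> {..<N}" "\<And>a b. a < N \<Longrightarrow> b < N \<Longrightarrow> \<tau> a = \<tau> b \<Longrightarrow> \<omega> a = \<omega> b"
  shows "top_form \<omega> (mwt \<omega> e) (av N \<tau> e) (av N \<tau> e :: (nat \<Rightarrow>\<^sub>0 nat) \<Rightarrow>\<^sub>0 'a::comm_ring_1)"
proof -
  have "mwt \<omega> m = mwt \<omega> e" if "m \<in> keys (av N \<tau> e :: (nat \<Rightarrow>\<^sub>0 nat) \<Rightarrow>\<^sub>0 'a)" for m
  proof -
    have l: "lookup (av N \<tau> e :: (nat \<Rightarrow>\<^sub>0 nat) \<Rightarrow>\<^sub>0 'a) m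
        = (\<Sum>\<sigma>\<in>stab N \<tau>. if m = act \<sigma> e then 1 else 0)"
      by (simp add: av_def lookup_sum lookup_mon)
    have ne: "(\<Sum>\<sigma>\<in>stab N \<tau>. if m = act \<sigma> e then 1 else (0::'a)) \<noteq> 0"
      using that unfolding in_keys_iff l .
    have "\<exists>\<sigma>\<in>stab N \<tau>. m = act \<sigma> e"
    proof (rule ccontr)
      assume "\<not> (\<exists>\<sigma>\<in>stab N \<tau>. m = act \<sigma> e)"
      then have "(\<Sum>\<sigma>\<in>stab N \<tau>. if m = act \<sigma> e then 1 else (0::'a)) = 0"
        by (intro sum.neutral ballI if_not_P) blast
      with ne show False by contradiction
    qed
    then obtain \<sigma> where \<sigma>: "\<sigma> \<in> stab N \<tau>" "m = act \<sigma> e" by blast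
    have "\<omega> (\<sigma> a) = \<omega> a" if "a < N" for a
      using assms(2)[OF stabD(3)[OF \<sigma>(1) that] that stabD(2)[OF \<sigma>(1) that]] .
    then show ?thesis using mwt_act[OF stabD(1)[OF \<sigma>(1)] assms(1)] \<sigma>(2) by simp
  qed
  then show ?thesis by (simp add: top_form_def)
qed

text \<open>At a weight not below the top only the leading form contributes, and it is the monomial
  of \<open>K\<close> times a symmetrized monomial.\<close>

lemma lookup_kprod_av:
  fixes N :: nat and \<tau> :: "nat \<Rightarrow> nat set" and \<omega> :: "nat \<Rightarrow> int"
  defines "K \<equiv> (\<Sum>a<N. Poly_Mapping.single a (\<Sum>b<a. k_num (\<tau> a) (\<tau> b)))"
  assumes sorted: "\<And>a b. b < a \<Longrightarrow> a < N \<Longrightarrow> \<tau> b = \<tau> a \<or> \<omega> b < \<omega> a"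
    and eq: "\<And>a b. a < N \<Longrightarrow> b < N \<Longrightarrow> \<tau> a = \<tau> b \<Longrightarrow> \<omega> a = \<omega> b"
    and \<epsilon>: "keys \<epsilon> \<subseteq> {..<N}" and m: "mwt \<omega> (\<epsilon> + K) \<le> mwt \<omega> m"
  shows "lookup (kprod N \<tau> * av N \<tau> \<epsilon>) m
    = of_nat (card {\<sigma> \<in> stab N \<tau>. m = act \<sigma> \<epsilon> + K}) * (1 :: 'a::comm_ring_1)"
proof -
  let ?p = "kprod N \<tau> * av N \<tau> \<epsilon> :: (nat \<Rightarrow>\<^sub>0 nat) \<Rightarrow>\<^sub>0 'a"
  let ?q = "mon K * av N \<tau> \<epsilon> :: (nat \<Rightarrow>\<^sub>0 nat) \<Rightarrow>\<^sub>0 'a"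
  let ?w = "\<Sum>a<N. \<Sum>b<a. int (k_num (\<tau> a) (\<tau> b)) * \<omega> a"
  have k: "top_form \<omega> ?w (kprod N \<tau>) (mon K :: (nat \<Rightarrow>\<^sub>0 nat) \<Rightarrow>\<^sub>0 'a)"
    unfolding K_def by (rule top_form_kprod[OF sorted])
  have K: "mwt \<omega> (\<epsilon> + K) = mwt \<omega> \<epsilon> + ?w"
    using k by (simp add: mwt_add top_form_def mon_def)
  have "top_form \<omega> (?w + mwt \<omega> \<epsilon>) ?p ?q"
    by (rule top_form_mult[OF k top_form_av[OF \<epsilon> eq]])
  then have lt: "mwt \<omega> m' < ?w + mwt \<omega> \<epsilon>" if "m' \<in> keys (?p - ?q)" for m'
    using that unfolding top_form_def by blast
  have "m \<notin> keys (?p - ?q)"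
  proof
    assume "m \<in> keys (?p - ?q)"
    from lt[OF this] m show False unfolding K by linarith
  qed
  then have "lookup ?p m = lookup ?q m"
    unfolding in_keys_iff lookup_minus by simp
  also have "?q = (\<Sum>\<sigma>\<in>stab N \<tau>. mon (act \<sigma> \<epsilon> + K))"
    unfolding av_def sum_distrib_left by (intro sum.cong refl) (simp add: mon_add mult.commute)
  also have "lookup \<dots> m = (\<Sum>\<sigma>\<in>stab N \<tau>. if m = act \<sigma> \<epsilon> + K then 1 else 0)"
    by (simp add: lookup_sum lookup_mon)
  also have "\<dots> = of_nat (card {\<sigma> \<in> stab N \<tau>. m = act \<sigma> \<epsilon> + K}) * 1"
    by (subst sum.inter_filter[OF finite_stab, symmetric]) (simp only: sum_constant)
  finally show ?thesis .
qed

text \<open>Embeds \<open>\<prec>\<close> on the subsets of \<open>{1..n}\<close> into the numbers: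
  \<open>bin\<close> stays below \<open>2 ^ Suc n\<close> there, so the size decides first. It later
  serves as the weight of a variable.\<close>

definition subset_rank :: "nat \<Rightarrow> nat set \<Rightarrow> nat" where
  "subset_rank n I = card I * 2 ^ Suc n + bin I"

lemma subset_rank_less_iff:
  assumes "I \<subseteq> {1..n}" "J \<subseteq> {1..n}"
  shows "subset_rank n I < subset_rank n J \<longleftrightarrow> I \<prec> J"
proof -
  have fin: "finite I" "finite J" using assms finite_subset by auto
  have *: "subset_rank n I < subset_rank n J" if "I \<subseteq> {1..n}" "card I < card J" for I J
  proof -
    have "bin I < 2 ^ Suc n" using that by (intro bin_less_pow) auto
    then have "subset_rank n I < (card I + 1) * 2 ^ Suc n" by (simp add: subset_rank_def)
    also have "\<dots> \<le> card J * 2 ^ Suc n" using that by (intro mult_right_mono) auto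
    finally show ?thesis by (simp add: subset_rank_def)
  qed
  consider "card I < card J" | "card J < card I" | "card I = card J" by linarith
  then show ?thesis
  proof cases
    case 1
    then show ?thesis using *[OF assms(1) 1] by (simp add: set_prec_def)
  next
    case 2
    then show ?thesis using *[OF assms(2) 2] by (simp add: set_prec_def)
  next
    case 3
    then show ?thesis using bin_less_iff[OF fin 3] by (simp add: subset_rank_def)
  qed
qed

lemma proper_subsetsD:
  assumes "I \<in> proper_subsets n"
  shows "I \<subseteq> {1..n}" "finite I" "I \<noteq> {}"
  using assms finite_subset by (auto simp: proper_subsets_def)

lemma finite_proper_subsets: "finite (proper_subsets n)"
  by (rule finite_subset[of _ "Pow {1..n}"]) (auto simp: proper_subsets_def)

lemma subset_rank_inj: "inj_on (subset_rank n) (proper_subsets n)"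
proof
  fix I J assume *: "I \<in> proper_subsets n" "J \<in> proper_subsets n" "subset_rank n I = subset_rank n J"
  show "I = J"
    using set_prec_total[OF proper_subsetsD(2)[OF *(1)] proper_subsetsD(2)[OF *(2)]]
      subset_rank_less_iff[OF proper_subsetsD(1)[OF *(1)] proper_subsetsD(1)[OF *(2)]]
      subset_rank_less_iff[OF proper_subsetsD(1)[OF *(2)] proper_subsetsD(1)[OF *(1)]] *(3) by auto
qed

definition subset_list :: "nat \<Rightarrow> nat set list" where
  "subset_list n = sort_key (subset_rank n) (SOME xs. set xs = proper_subsets n \<and> distinct xs)"

lemma subset_list:
  "set (subset_list n) = proper_subsets n" "distinct (subset_list n)"
  "sorted (map (subset_rank n) (subset_list n))"
proof -
  have "\<exists>xs. set xs = proper_subsets n \<and> distinct xs"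
    using finite_distinct_list[OF finite_proper_subsets] .
  from someI_ex[OF this] show "set (subset_list n) = proper_subsets n" "distinct (subset_list n)"
    unfolding subset_list_def by simp_all
  show "sorted (map (subset_rank n) (subset_list n))" by (simp add: subset_list_def)
qed

section \<open>Admissible monomials as families of types and exponents\<close>

definition factors :: "nat \<Rightarrow> (nat set \<Rightarrow> nat list) \<Rightarrow> (nat set \<times> nat) list" where
  "factors n l = concat (map (\<lambda>I. map (Pair I) (l I)) (subset_list n))"

lemma filter_factors:
  assumes "I \<in> proper_subsets n"
  shows "filter (\<lambda>x. fst x = I) (factors n l) = map (Pair I) (l I)"
proof -
  have const: "filter (\<lambda>x. c) xs = (if c then xs else [])" for c and xs :: "nat list"
    by simp
  have "filter (\<lambda>x. fst x = I) (concat (map (\<lambda>I. map (Pair I) (l I)) Is))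
      = (if I \<in> set Is then map (Pair I) (l I) else [])" if "distinct Is" for Is
    using that by (induction Is) (auto simp: filter_map comp_def const)
  from this[OF subset_list(2)] show ?thesis using assms subset_list(1) by (simp add: factors_def)
qed

lemma prod_factors:
  fixes g :: "nat set \<times> nat \<Rightarrow> 'c::comm_monoid_mult"
  shows "(\<Prod>a<length (factors n l). g (factors n l ! a)) = (\<Prod>I\<in>proper_subsets n. \<Prod>p<length (l I). g (I, l I ! p))"
proof -
  have nth: "prod_list (map h xs) = (\<Prod>a<length xs. h (xs ! a))" for h :: "'d \<Rightarrow> 'c" and xs
    by (simp add: prod.list_conv_set_nth atLeast0LessThan)
  have "prod_list (map g (concat (map (\<lambda>I. map (Pair I) (l I)) Is))) = (\<Prod>I\<in>set Is. \<Prod>p<length (l I). g (I, l I ! p))"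
    if "distinct Is" for Is
    using that by (induction Is) (auto simp: nth comp_def)
  from this[OF subset_list(2)] show ?thesis
    using subset_list(1) by (simp add: factors_def[symmetric] nth)
qed

lemma sum_factors:
  fixes g :: "nat set \<times> nat \<Rightarrow> 'c::comm_monoid_add"
  shows "(\<Sum>a<length (factors n l). g (factors n l ! a)) = (\<Sum>I\<in>proper_subsets n. \<Sum>p<length (l I). g (I, l I ! p))"
proof -
  have nth: "sum_list (map h xs) = (\<Sum>a<length xs. h (xs ! a))" for h :: "'d \<Rightarrow> 'c" and xs
    by (simp add: sum.list_conv_set_nth atLeast0LessThan)
  have "sum_list (map g (concat (map (\<lambda>I. map (Pair I) (l I)) Is))) = (\<Sum>I\<in>set Is. \<Sum>p<length (l I). g (I, l I ! p))"
    if "distinct Is" for Is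
    using that by (induction Is) (auto simp: nth comp_def)
  from this[OF subset_list(2)] show ?thesis
    using subset_list(1) by (simp add: factors_def[symmetric] nth)
qed

lemma mem_factors: "(I, k) \<in> set (factors n l) \<longleftrightarrow> I \<in> proper_subsets n \<and> k \<in> set (l I)"
  using subset_list(1) by (auto simp: factors_def)

lemma sorted_factors: "sorted (map (\<lambda>x. subset_rank n (fst x)) (factors n l))"
proof -
  have const: "sorted (map (\<lambda>x. c) xs)" for c :: nat and xs :: "nat list"
    by (induction xs) auto
  have "sorted (map (\<lambda>x. subset_rank n (fst x)) (concat (map (\<lambda>I. map (Pair I) (l I)) Is)))"
    if "sorted (map (subset_rank n) Is)" for Is
    using that by (induction Is) (auto simp: sorted_append comp_def const)
  then show ?thesis using subset_list(3) by (simp add: factors_def)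
qed

lemma factors_eqD:
  assumes "l \<in> admissible n" "l' \<in> admissible n" "mset (factors n l) = mset (factors n l')"
  shows "l = l'"
proof
  fix I
  show "l I = l' I"
  proof (cases "I \<in> proper_subsets n")
    case True
    have "image_mset snd (mset (filter (\<lambda>x. fst x = I) (factors n l)))
        = image_mset snd (mset (filter (\<lambda>x. fst x = I) (factors n l')))"
      using assms(3) by (simp only: mset_filter)
    then have "mset (l I) = mset (l' I)"
      by (simp add: filter_factors[OF True] image_mset.compositionality comp_def)
    moreover have "sorted (l I)" "sorted (l' I)"
      using assms(1,2) True by (auto simp: admissible_def)
    ultimately show ?thesis using properties_for_sort by metis
  next
    case False
    then show ?thesis using assms(1,2) by (simp add: admissible_def)
  qed
qed

definition ftype :: "nat \<Rightarrow> (nat set \<Rightarrow> nat list) \<Rightarrow> nat \<Rightarrow> nat set" where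
  "ftype n l a = map fst (factors n l) ! a"

definition expo :: "nat \<Rightarrow> (nat set \<Rightarrow> nat list) \<Rightarrow> (nat \<Rightarrow>\<^sub>0 nat)" where
  "expo n l = (\<Sum>a<length (factors n l). Poly_Mapping.single a (snd (factors n l ! a)))"

definition ftypes :: "nat \<Rightarrow> (nat set \<Rightarrow> nat list) \<Rightarrow> nat set multiset" where
  "ftypes n l = tms (length (factors n l)) (ftype n l)"

lemma lookup_expo:
  "lookup (expo n l) a = (if a < length (factors n l) then snd (factors n l ! a) else 0)"
  by (auto simp: expo_def lookup_sum lookup_single when_def)

lemma keys_expo: "keys (expo n l) \<subseteq> {..<length (factors n l)}"
  by (auto simp: in_keys_iff lookup_expo split: if_splits)

lemma ftype_nth: "a < length (factors n l) \<Longrightarrow> ftype n l a = fst (factors n l ! a)"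
  by (simp add: ftype_def)

lemma ftype_in: "a < length (factors n l) \<Longrightarrow> ftype n l a \<in> proper_subsets n"
  using mem_factors[of "fst (factors n l ! a)" "snd (factors n l ! a)" n l] by (simp add: ftype_def)

lemma vals_factors:
  "vals X (length (factors n l)) (ftype n l) (expo n l)
    = (\<Prod>I\<in>proper_subsets n. \<Prod>p<length (l I). fps_nth (X I) (l I ! p))"
  using prod_factors[of "\<lambda>(I, k). fps_nth (X I) k" n l]
  by (simp add: vals_def lookup_expo ftype_def case_prod_beta)

lemma tms_nth: "tms (length xs) (\<lambda>a. xs ! a) = mset xs"
proof -
  have "mset xs = mset (map (\<lambda>a. xs ! a) [0..<length xs])" by (simp add: map_nth)
  then show ?thesis by (simp add: tms_def atLeast0LessThan)
qed

text \<open>The factors are listed by increasing rank, so the multiset of types already fixes the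
  list of types.\<close>

lemma ftype_cong:
  assumes "ftypes n l = ftypes n l'"
  shows "length (factors n l) = length (factors n l')" "ftype n l = ftype n l'"
proof -
  have *: "ftypes n l = mset (map fst (factors n l))" for l
    using tms_nth[of "map fst (factors n l)"] by (simp add: ftypes_def ftype_def[abs_def])
  have m: "mset (map fst (factors n l)) = mset (map fst (factors n l'))"
    using assms unfolding * .
  then show "length (factors n l) = length (factors n l')"
    by (metis length_map mset_eq_length)
  have "mset (map (subset_rank n) (map fst (factors n l))) = mset (map (subset_rank n) (map fst (factors n l')))"
    using m by (metis mset_map)
  moreover have "sorted (map (subset_rank n) (map fst (factors n l)))" for l
    using sorted_factors[of n l] by (simp add: comp_def)
  ultimately have "map (subset_rank n) (map fst (factors n l)) = map (subset_rank n) (map fst (factors n l'))"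
    using properties_for_sort by metis
  moreover have "set (map fst (factors n l)) \<subseteq> proper_subsets n" for l
    using mem_factors[of _ _ n l] by auto
  ultimately have "map fst (factors n l) = map fst (factors n l')"
    using inj_on_subset[OF subset_rank_inj[of n]] by (subst (asm) inj_on_map_eq_map) auto
  then show "ftype n l = ftype n l'" by (simp add: ftype_def[abs_def])
qed

lemma ftype_sorted:
  assumes "b \<le> a" "a < length (factors n l)"
  shows "ftype n l b = ftype n l a \<or> ftype n l b \<prec> ftype n l a"
proof -
  have b: "b < length (factors n l)" using assms by simp
  have "subset_rank n (ftype n l b) \<le> subset_rank n (ftype n l a)"
    using sorted_nth_mono[OF sorted_factors[of n l] assms(1)] assms b by (simp add: ftype_def)
  then show ?thesis
    using inj_onD[OF subset_rank_inj _ ftype_in[OF b] ftype_in[OF assms(2)]]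
      subset_rank_less_iff[OF proper_subsetsD(1)[OF ftype_in[OF b]] proper_subsetsD(1)[OF ftype_in[OF assms(2)]]]
    by (auto simp: le_less)
qed

text \<open>Identifies an exponent of the leading monomial of \<open>kprod\<close> with the bound in
  the admissibility condition: earlier positions of the same type contribute nothing, and later
  positions do not precede in \<open>\<prec>\<close>.\<close>

lemma sum_k_num_ftype:
  assumes "a < length (factors n l)"
  shows "(\<Sum>b<a. k_num (ftype n l a) (ftype n l b))
    = (\<Sum>J\<in>{J \<in> proper_subsets n. J \<prec> ftype n l a}. k_num (ftype n l a) J * length (l J))"
proof -
  let ?N = "length (factors n l)"
  let ?g = "\<lambda>J. if J \<prec> ftype n l a then k_num (ftype n l a) J else 0"
  have fin: "finite (ftype n l b)" if "b < ?N" for b using proper_subsetsD(2)[OF ftype_in[OF that]] .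
  have irr: "\<not> I \<prec> I" for I by (simp add: set_prec_def)
  have "(\<Sum>b<a. k_num (ftype n l a) (ftype n l b)) = (\<Sum>b<a. ?g (ftype n l b))"
  proof (intro sum.cong refl)
    fix b assume "b \<in> {..<a}"
    then consider "ftype n l b = ftype n l a" | "ftype n l b \<prec> ftype n l a"
      using ftype_sorted[OF less_imp_le assms] by blast
    then show "k_num (ftype n l a) (ftype n l b) = ?g (ftype n l b)" by cases simp_all
  qed
  also have "\<dots> = (\<Sum>b<?N. ?g (ftype n l b))"
  proof (intro sum.mono_neutral_left ballI)
    fix b assume "b \<in> {..<?N} - {..<a}"
    then have b: "a \<le> b" "b < ?N" by auto
    have "\<not> ftype n l b \<prec> ftype n l a"
      using ftype_sorted[OF b] set_prec_asym[OF fin[OF assms] fin[OF b(2)]] irr by metis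
    then show "?g (ftype n l b) = 0" by simp
  qed (use assms in auto)
  also have "\<dots> = (\<Sum>b<?N. ?g (fst (factors n l ! b)))"
    by (rule sum.cong[OF refl]) (simp add: ftype_nth)
  also have "\<dots> = (\<Sum>J\<in>proper_subsets n. \<Sum>p<length (l J). ?g J)"
    using sum_factors[of "\<lambda>x. ?g (fst x)" n l] by (simp only: fst_conv)
  also have "\<dots> = (\<Sum>J\<in>{J \<in> proper_subsets n. J \<prec> ftype n l a}. k_num (ftype n l a) J * length (l J))"
    unfolding sum.inter_filter[OF finite_proper_subsets] by (intro sum.cong refl) simp
  finally show ?thesis .
qed

lemma sum_k_num_le_expo:
  assumes "l \<in> admissible n" "a < length (factors n l)"
  shows "(\<Sum>b<a. k_num (ftype n l a) (ftype n l b)) \<le> lookup (expo n l) a"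
proof -
  let ?I = "fst (factors n l ! a)" and ?k = "snd (factors n l ! a)"
  have "(?I, ?k) \<in> set (factors n l)" using assms(2) by simp
  then have I: "?I \<in> proper_subsets n" and k: "?k \<in> set (l ?I)" unfolding mem_factors by auto
  have "l ?I \<noteq> []" using k by auto
  then have "(\<Sum>b<a. k_num (ftype n l a) (ftype n l b)) \<le> hd (l ?I)"
    unfolding sum_k_num_ftype[OF assms(2)] using assms I by (simp add: admissible_def ftype_def)
  also have "sorted (l ?I)" using assms(1) I by (simp add: admissible_def)
  then have "hd (l ?I) \<le> ?k" using k by (cases "l ?I") auto
  finally show ?thesis using assms(2) by (simp add: lookup_expo)
qed

definition minor_product :: "(nat set \<Rightarrow> 'a::comm_ring_1 arc_poly fps) \<Rightarrow> nat \<Rightarrow> (nat set \<Rightarrow> nat list) \<Rightarrow> 'a arc_poly" where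
  "minor_product X n l = (\<Prod>I\<in>proper_subsets n. \<Prod>p<length (l I). fps_nth (X I) (l I ! p))"

text \<open>The exponent to be symmetrized is that of \<open>l0\<close> minus the leading exponent
  \<open>K\<close> of \<open>kprod\<close>, so the leading form of the generating function is the
  symmetrized monomial of \<open>l0\<close>. Sorted index lists make an admissible monomial unique
  in its orbit.\<close>

lemma separating_functional:
  fixes X :: "nat set \<Rightarrow> 'a::field_char_0 arc_poly fps"
  assumes rep: "representable X {I. I \<noteq> {} \<and> I \<subseteq> {1..n}} gr" and l0: "l0 \<in> admissible n"
  defines "\<omega> \<equiv> \<lambda>a. int (subset_rank n (ftype n l0 a))"
  obtains L where
    "\<And>l. ftypes n l \<noteq> ftypes n l0 \<Longrightarrow> \<not> gr (ftypes n l) (ftypes n l0) \<Longrightarrow> pair L (minor_product X n l) = 0"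
    "\<And>l. l \<in> admissible n \<Longrightarrow> ftypes n l = ftypes n l0 \<Longrightarrow> mwt \<omega> (expo n l0) \<le> mwt \<omega> (expo n l)
        \<Longrightarrow> pair L (minor_product X n l) = 0 \<longleftrightarrow> l \<noteq> l0"
proof -
  define N where "N = length (factors n l0)"
  define \<tau> where "\<tau> = ftype n l0"
  define K where "K = (\<Sum>a<N. Poly_Mapping.single a (\<Sum>b<a. k_num (\<tau> a) (\<tau> b)))"
  define \<epsilon> where "\<epsilon> = expo n l0 - K"
  have lK: "lookup K a = (if a < N then (\<Sum>b<a. k_num (\<tau> a) (\<tau> b)) else 0)" for a
    by (auto simp: K_def lookup_sum lookup_single when_def)
  \<comment> \<open>Admissibility enters here: subtraction of exponents is truncated, and this bound
    makes it exact in \<open>\<epsilon>\<close>.\<close>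
  have "lookup K a \<le> lookup (expo n l0) a" for a
    using sum_k_num_le_expo[OF l0, of a] by (simp add: lK N_def \<tau>_def)
  then have \<epsilon>K: "\<epsilon> + K = expo n l0"
    by (intro poly_mapping_eqI) (simp add: \<epsilon>_def lookup_add lookup_minus)
  have k\<epsilon>: "keys \<epsilon> \<subseteq> {..<N}"
    using keys_expo[of n l0] by (auto simp: \<epsilon>_def in_keys_iff lookup_minus N_def lookup_expo split: if_splits)
  have \<tau>_in: "\<tau> a \<in> proper_subsets n" if "a < N" for a
    using ftype_in[of a n l0] that by (simp add: \<tau>_def N_def)
  have sorted: "\<tau> b = \<tau> a \<or> \<omega> b < \<omega> a" if "b < a" "a < N" for a b
    using ftype_sorted[of b a n l0] that subset_rank_less_iff[OF proper_subsetsD(1)[OF \<tau>_in[of b]] proper_subsetsD(1)[OF \<tau>_in[of a]]]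
    by (simp add: \<tau>_def N_def \<omega>_def)
  have \<omega>_eq: "\<omega> a = \<omega> b" if "\<tau> a = \<tau> b" for a b using that by (simp add: \<omega>_def \<tau>_def)
  \<comment> \<open>By \<open>sum_k_num_ftype\<close> the exponent of \<open>K\<close> at a position
    depends only on the type there. So symmetrizing \<open>\<epsilon>\<close> and adding
    \<open>K\<close> amounts to symmetrizing \<open>expo n l0\<close>.\<close>
  have K_inv: "act \<sigma> K = K" if "\<sigma> \<in> stab N \<tau>" for \<sigma>
  proof (rule poly_mapping_eqI)
    fix a
    show "lookup (act \<sigma> K) a = lookup K a"
    proof (cases "a < N")
      case True
      have "\<sigma> a < N" "\<tau> (\<sigma> a) = \<tau> a" using stabD(2,3)[OF that True] by auto
      then show ?thesis
        using True sum_k_num_ftype[of a n l0] sum_k_num_ftype[of "\<sigma> a" n l0]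
        by (simp add: lookup_act[OF stabD(1)[OF that]] lK \<tau>_def N_def)
    next
      case False
      then have "\<sigma> a = a" using stabD(1)[OF that] by (simp add: permutes_def)
      then show ?thesis by (simp add: lookup_act[OF stabD(1)[OF that]])
    qed
  qed
  have "\<forall>a<N. \<tau> a \<in> {I. I \<noteq> {} \<and> I \<subseteq> {1..n}}"
    using proper_subsetsD[OF \<tau>_in] by blast
  then obtain L where L: "represents X {I. I \<noteq> {} \<and> I \<subseteq> {1..n}} gr N \<tau> (av N \<tau> \<epsilon>) L"
    using rep k\<epsilon> unfolding representable_def by blast
  show thesis
  proof (rule that)
    fix l assume l: "ftypes n l \<noteq> ftypes n l0" "\<not> gr (ftypes n l) (ftypes n l0)"
    have "\<forall>a<length (factors n l). ftype n l a \<in> {I. I \<noteq> {} \<and> I \<subseteq> {1..n}}"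
      using proper_subsetsD[OF ftype_in[of _ n l]] by blast
    then have "pair L (vals X (length (factors n l)) (ftype n l) (expo n l)) = 0"
      using L l keys_expo[of n l] unfolding represents_def ftypes_def N_def \<tau>_def by blast
    then show "pair L (minor_product X n l) = 0" by (simp only: vals_factors minor_product_def)
  next
    fix l assume l: "l \<in> admissible n" "ftypes n l = ftypes n l0" "mwt \<omega> (expo n l0) \<le> mwt \<omega> (expo n l)"
    have N: "length (factors n l) = N" and t: "ftype n l = \<tau>"
      using ftype_cong[OF l(2)] by (simp_all add: N_def \<tau>_def)
    have kl: "keys (expo n l) \<subseteq> {..<N}" using keys_expo[of n l] N by simp
    have "pair L (minor_product X n l) = pair L (vals X N \<tau> (expo n l))"
      using vals_factors[of X n l] by (simp only: minor_product_def N t)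
    also have "\<dots> = lookup (kprod N \<tau> * av N \<tau> \<epsilon>) (expo n l)"
      using L kl unfolding represents_def by blast
    also have "\<dots> = of_nat (card {\<sigma> \<in> stab N \<tau>. expo n l = act \<sigma> \<epsilon> + K}) * 1"
      unfolding K_def
      by (rule lookup_kprod_av[OF sorted \<omega>_eq k\<epsilon>]) (use \<epsilon>K l(3) in \<open>simp_all add: K_def\<close>)
    finally have p: "pair L (minor_product X n l) = of_nat (card {\<sigma> \<in> stab N \<tau>. expo n l = act \<sigma> \<epsilon> + K})"
      by simp
    have iff: "expo n l = act \<sigma> \<epsilon> + K \<longleftrightarrow> expo n l = act \<sigma> (expo n l0)" if "\<sigma> \<in> stab N \<tau>" for \<sigma>
      using act_add[OF stabD(1)[OF that], of \<epsilon> K] K_inv[OF that] \<epsilon>K by simp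
    have "l = l0" if \<sigma>: "\<sigma> \<in> stab N \<tau>" "expo n l = act \<sigma> (expo n l0)" for \<sigma>
    proof -
      have fac: "mset (factors n l') = tms N (\<lambda>a. (\<tau> a, lookup (expo n l') a))"
        if "length (factors n l') = N" "ftype n l' = \<tau>" for l'
      proof -
        have "mset (factors n l') = tms N (\<lambda>a. factors n l' ! a)"
          using tms_nth[of "factors n l'"] that by simp
        also have "\<dots> = tms N (\<lambda>a. (\<tau> a, lookup (expo n l') a))"
          using that by (intro tms_cong) (auto simp: lookup_expo ftype_nth simp flip: that(2))
        finally show ?thesis .
      qed
      have "tms N (\<lambda>a. (\<tau> a, lookup (expo n l) a)) = tms N (\<lambda>a. (\<tau> (\<sigma> a), lookup (expo n l0) (\<sigma> a)))"
        using stabD(2)[OF \<sigma>(1)] by (intro tms_cong) (simp add: \<sigma>(2) lookup_act[OF stabD(1)[OF \<sigma>(1)]])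
      also have "\<dots> = tms N (\<lambda>a. (\<tau> a, lookup (expo n l0) a))"
        using tms_permute[OF stabD(1)[OF \<sigma>(1)], of "\<lambda>a. (\<tau> a, lookup (expo n l0) a)"] .
      finally have "mset (factors n l) = mset (factors n l0)"
        using fac[OF N t] fac[of l0] by (simp add: N_def \<tau>_def)
      then show ?thesis by (rule factors_eqD[OF l(1) l0])
    qed
    moreover have "expo n l = act id (expo n l0)" if "l = l0" using that by simp
    ultimately have "{\<sigma> \<in> stab N \<tau>. expo n l = act \<sigma> \<epsilon> + K} = {} \<longleftrightarrow> l \<noteq> l0"
      using iff id_stab[of N \<tau>] by blast
    then show "pair L (minor_product X n l) = 0 \<longleftrightarrow> l \<noteq> l0"
      unfolding p of_nat_eq_0_iff by (subst card_0_eq) simp_all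
  qed
qed

text \<open>Among the monomials with nonzero coefficient, take a type with none above it, and of
  this type a monomial of least weight. Its functional kills all the others.\<close>

lemma lead_minor_products_independent:
  fixes c :: "(nat set \<Rightarrow> nat list) \<Rightarrow> 'a::field_char_0"
  assumes fin: "finite \<Lambda>" and \<Lambda>: "\<Lambda> \<subseteq> admissible n"
    and zero: "(\<Sum>l\<in>\<Lambda>. pconst (c l) * minor_product lead_minor n l) = 0"
  shows "\<forall>l\<in>\<Lambda>. c l = 0"
proof (rule ccontr)
  let ?X = "lead_minor :: nat set \<Rightarrow> 'a arc_poly fps"
  assume "\<not> (\<forall>l\<in>\<Lambda>. c l = 0)"
  define A where "A = {l \<in> \<Lambda>. c l \<noteq> 0}"
  have A: "finite A" "A \<noteq> {}" "A \<subseteq> \<Lambda>" using fin \<open>\<not> _\<close> by (auto simp: A_def)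
  obtain gr where gr: "\<And>T. \<not> gr T T" "\<And>T T' T''. gr T T' \<Longrightarrow> gr T' T'' \<Longrightarrow> gr T T''"
      and rep: "representable ?X {I. I \<noteq> {} \<and> I \<subseteq> {1..n}} gr"
    using lead_minor_representable[of n, where 'a = 'a] unfolding order_representable_def by blast
  have "\<exists>T\<in>ftypes n ` A. \<forall>T'\<in>ftypes n ` A. T' \<noteq> T \<longrightarrow> \<not> gr T' T"
  proof (rule Finite_Set.bex_max_element[where R = "\<lambda>T T'. gr T' T"])
    show "asymp_on (ftypes n ` A) (\<lambda>T T'. gr T' T)" by (rule asymp_onI) (metis gr)
    show "transp_on (ftypes n ` A) (\<lambda>T T'. gr T' T)" by (rule transp_onI) (metis gr(2))
  qed (use A in auto)
  then obtain T where T: "T \<in> ftypes n ` A" and max: "\<And>l. l \<in> A \<Longrightarrow> ftypes n l \<noteq> T \<Longrightarrow> \<not> gr (ftypes n l) T"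
    by blast
  define B where "B = {l \<in> A. ftypes n l = T}"
  have B: "finite B" "B \<noteq> {}" using A T by (auto simp: B_def)
  then obtain l1 where l1: "l1 \<in> B" by blast
  \<comment> \<open>The weight depends only on the common type, so any member of \<open>B\<close>
    may define it before \<open>l0\<close> is chosen by means of it.\<close>
  define \<omega> where "\<omega> = (\<lambda>a. int (subset_rank n (ftype n l1 a)))"
  define l0 where "l0 = arg_min_on (\<lambda>l. mwt \<omega> (expo n l)) B"
  have l0: "l0 \<in> B" and min: "\<And>l. l \<in> B \<Longrightarrow> mwt \<omega> (expo n l0) \<le> mwt \<omega> (expo n l)"
    using arg_min_if_finite[OF B, of "\<lambda>l. mwt \<omega> (expo n l)"] unfolding l0_def by (auto simp: not_less)
  have T0: "ftypes n l0 = T" "l0 \<in> admissible n" "c l0 \<noteq> 0" "l0 \<in> \<Lambda>" using l0 A \<Lambda> by (auto simp: B_def A_def)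
  have "ftype n l1 = ftype n l0"
    using ftype_cong(2)[of n l1 l0] l0 l1 by (simp add: B_def)
  then have \<omega>: "\<omega> = (\<lambda>a. int (subset_rank n (ftype n l0 a)))" by (simp add: \<omega>_def)
  obtain L where L: "\<And>l. ftypes n l \<noteq> T \<Longrightarrow> \<not> gr (ftypes n l) T \<Longrightarrow> pair L (minor_product ?X n l) = 0"
      "\<And>l. l \<in> admissible n \<Longrightarrow> ftypes n l = T \<Longrightarrow> mwt \<omega> (expo n l0) \<le> mwt \<omega> (expo n l)
        \<Longrightarrow> pair L (minor_product ?X n l) = 0 \<longleftrightarrow> l \<noteq> l0"
    using separating_functional[OF rep T0(2)] unfolding T0(1) \<omega>[symmetric] by metis
  have z: "c l * pair L (minor_product ?X n l) = 0" if l: "l \<in> \<Lambda>" "l \<noteq> l0" for l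
  proof (cases "l \<in> A")
    case lA: True
    show ?thesis
    proof (cases "ftypes n l = T")
      case True
      then have "l \<in> B" using lA by (simp add: B_def)
      then show ?thesis using L(2)[OF _ True min] l \<Lambda> by auto
    next
      case False
      then show ?thesis using L(1)[OF False max[OF lA False]] by simp
    qed
  qed (use l in \<open>simp add: A_def\<close>)
  have "0 = pair L (\<Sum>l\<in>\<Lambda>. pconst (c l) * minor_product ?X n l)"
    unfolding zero by simp
  also have "\<dots> = (\<Sum>l\<in>\<Lambda>. c l * pair L (minor_product ?X n l))"
    by (simp only: pair_sum pair_const_mult)
  also have "\<dots> = (\<Sum>l\<in>\<Lambda>. if l = l0 then c l * pair L (minor_product ?X n l) else 0)"
    using z by (intro sum.cong refl) simp
  also have "\<dots> = c l0 * pair L (minor_product ?X n l0)"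
    using fin T0(4) by simp
  finally have "pair L (minor_product ?X n l0) = 0" using T0(3) by simp
  then show False using L(2)[OF T0(2,1) order_refl] by simp
qed

section \<open>Leading forms of the minors\<close>

text \<open>If the last index is not fixed, exchanging two values so that it becomes fixed increases
  the sum strictly, by the product of a difference of \<open>x\<close> and a difference of indices.
  Strictness makes the diagonal product the only leading term of a minor.\<close>

lemma rearrangement:
  fixes x :: "nat \<Rightarrow> int"
  assumes "\<And>i j. i < j \<Longrightarrow> j < m \<Longrightarrow> x i < x j" "\<pi> permutes {..<m}"
  shows "(\<Sum>p<m. x p * int (\<pi> p)) \<le> (\<Sum>p<m. x p * int p)"
    and "\<pi> \<noteq> id \<Longrightarrow> (\<Sum>p<m. x p * int (\<pi> p)) < (\<Sum>p<m. x p * int p)"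
proof -
  have "(\<Sum>p<m. x p * int (\<pi> p)) < (\<Sum>p<m. x p * int p) \<or> \<pi> = id"
    using assms
  proof (induction m arbitrary: \<pi>)
    case (Suc m)
    have fixed: "\<sigma> permutes {..<m}" if "\<sigma> permutes {..<Suc m}" "\<sigma> m = m" for \<sigma>
      using that by (intro permutes_superset[OF that(1)]) (auto simp: less_Suc_eq)
    show ?case
    proof (cases "\<pi> m = m")
      case True
      then show ?thesis using Suc.IH[OF _ fixed[OF Suc.prems(2)]] Suc.prems(1) by auto
    next
      case False
      define q where "q = pinv \<pi> m"
      have \<pi>q: "\<pi> q = m" by (simp add: q_def permutes_inverses[OF Suc.prems(2)])
      then have qm: "q < m"
        using False permutes_in_image[OF Suc.prems(2), of q] by (cases "q = m") auto
      have \<pi>m: "\<pi> m < m" using False permutes_in_image[OF Suc.prems(2), of m] by auto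
      define \<sigma> where "\<sigma> = \<pi> \<circ> transpose q m"
      have "transpose q m permutes {..<Suc m}" using qm by (intro permutes_swap_id) auto
      then have "\<sigma> permutes {..<Suc m}" unfolding \<sigma>_def by (rule permutes_compose[OF _ Suc.prems(2)])
      moreover have \<sigma>m: "\<sigma> m = m" by (simp add: \<sigma>_def \<pi>q)
      ultimately have IH: "(\<Sum>p<m. x p * int (\<sigma> p)) \<le> (\<Sum>p<m. x p * int p)"
        using Suc.IH[OF _ fixed] Suc.prems(1) by fastforce
      have q: "q \<in> {..<m}" using qm by simp
      have "(\<Sum>p<m. x p * int (\<pi> p)) = x q * int m + (\<Sum>p\<in>{..<m} - {q}. x p * int (\<pi> p))"
        using sum.remove[OF finite_lessThan q, of "\<lambda>p. x p * int (\<pi> p)"] \<pi>q by simp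
      moreover have "(\<Sum>p<m. x p * int (\<sigma> p)) = x q * int (\<pi> m) + (\<Sum>p\<in>{..<m} - {q}. x p * int (\<sigma> p))"
        using sum.remove[OF finite_lessThan q, of "\<lambda>p. x p * int (\<sigma> p)"] by (simp add: \<sigma>_def)
      moreover have "(\<Sum>p\<in>{..<m} - {q}. x p * int (\<sigma> p)) = (\<Sum>p\<in>{..<m} - {q}. x p * int (\<pi> p))"
        by (intro sum.cong refl) (auto simp: \<sigma>_def transpose_def)
      moreover have "(x m - x q) * (int m - int (\<pi> m)) > 0"
        using Suc.prems(1)[OF qm] \<pi>m by simp
      ultimately show ?thesis using IH by (simp add: algebra_simps)
    qed
  qed simp
  then show "(\<Sum>p<m. x p * int (\<pi> p)) \<le> (\<Sum>p<m. x p * int p)"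
      "\<pi> \<noteq> id \<Longrightarrow> (\<Sum>p<m. x p * int (\<pi> p)) < (\<Sum>p<m. x p * int p)"
    by auto
qed

definition homogeneous :: "('v \<Rightarrow> int) \<Rightarrow> int \<Rightarrow> (('v \<Rightarrow>\<^sub>0 nat) \<Rightarrow>\<^sub>0 'c::comm_ring_1) fps \<Rightarrow> bool" where
  "homogeneous \<omega> w F \<longleftrightarrow> (\<forall>k. \<forall>m\<in>keys (fps_nth F k). mwt \<omega> m = w)"

lemma keys_sumE:
  assumes "m \<in> keys (\<Sum>i\<in>A. f i)"
  obtains i where "i \<in> A" "m \<in> keys (f i)"
  using Poly_Mapping.keys_sum[of f A] assms by blast

lemma homogeneous_zero: "homogeneous \<omega> w 0"
  by (simp add: homogeneous_def)

lemma homogeneous_mult: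
  assumes "homogeneous \<omega> w F" "homogeneous \<omega> w' G"
  shows "homogeneous \<omega> (w + w') (F * G)"
  unfolding homogeneous_def fps_mult_nth
proof (intro allI ballI)
  fix k m assume "m \<in> keys (\<Sum>i=0..k. fps_nth F i * fps_nth G (k - i))"
  then obtain i where "m \<in> keys (fps_nth F i * fps_nth G (k - i))" by (rule keys_sumE)
  then show "mwt \<omega> m = w + w'"
    using assms unfolding homogeneous_def
    by (intro keys_mult_mwt[where P = "\<lambda>a. a = w" and Q = "\<lambda>a. a = w'" and R = "\<lambda>a. a = w + w'"]) auto
qed

lemma homogeneous_prod:
  "(\<And>i. i \<in> A \<Longrightarrow> homogeneous \<omega> (w i) (F i)) \<Longrightarrow> homogeneous \<omega> (\<Sum>i\<in>A. w i) (\<Prod>i\<in>A. F i)"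
proof (induction A rule: infinite_finite_induct)
  case (insert x A)
  then show ?case by (auto intro: homogeneous_mult)
qed (auto simp: homogeneous_def fps_one_nth)

lemma homogeneous_signof:
  "homogeneous \<omega> w F \<Longrightarrow> homogeneous \<omega> w (signof \<pi> * F)"
  by (cases \<pi> rule: sign_cases) (auto simp: homogeneous_def)

definition low_entry :: "nat \<Rightarrow> nat \<Rightarrow> 'a::comm_ring_1 arc_poly fps" where
  "low_entry i j = (if i < j then 0 else arc_entry i j)"

definition low_minor :: "nat set \<Rightarrow> 'a::comm_ring_1 arc_poly fps" where
  "low_minor I = det (mat (card I) (card I) (\<lambda>(p, q). low_entry (sls I ! p) (q + 1)))"

abbreviation entry_weight :: "nat \<times> nat \<times> nat \<Rightarrow> int" where
  "entry_weight \<equiv> \<lambda>(i, j, k). int i * int j"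

definition minor_weight :: "nat set \<Rightarrow> int" where
  "minor_weight I = (\<Sum>p<card I. int (sls I ! p) * int (Suc p))"

lemma homogeneous_arc_entry: "homogeneous entry_weight (int i * int j) (arc_entry i j)"
  by (simp add: homogeneous_def arc_entry_def arc_var_def)

lemma homogeneous_low_entry: "homogeneous entry_weight (int i * int j) (low_entry i j)"
  by (simp add: low_entry_def homogeneous_zero homogeneous_arc_entry)

text \<open>So the entries \<open>(i_p, p)\<close> lie on or below the diagonal and survive in a
  lower triangular matrix.\<close>

lemma sls_ge:
  assumes "finite I" "0 \<notin> I" "p < card I"
  shows "Suc p \<le> sls I ! p"
  using assms(3)
proof (induction p)
  case 0
  then show ?case using sls_nth_mem[OF assms(1) 0] assms(2) by (metis Suc_leI gr0I)
next
  case (Suc p)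
  then show ?case using sls_nth_less[of p "Suc p" I] by simp
qed

text \<open>Every term of the Leibniz formula is homogeneous, or zero if it meets an entry above the
  diagonal, and by the strict rearrangement inequality the identity permutation alone attains the
  largest weight.\<close>

lemma top_form_low_minor:
  assumes "finite I" "0 \<notin> I"
  shows "top_form entry_weight (minor_weight I) (fps_nth (low_minor I) k) (fps_nth (lead_minor I :: 'a::comm_ring_1 arc_poly fps) k)"
proof -
  let ?m = "card I"
  let ?P = "{\<pi>. \<pi> permutes {..<?m}}"
  let ?t = "\<lambda>\<pi>. signof \<pi> * (\<Prod>p<?m. low_entry (sls I ! p) (Suc (\<pi> p)) :: 'a arc_poly fps)"
  have "low_minor I = (\<Sum>\<pi>\<in>?P. signof \<pi> * (\<Prod>p = 0..<?m. mat ?m ?m (\<lambda>(p, q). low_entry (sls I ! p) (q + 1)) $$ (p, \<pi> p)))"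
    unfolding low_minor_def by (subst det_def'[of _ ?m]) (simp_all add: atLeast0LessThan)
  also have "\<dots> = (\<Sum>\<pi>\<in>?P. ?t \<pi>)"
  proof (rule sum.cong[OF refl])
    fix \<pi> assume "\<pi> \<in> ?P"
    then have "\<pi> p < ?m" if "p < ?m" for p using permutes_in_image[of \<pi> "{..<?m}" p] that by simp
    then have "(\<Prod>p = 0..<?m. mat ?m ?m (\<lambda>(p, q). low_entry (sls I ! p) (q + 1)) $$ (p, \<pi> p))
        = (\<Prod>p<?m. low_entry (sls I ! p) (Suc (\<pi> p)) :: 'a arc_poly fps)"
      unfolding atLeast0LessThan by (intro prod.cong refl) simp
    then show "signof \<pi> * (\<Prod>p = 0..<?m. mat ?m ?m (\<lambda>(p, q). low_entry (sls I ! p) (q + 1)) $$ (p, \<pi> p)) = ?t \<pi>"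
      by simp
  qed
  also have "\<dots> = ?t id + (\<Sum>\<pi>\<in>?P - {id}. ?t \<pi>)"
    by (intro sum.remove) (simp_all add: finite_permutations permutes_id)
  also have "?t id = lead_minor I"
  proof -
    have "low_entry (sls I ! p) (Suc p) = (arc_entry (sls I ! p) (Suc p) :: 'a arc_poly fps)" if "p < ?m" for p
      using sls_ge[OF assms that] by (simp add: low_entry_def)
    then show ?thesis by (simp add: lead_minor_def)
  qed
  finally have "low_minor I = lead_minor I + (\<Sum>\<pi>\<in>?P - {id}. ?t \<pi>)" .
  then have eq: "low_minor I - lead_minor I = (\<Sum>\<pi>\<in>?P - {id}. ?t \<pi>)"
    by (simp only: add_diff_cancel_left')
  have "mwt entry_weight m < minor_weight I" if m: "m \<in> keys (fps_nth (low_minor I - lead_minor I :: 'a arc_poly fps) k)" for m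
  proof -
    from m obtain \<pi> where \<pi>: "\<pi> \<in> ?P - {id}" "m \<in> keys (fps_nth (?t \<pi>) k)"
      unfolding eq fps_sum_nth by (rule keys_sumE)
    have "homogeneous entry_weight (\<Sum>p<?m. int (sls I ! p) * int (Suc (\<pi> p))) (?t \<pi>)"
      by (intro homogeneous_signof homogeneous_prod homogeneous_low_entry)
    then have "mwt entry_weight m = (\<Sum>p<?m. int (sls I ! p) * int (Suc (\<pi> p)))"
      using \<pi>(2) unfolding homogeneous_def by blast
    moreover have "(\<Sum>p<?m. int (sls I ! p) * int (\<pi> p)) < (\<Sum>p<?m. int (sls I ! p) * int p)"
      using \<pi>(1) sls_nth_less[of _ _ I] by (intro rearrangement(2)) auto
    ultimately show ?thesis
      by (simp add: minor_weight_def algebra_simps sum.distrib)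
  qed
  moreover have "homogeneous entry_weight (minor_weight I) (lead_minor I :: 'a arc_poly fps)"
    unfolding minor_weight_def lead_minor_def by (intro homogeneous_prod homogeneous_arc_entry)
  ultimately show ?thesis
    by (simp add: top_form_def homogeneous_def)
qed

text \<open>In a nontrivial relation the members of largest weight with nonzero coefficient give a
  relation among their leading forms. This is why \<open>indep\<close> ranges over
  subfamilies.\<close>

lemma independent_if_top_forms_independent:
  fixes P V :: "'i \<Rightarrow> ('v \<Rightarrow>\<^sub>0 nat) \<Rightarrow>\<^sub>0 'c::comm_ring_1"
  assumes top: "\<And>i. i \<in> A \<Longrightarrow> top_form \<omega> (w i) (P i) (V i)" and fin: "finite A"
    and indep: "\<And>B. B \<subseteq> A \<Longrightarrow> (\<Sum>i\<in>B. pconst (c i) * V i) = 0 \<Longrightarrow> \<forall>i\<in>B. c i = 0"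
    and zero: "(\<Sum>i\<in>A. pconst (c i) * P i) = 0"
  shows "\<forall>i\<in>A. c i = 0"
proof (rule ccontr)
  assume "\<not> (\<forall>i\<in>A. c i = 0)"
  define A' where "A' = {i \<in> A. c i \<noteq> 0}"
  define W where "W = Max (w ` A')"
  define B where "B = {i \<in> A'. w i = W}"
  have A': "finite A'" "A' \<noteq> {}" using fin \<open>\<not> _\<close> by (auto simp: A'_def)
  have "W \<in> w ` A'" unfolding W_def using A' by (intro Max_in) auto
  then obtain b where b: "b \<in> B" by (auto simp: B_def)
  have le: "w i \<le> W" if "i \<in> A'" for i
    unfolding W_def using A' that by simp
  have V: "lookup (V i) m = 0" if "i \<in> A" "mwt \<omega> m \<noteq> w i" for i m
    using top[OF that(1)] that(2) unfolding top_form_def by (meson in_keys_iff)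
  have PV: "lookup (P i) m = lookup (V i) m" if "i \<in> A" "w i \<le> mwt \<omega> m" for i m
  proof -
    have "m \<notin> keys (P i - V i)" using top[OF that(1)] that(2) unfolding top_form_def by force
    then show ?thesis unfolding in_keys_iff lookup_minus by simp
  qed
  have "(\<Sum>i\<in>B. pconst (c i) * V i) = 0"
  proof (rule poly_mapping_eqI)
    fix m
    have "(\<Sum>i\<in>B. c i * lookup (V i) m) = 0"
    proof (cases "mwt \<omega> m = W")
      case True
      have "(\<Sum>i\<in>B. c i * lookup (V i) m) = (\<Sum>i\<in>A. c i * lookup (P i) m)"
      proof (rule sum.mono_neutral_cong_left)
        show "\<forall>i\<in>A - B. c i * lookup (P i) m = 0"
        proof
          fix i assume i: "i \<in> A - B"
          show "c i * lookup (P i) m = 0"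
          proof (cases "c i = 0")
            case False
            then have "i \<in> A'" using i by (simp add: A'_def)
            moreover from this have "w i \<noteq> W" using i by (simp add: B_def)
            ultimately have "w i < mwt \<omega> m" using le[of i] True by simp
            then show ?thesis using PV[of i m] V[of i m] i by simp
          qed simp
        qed
        show "c i * lookup (V i) m = c i * lookup (P i) m" if "i \<in> B" for i
          using PV[of i m] that True by (simp add: B_def A'_def)
      qed (use fin in \<open>auto simp: B_def A'_def\<close>)
      also have "\<dots> = lookup (\<Sum>i\<in>A. pconst (c i) * P i) m"
        by (simp add: lookup_sum lookup_const_mult)
      finally show ?thesis unfolding zero by simp
    next
      case False
      then show ?thesis using V[of _ m] by (intro sum.neutral) (auto simp: B_def A'_def)
    qed
    then show "lookup (\<Sum>i\<in>B. pconst (c i) * V i) m = lookup 0 m"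
      by (simp add: lookup_sum lookup_const_mult)
  qed
  moreover have "B \<subseteq> A" unfolding B_def A'_def by blast
  ultimately have "c b = 0" using indep b by blast
  moreover have "c b \<noteq> 0" using b unfolding B_def A'_def by blast
  ultimately show False by contradiction
qed

lemma low_minor_products_independent:
  fixes c :: "(nat set \<Rightarrow> nat list) \<Rightarrow> 'a::field_char_0"
  assumes "finite \<Lambda>" "\<Lambda> \<subseteq> admissible n"
    and "(\<Sum>l\<in>\<Lambda>. pconst (c l) * minor_product low_minor n l) = 0"
  shows "\<forall>l\<in>\<Lambda>. c l = 0"
proof (rule independent_if_top_forms_independent)
  show "top_form entry_weight (\<Sum>I\<in>proper_subsets n. \<Sum>p<length (l I). minor_weight I)
      (minor_product low_minor n l) (minor_product lead_minor n l :: 'a arc_poly)" for l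
    unfolding minor_product_def
  proof (rule top_form_prod, rule top_form_prod)
    fix I p assume "I \<in> proper_subsets n"
    then show "top_form entry_weight (minor_weight I) (fps_nth (low_minor I) (l I ! p))
        (fps_nth (lead_minor I :: 'a arc_poly fps) (l I ! p))"
      using proper_subsetsD[of I n] by (intro top_form_low_minor) auto
  qed
next
  fix B assume B: "B \<subseteq> \<Lambda>" "(\<Sum>l\<in>B. pconst (c l) * minor_product lead_minor n l) = 0"
  show "\<forall>l\<in>B. c l = 0"
    by (rule lead_minor_products_independent[OF _ _ B(2)])
      (use B(1) assms(1,2) finite_subset in auto)
qed (use assms in auto)

section \<open>Specialization to lower triangular matrices\<close>

definition map_coeffs :: "('b::comm_ring_1 \<Rightarrow> 'c::comm_ring_1) \<Rightarrow> 'b fps \<Rightarrow> 'c fps" where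
  "map_coeffs h F = Abs_fps (\<lambda>k. h (fps_nth F k))"

lemma comm_ring_hom_map_coeffs:
  assumes "comm_ring_hom h"
  shows "comm_ring_hom (map_coeffs h)"
proof -
  interpret comm_ring_hom h by fact
  show ?thesis
    by unfold_locales (simp_all add: map_coeffs_def fps_eq_iff fps_mult_nth hom_sum hom_mult hom_add fps_one_nth)
qed

lemma det_map_coeffs:
  assumes "comm_ring_hom h"
  shows "map_coeffs h (det (mat m m f)) = det (mat m m (\<lambda>ij. map_coeffs h (f ij)))"
proof -
  interpret H: comm_ring_hom "map_coeffs h" by (rule comm_ring_hom_map_coeffs[OF assms])
  have "map_mat (map_coeffs h) (mat m m f) = mat m m (\<lambda>ij. map_coeffs h (f ij))"
    by (intro eq_matI) auto
  then show ?thesis using H.hom_det[of "mat m m f"] by simp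
qed

abbreviation fract_of :: "'b::idom \<Rightarrow> 'b fract" where
  "fract_of p \<equiv> Fract p 1"

lemma comm_ring_hom_fract_of: "comm_ring_hom fract_of"
  by unfold_locales (simp_all add: One_fract_def Zero_fract_def)

lemma fract_of_eq_0: "fract_of p = 0 \<longleftrightarrow> p = 0"
  by (simp add: Zero_fract_def eq_fract)

text \<open>
  The generic lower triangular matrix of determinant one: its last diagonal entry is the inverse
  power series of the product of the others, which exists over the field of fractions.
\<close>

definition triangular_entry :: "nat \<Rightarrow> nat \<Rightarrow> nat \<Rightarrow> ('a::field arc_poly) fract fps" where
  "triangular_entry n i j =
    (if i = n \<and> j = n then inverse (\<Prod>q\<in>{1..<n}. map_coeffs fract_of (arc_entry q q))
     else map_coeffs fract_of (low_entry i j))"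

definition specialize :: "nat \<Rightarrow> 'a::field arc_poly \<Rightarrow> 'a arc_poly fract" where
  "specialize n = ins (\<lambda>c. fract_of (pconst c)) (\<lambda>(i, j, k). fps_nth (triangular_entry n i j) k)"

lemma comm_ring_hom_fract_const: "comm_ring_hom (\<lambda>c::'a::field. fract_of (pconst c :: 'a arc_poly))"
  by unfold_locales (simp_all add: One_fract_def Zero_fract_def single_add mult_single)

lemma comm_ring_hom_specialize: "comm_ring_hom (specialize n :: 'a::field arc_poly \<Rightarrow> _)"
  unfolding specialize_def by (rule comm_ring_hom.ins_hom[OF comm_ring_hom_fract_const])

lemma specialize_const: "specialize n (pconst c) = fract_of (pconst c)"
  unfolding specialize_def by (subst comm_ring_hom.ins_single[OF comm_ring_hom_fract_const]) simp

lemma specialize_entry: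
  "map_coeffs (specialize n) (arc_entry i j) = (triangular_entry n i j :: ('a::field arc_poly) fract fps)"
proof -
  have "specialize n (arc_var i j k) = fps_nth (triangular_entry n i j :: ('a arc_poly) fract fps) k" for k
    unfolding specialize_def arc_var_def
    by (subst comm_ring_hom.ins_single[OF comm_ring_hom_fract_const]) (simp add: One_fract_def)
  then show ?thesis by (simp add: map_coeffs_def arc_entry_def fps_eq_iff)
qed

text \<open>The last diagonal entry inverts the product of the others. The inverse series exists
  because the constant coefficient of that product is a product of variables, hence nonzero in the
  fraction field.\<close>

lemma specialize_det:
  assumes "n \<ge> 1"
  shows "map_coeffs (specialize n) (det (mat n n (\<lambda>(p, q). arc_entry (p + 1) (q + 1))))
    = (1 :: ('a::field arc_poly) fract fps)"
proof -
  let ?A = "mat n n (\<lambda>(p, q). triangular_entry n (p + 1) (q + 1) :: ('a arc_poly) fract fps)"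
  let ?P = "\<Prod>q\<in>{1..<n}. map_coeffs fract_of (arc_entry q q :: 'a arc_poly fps)"
  have zero: "map_coeffs fract_of (0 :: 'a arc_poly fps) = 0"
    by (simp add: map_coeffs_def fps_eq_iff Zero_fract_def)
  have "map_coeffs (specialize n) (det (mat n n (\<lambda>(p, q). arc_entry (p + 1) (q + 1)))) = det ?A"
    unfolding det_map_coeffs[OF comm_ring_hom_specialize]
    by (intro arg_cong[where f = det] cong_mat) (auto simp: specialize_entry)
  also have "\<dots> = prod_list (diag_mat ?A)"
    by (rule det_lower_triangular[of n]) (auto simp: triangular_entry_def low_entry_def zero)
  also have "\<dots> = (\<Prod>p = 0..<n. triangular_entry n (p + 1) (p + 1))"
    unfolding prod_list_diag_prod by (intro prod.cong) auto
  also have "\<dots> = (\<Prod>q\<in>{1..<Suc n}. triangular_entry n q q)"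
    by (rule prod.reindex_bij_witness[of _ "\<lambda>q. q - 1" Suc]) auto
  also have "\<dots> = triangular_entry n n n * (\<Prod>q\<in>{1..<n}. triangular_entry n q q)"
    using assms by (simp add: atLeastLessThanSuc)
  also have "(\<Prod>q\<in>{1..<n}. triangular_entry n q q) = ?P"
    by (intro prod.cong refl) (auto simp: triangular_entry_def low_entry_def)
  also have "triangular_entry n n n = inverse ?P" by (simp add: triangular_entry_def)
  also have "inverse ?P * ?P = 1"
  proof (rule inverse_mult_eq_1)
    have nth_0: "fps_nth (prod F B) 0 = (\<Prod>q\<in>B. fps_nth (F q) 0)"
      for F :: "nat \<Rightarrow> 'a arc_poly fract fps" and B
      by (induction B rule: infinite_finite_induct) simp_all
    have "fps_nth ?P 0 = (\<Prod>q\<in>{1..<n}. fract_of (arc_var q q 0 :: 'a arc_poly))"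
      by (simp add: nth_0 map_coeffs_def arc_entry_def)
    moreover have "arc_var q q 0 \<noteq> (0 :: 'a arc_poly)" for q
    proof -
      have "keys (arc_var q q 0 :: 'a arc_poly) \<noteq> {}" by (simp add: arc_var_def)
      then show ?thesis by auto
    qed
    ultimately show "fps_nth ?P 0 \<noteq> 0"
      by (simp only: prod_zero_iff finite_atLeastLessThan fract_of_eq_0) blast
  qed
  finally show ?thesis .
qed

text \<open>A proper subset has fewer than \<open>n\<close> elements, so its columns stop before the
  exceptional entry \<open>(n, n)\<close>, and the image is a polynomial.\<close>

lemma specialize_minor:
  assumes "I \<in> proper_subsets n"
  shows "specialize n (fps_nth (arc_minor I) k) = fract_of (fps_nth (low_minor I :: 'a::field arc_poly fps) k)"
proof -
  have "card I < card {1..n}"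
    using assms by (intro psubset_card_mono) (auto simp: proper_subsets_def)
  then have card: "card I < n" by simp
  have "map_coeffs (specialize n) (arc_minor I) = map_coeffs fract_of (low_minor I :: 'a arc_poly fps)"
    unfolding arc_minor_def low_minor_def det_map_coeffs[OF comm_ring_hom_specialize]
      det_map_coeffs[OF comm_ring_hom_fract_of]
    using card by (intro arg_cong[where f = det] cong_mat) (auto simp: specialize_entry triangular_entry_def)
  from arg_cong[OF this, of "\<lambda>F. fps_nth F k"] show ?thesis by (simp add: map_coeffs_def)
qed

text \<open>The kernel of \<open>specialize n\<close> inside the carrier is an ideal, and it
  contains the relations by \<open>specialize_det\<close>.\<close>

lemma specialize_sl_ideal:
  assumes "n \<ge> 1" "p \<in> sl_ideal n"
  shows "specialize n (p :: 'a::field arc_poly) = 0"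
proof -
  let ?R = "arc_poly_ring n :: 'a arc_poly ring"
  interpret h: comm_ring_hom "specialize n :: 'a arc_poly \<Rightarrow> _" by (rule comm_ring_hom_specialize)
  interpret R: cring ?R by (rule cring_arc_poly_ring)
  let ?J = "{p \<in> carrier ?R. specialize n p = 0}"
  have sel: "mult ?R = (*)" "zero ?R = 0" "add ?R = (+)"
    by (simp_all add: arc_poly_ring_def)
  have "ideal ?J ?R"
  proof (rule idealI[OF R.ring_axioms])
    show "subgroup ?J (add_monoid ?R)"
    proof (rule R.add.subgroupI)
      show "\<ominus>\<^bsub>?R\<^esub> p \<in> ?J" if "p \<in> ?J" for p
      proof -
        have "- p + p = 0" by simp
        then have "\<ominus>\<^bsub>?R\<^esub> p = - p"
          using R.minus_equality[of "- p" p] arc_poly_ring_closed(3)[of p n] that by (simp add: sel)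
        then show ?thesis using that arc_poly_ring_closed(3)[of p n] by (simp add: h.hom_uminus)
      qed
    qed (auto simp: sel h.hom_add arc_poly_ring_closed intro!: exI[of _ 0])
  qed (auto simp: sel h.hom_mult arc_poly_ring_closed)
  moreover have "sl_relations n \<subseteq> ?J"
  proof
    fix r assume r: "r \<in> (sl_relations n :: 'a arc_poly set)"
    then obtain k where k: "r = fps_nth (det (mat n n (\<lambda>(p, q). arc_entry (p + 1) (q + 1))) - 1) k"
      by (auto simp: sl_relations_def)
    interpret H: comm_ring_hom "map_coeffs (specialize n :: 'a arc_poly \<Rightarrow> _)"
      by (rule comm_ring_hom_map_coeffs[OF comm_ring_hom_specialize])
    have "map_coeffs (specialize n) (det (mat n n (\<lambda>(p, q). arc_entry (p + 1) (q + 1))) - 1 :: 'a arc_poly fps) = 0"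
      by (simp only: H.hom_minus specialize_det[OF assms(1)] H.hom_one diff_self)
    from arg_cong[OF this, of "\<lambda>F. fps_nth F k"] have "specialize n r = 0"
      unfolding k map_coeffs_def by simp
    then show "r \<in> ?J" using r sl_relations_closed by blast
  qed
  ultimately have "sl_ideal n \<subseteq> ?J"
    unfolding sl_ideal_def by (rule R.genideal_minimal)
  then show ?thesis using assms(2) by blast
qed

text \<open>Any representative will do, because elements of the ideal are sent to zero.\<close>

definition specialize_class :: "nat \<Rightarrow> 'a::field arc_poly set \<Rightarrow> 'a arc_poly fract" where
  "specialize_class n A = specialize n (SOME p. p \<in> A)"

lemma specialize_class:
  fixes p :: "'a::field arc_poly"
  assumes "n \<ge> 1"
  shows "specialize_class n (sl_class n p) = specialize n p"
proof -
  interpret h: comm_ring_hom "specialize n :: 'a arc_poly \<Rightarrow> _" by (rule comm_ring_hom_specialize)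
  have cls: "sl_class n p = {i + p | i. i \<in> sl_ideal n}"
    by (auto simp: sl_class_def a_r_coset_def' arc_poly_ring_def)
  have "0 \<in> (sl_ideal n :: 'a arc_poly set)"
    using additive_subgroup.zero_closed[OF ideal.axioms(1)[OF ideal_sl_ideal[of n, where 'a = 'a]]]
    by (simp add: arc_poly_ring_def)
  then have "p \<in> sl_class n p" unfolding cls by force
  then have "(SOME q. q \<in> sl_class n p) \<in> sl_class n p" by (rule someI)
  then obtain i where "i \<in> sl_ideal n" "(SOME q. q \<in> sl_class n p) = i + p" unfolding cls by auto
  then show ?thesis
    using specialize_sl_ideal[OF assms] by (simp add: specialize_class_def h.hom_add)
qed

lemma sl_class_hom:
  fixes p q :: "'a::comm_ring_1 arc_poly"
  assumes "p \<in> carrier (arc_poly_ring n)" "q \<in> carrier (arc_poly_ring n)"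
  shows "sl_class n p \<oplus>\<^bsub>sl_arc_ring n\<^esub> sl_class n q = sl_class n (p + q)"
    and "sl_class n p \<otimes>\<^bsub>sl_arc_ring n\<^esub> sl_class n q = sl_class n (p * q)"
    and "\<one>\<^bsub>sl_arc_ring n\<^esub> = sl_class n (1 :: 'a arc_poly)"
    and "\<zero>\<^bsub>sl_arc_ring n\<^esub> = sl_class n (0 :: 'a arc_poly)"
proof -
  interpret ring_hom_ring "arc_poly_ring n :: 'a arc_poly ring" "sl_arc_ring n" "sl_class n"
    using ideal.rcos_ring_hom_ring[OF ideal_sl_ideal[of n, where 'a = 'a]]
    unfolding sl_arc_ring_def sl_class_def[abs_def] .
  have sel: "mult (arc_poly_ring n :: 'a arc_poly ring) = (*)" "one (arc_poly_ring n :: 'a arc_poly ring) = 1"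
      "zero (arc_poly_ring n :: 'a arc_poly ring) = 0" "add (arc_poly_ring n :: 'a arc_poly ring) = (+)"
    by (simp_all add: arc_poly_ring_def)
  show "sl_class n p \<oplus>\<^bsub>sl_arc_ring n\<^esub> sl_class n q = sl_class n (p + q)"
    using hom_add[OF assms] by (simp add: sel)
  show "sl_class n p \<otimes>\<^bsub>sl_arc_ring n\<^esub> sl_class n q = sl_class n (p * q)"
    using hom_mult[OF assms] by (simp add: sel)
  show "\<one>\<^bsub>sl_arc_ring n\<^esub> = sl_class n (1 :: 'a arc_poly)" using hom_one by (simp add: sel)
  show "\<zero>\<^bsub>sl_arc_ring n\<^esub> = sl_class n (0 :: 'a arc_poly)" using hom_zero by (simp add: sel)
qed

lemma sl_class_cases:
  assumes "A \<in> carrier (sl_arc_ring n :: 'a::comm_ring_1 arc_poly set ring)"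
  obtains p where "p \<in> carrier (arc_poly_ring n)" "A = sl_class n p"
  using assms that unfolding sl_arc_ring_def sl_class_def FactRing_def A_RCOSETS_def' by auto

lemma specialize_class_hom:
  fixes A B :: "'a::field arc_poly set"
  assumes n: "n \<ge> 1" and A: "A \<in> carrier (sl_arc_ring n)" and B: "B \<in> carrier (sl_arc_ring n)"
  shows "specialize_class n (A \<oplus>\<^bsub>sl_arc_ring n\<^esub> B) = specialize_class n A + specialize_class n B"
    and "specialize_class n (A \<otimes>\<^bsub>sl_arc_ring n\<^esub> B) = specialize_class n A * specialize_class n B"
proof -
  interpret h: comm_ring_hom "specialize n :: 'a arc_poly \<Rightarrow> _" by (rule comm_ring_hom_specialize)
  obtain p where p: "p \<in> carrier (arc_poly_ring n)" "A = sl_class n p" using A by (rule sl_class_cases)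
  obtain q where q: "q \<in> carrier (arc_poly_ring n)" "B = sl_class n q" using B by (rule sl_class_cases)
  show "specialize_class n (A \<oplus>\<^bsub>sl_arc_ring n\<^esub> B) = specialize_class n A + specialize_class n B"
    "specialize_class n (A \<otimes>\<^bsub>sl_arc_ring n\<^esub> B) = specialize_class n A * specialize_class n B"
    unfolding p(2) q(2) sl_class_hom[OF p(1) q(1)] specialize_class[OF n] by (simp_all add: h.hom_add h.hom_mult)
qed

section \<open>Transfer of products and independence from a carrier to a ring type\<close>

lemma (in comm_monoid) finprod_image:
  fixes \<phi> :: "'a \<Rightarrow> 'c::comm_monoid_mult"
  assumes \<phi>: "\<phi> \<one> = 1" "\<And>x y. x \<in> carrier G \<Longrightarrow> y \<in> carrier G \<Longrightarrow> \<phi> (x \<otimes> y) = \<phi> x * \<phi> y"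
    and f: "finite A" "f \<in> A \<rightarrow> carrier G"
  shows "\<phi> (finprod G f A) = (\<Prod>i\<in>A. \<phi> (f i))"
  using f by (induction A rule: finite_induct) (auto simp: \<phi> Pi_iff)

lemma (in comm_monoid) finprod_mem:
  assumes H: "\<one> \<in> H" "\<And>x y. x \<in> H \<Longrightarrow> y \<in> H \<Longrightarrow> x \<otimes> y \<in> H" "H \<subseteq> carrier G"
    and f: "finite A" "f \<in> A \<rightarrow> H"
  shows "finprod G f A \<in> H"
  using f
proof (induction A rule: finite_induct)
  case (insert x A)
  then have "f \<in> A \<rightarrow> carrier G" "f x \<in> carrier G" using H(3) by auto
  then show ?case using insert H(2) by simp
qed (use H in simp)

text \<open>Reduces independence over a subset of a carrier to the vanishing of coefficients in an
  ordinary commutative ring: elements of a span are mapped to linear combinations of the images.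
  Coefficients are indexed by all of \<open>is\<close> and set to zero off the sublist, so that the
  same sum serves every step of the induction.\<close>

lemma (in ring) independent_if_image_independent:
  fixes \<phi> :: "'a \<Rightarrow> 'c::comm_ring_1" and \<kappa> :: "'k::comm_ring_1 \<Rightarrow> 'c"
  assumes \<phi>: "\<phi> \<zero> = 0" "\<And>x y. x \<in> carrier R \<Longrightarrow> y \<in> carrier R \<Longrightarrow> \<phi> (x \<oplus> y) = \<phi> x + \<phi> y"
      "\<And>x y. x \<in> carrier R \<Longrightarrow> y \<in> carrier R \<Longrightarrow> \<phi> (x \<otimes> y) = \<phi> x * \<phi> y"
    and \<kappa>: "comm_ring_hom \<kappa>"
    and K: "K \<subseteq> carrier R" "\<And>k. k \<in> K \<Longrightarrow> \<exists>c. \<phi> k = \<kappa> c"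
    and f: "\<And>i. i \<in> set is \<Longrightarrow> f i \<in> carrier R"
    and indep: "\<And>c. (\<Sum>i\<in>set is. \<kappa> (c i) * \<phi> (f i)) = 0 \<Longrightarrow> \<forall>i\<in>set is. c i = 0"
    and dist: "distinct is"
  shows "independent K (map f is)"
proof -
  interpret \<kappa>: comm_ring_hom \<kappa> by (rule \<kappa>)
  have Span: "x \<in> carrier R \<and> (\<exists>c. (\<forall>i. i \<notin> set js \<longrightarrow> c i = 0) \<and> \<phi> x = (\<Sum>i\<in>set is. \<kappa> (c i) * \<phi> (f i)))"
    if "set js \<subseteq> set is" "distinct js" "x \<in> Span K (map f js)" for js x
    using that
  proof (induction js arbitrary: x)
    case Nil
    then show ?case by (auto simp: \<phi>(1) intro!: exI[of _ "\<lambda>_. 0"])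
  next
    case (Cons j js)
    then obtain k y where y: "k \<in> K" "y \<in> Span K (map f js)" "x = k \<otimes> f j \<oplus> y"
      by (auto simp: line_extension_def set_add_def' r_coset_def)
    obtain c where c: "y \<in> carrier R" "\<And>i. i \<notin> set js \<Longrightarrow> c i = 0" "\<phi> y = (\<Sum>i\<in>set is. \<kappa> (c i) * \<phi> (f i))"
      using Cons.IH[OF _ _ y(2)] Cons.prems by auto
    obtain d where d: "\<phi> k = \<kappa> d" using K(2)[OF y(1)] by blast
    have k: "k \<in> carrier R" and j: "j \<in> set is" "f j \<in> carrier R" using y(1) K(1) f[of j] Cons.prems by auto
    have "\<phi> x = \<kappa> d * \<phi> (f j) + (\<Sum>i\<in>set is. \<kappa> (c i) * \<phi> (f i))"
      unfolding y(3) using k j c(1) by (simp add: \<phi> c(3) d)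
    also have "(\<Sum>i\<in>set is. \<kappa> (c i) * \<phi> (f i)) = (\<Sum>i\<in>set is - {j}. \<kappa> (c i) * \<phi> (f i))"
      using c(2)[of j] Cons.prems j(1) by (simp add: sum.remove[of "set is" j])
    also have "\<dots> = (\<Sum>i\<in>set is - {j}. \<kappa> ((c(j := d)) i) * \<phi> (f i))"
      by (intro sum.cong refl) simp
    also have "\<kappa> d * \<phi> (f j) + \<dots> = (\<Sum>i\<in>set is. \<kappa> ((c(j := d)) i) * \<phi> (f i))"
      using j(1) by (simp add: sum.remove[of "set is" j])
    finally have "\<phi> x = (\<Sum>i\<in>set is. \<kappa> ((c(j := d)) i) * \<phi> (f i))" .
    moreover have "x \<in> carrier R" unfolding y(3) using k j c(1) by simp
    ultimately show ?case using c(2) by (intro conjI exI[of _ "c(j := d)"]) auto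
  qed
  have "independent K (map f js)" if "set js \<subseteq> set is" "distinct js" for js
    using that
  proof (induction js)
    case (Cons j js)
    have j: "j \<in> set is" "j \<notin> set js" using Cons.prems by auto
    have "f j \<notin> Span K (map f js)"
    proof
      assume "f j \<in> Span K (map f js)"
      then obtain c where c: "\<And>i. i \<notin> set js \<Longrightarrow> c i = 0" "\<phi> (f j) = (\<Sum>i\<in>set is. \<kappa> (c i) * \<phi> (f i))"
        using Span[of js "f j"] Cons.prems by auto
      \<comment> \<open>Moving \<open>f j\<close> to the other side gives a relation whose
        coefficient at \<open>j\<close> is \<open>- 1\<close>, which is not zero.\<close>
      have "(\<Sum>i\<in>set is. \<kappa> ((c(j := - 1)) i) * \<phi> (f i)) = - \<phi> (f j) + (\<Sum>i\<in>set is - {j}. \<kappa> (c i) * \<phi> (f i))"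
        using j(1) by (simp add: sum.remove[of "set is" j] \<kappa>.hom_uminus \<kappa>.hom_one)
      also have "(\<Sum>i\<in>set is - {j}. \<kappa> (c i) * \<phi> (f i)) = \<phi> (f j)"
        unfolding c(2) using j c(1)[OF j(2)] by (simp add: sum.remove[of "set is" j])
      finally have "(\<Sum>i\<in>set is. \<kappa> ((c(j := - 1)) i) * \<phi> (f i)) = 0" by simp
      from bspec[OF indep[OF this] j(1)] show False by simp
    qed
    then show ?case using Cons f[OF j(1)] by (auto intro: li_Cons)
  qed auto
  then show ?thesis using dist by blast
qed

theorem corollary3p20:
  fixes n :: nat and ls :: "(nat set \<Rightarrow> nat list) list"
  assumes "n \<ge> 2"
    and "distinct ls"
    and "set ls \<subseteq> admissible n"
  shows "ring.independent (minor_algebra n)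
    (sl_scalars n :: 'a::{alg_closed_field, field_char_0} arc_poly set set)
    (map (minor_monomial n) ls)"
proof -
  let ?S = "sl_arc_ring n :: 'a arc_poly set ring"
  let ?W = "minor_algebra n :: 'a arc_poly set ring"
  let ?gens = "sl_scalars n \<union> {minor_coeff n I k | I k. I \<in> proper_subsets n} :: 'a arc_poly set set"
  let ?\<phi> = "specialize_class n :: 'a arc_poly set \<Rightarrow> 'a arc_poly fract"
  let ?\<kappa> = "\<lambda>c::'a. fract_of (pconst c :: 'a arc_poly)"
  have n: "n \<ge> 1" using assms(1) by simp
  interpret S: cring ?S by (rule cring_sl_arc_ring)
  interpret W: ring ?W by (rule ring_minor_algebra)
  interpret h: comm_ring_hom "specialize n :: 'a arc_poly \<Rightarrow> _" by (rule comm_ring_hom_specialize)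
  interpret \<iota>: comm_ring_hom "fract_of :: 'a arc_poly \<Rightarrow> _" by (rule comm_ring_hom_fract_of)
  have gens: "?gens \<subseteq> carrier ?S"
    by (auto simp: sl_scalars_def intro!: minor_coeff_closed sl_class_closed arc_poly_ring_closed)
  have ops: "zero ?W = zero ?S" "one ?W = one ?S" "add ?W = add ?S" "mult ?W = mult ?S"
    and carrier: "carrier ?W = generate_ring ?S ?gens"
    by (simp_all add: minor_algebra_def)
  have W_S: "carrier ?W \<subseteq> carrier ?S"
    unfolding carrier by (rule S.generate_ring_incl[OF gens])
  have coeff_W: "minor_coeff n I k \<in> carrier ?W" if "I \<in> proper_subsets n" for I k
    unfolding carrier by (rule generate_ring.incl) (use that in blast)
  have scalars_W: "sl_scalars n \<subseteq> carrier ?W"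
    unfolding carrier by (auto intro: generate_ring.incl)
  have \<phi>_one: "?\<phi> \<one>\<^bsub>?S\<^esub> = 1"
    using sl_class_hom(3)[OF arc_poly_ring_one_closed arc_poly_ring_one_closed, of n, where 'a = 'a]
    by (simp add: specialize_class[OF n] h.hom_one)
  have one_W: "\<one>\<^bsub>?S\<^esub> \<in> carrier ?W" using W.one_closed unfolding ops .
  have mult_W: "x \<otimes>\<^bsub>?S\<^esub> y \<in> carrier ?W" if "x \<in> carrier ?W" "y \<in> carrier ?W" for x y
    using W.m_closed[OF that] unfolding ops .
  \<comment> \<open>The products are formed in the full quotient ring, so membership in the
    subalgebra is tracked separately.\<close>
  note finprod_W = S.finprod_mem[OF one_W mult_W W_S]
  have mem: "minor_monomial n l \<in> carrier ?W" for l
    unfolding minor_monomial_def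
    by (intro finprod_W finite_proper_subsets finite_lessThan funcsetI coeff_W)
  have \<phi>_monomial: "?\<phi> (minor_monomial n l) = fract_of (minor_product low_minor n l)" for l
  proof -
    note image = S.finprod_image[where \<phi> = ?\<phi>, OF \<phi>_one specialize_class_hom(2)[OF n]]
    have inner: "?\<phi> (\<Otimes>\<^bsub>?S\<^esub>p\<in>{..<length (l I)}. minor_coeff n I (l I ! p))
        = (\<Prod>p<length (l I). fract_of (fps_nth (low_minor I) (l I ! p)))" if I: "I \<in> proper_subsets n" for I
    proof (subst image)
      show "(\<lambda>p. minor_coeff n I (l I ! p)) \<in> {..<length (l I)} \<rightarrow> carrier ?S"
        by (intro funcsetI minor_coeff_closed I)
    qed (simp_all add: minor_coeff_def specialize_class[OF n] specialize_minor[OF I])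
    have "?\<phi> (minor_monomial n l)
        = (\<Prod>I\<in>proper_subsets n. ?\<phi> (\<Otimes>\<^bsub>?S\<^esub>p\<in>{..<length (l I)}. minor_coeff n I (l I ! p)))"
      unfolding minor_monomial_def
      by (intro image finite_proper_subsets funcsetI S.finprod_closed minor_coeff_closed)
    also have "\<dots> = (\<Prod>I\<in>proper_subsets n. \<Prod>p<length (l I). fract_of (fps_nth (low_minor I) (l I ! p)))"
      by (intro prod.cong refl inner)
    finally show ?thesis by (simp add: minor_product_def \<iota>.hom_prod)
  qed
  show ?thesis
  proof (rule W.independent_if_image_independent[where \<phi> = ?\<phi> and \<kappa> = ?\<kappa>])
    show "?\<phi> \<zero>\<^bsub>?W\<^esub> = 0"
      using sl_class_hom(4)[OF arc_poly_ring_one_closed arc_poly_ring_one_closed, of n, where 'a = 'a]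
      by (simp add: ops specialize_class[OF n])
    show "?\<phi> (x \<oplus>\<^bsub>?W\<^esub> y) = ?\<phi> x + ?\<phi> y" "?\<phi> (x \<otimes>\<^bsub>?W\<^esub> y) = ?\<phi> x * ?\<phi> y"
      if "x \<in> carrier ?W" "y \<in> carrier ?W" for x y
      unfolding ops using specialize_class_hom[OF n, of x y] that W_S by auto
    show "\<exists>c. ?\<phi> k = ?\<kappa> c" if "k \<in> sl_scalars n" for k
      using that by (auto simp: sl_scalars_def specialize_class[OF n] arc_const_def specialize_const)
    show "\<forall>l\<in>set ls. c l = 0"
      if "(\<Sum>l\<in>set ls. ?\<kappa> (c l) * ?\<phi> (minor_monomial n l)) = 0" for c
    proof (rule low_minor_products_independent[OF finite_set assms(3)])
      have "fract_of (\<Sum>l\<in>set ls. pconst (c l) * minor_product low_minor n l :: 'a arc_poly) = 0"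
        using that by (simp only: \<phi>_monomial \<iota>.hom_sum \<iota>.hom_mult)
      then show "(\<Sum>l\<in>set ls. pconst (c l) * minor_product low_minor n l :: 'a arc_poly) = 0"
        by (simp only: fract_of_eq_0)
    qed
  qed (use mem scalars_W assms(2) comm_ring_hom_fract_const in auto)
qed

end
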